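(* Let $k\geq2$ be an integer. With \[E_x(q,a)=\sum_{\substack{n\leq x\\ n\equiv a\ (\mathrm{mod}\ q)}}d_k(n)-\frac{x f_x(q,a)}{q},\qquad V(x,Q)=\sum_{q\leq Q}\sum_{a=1}^{q}|E_x(q,a)|^2,\] we have for $1\leq Q\leq x$ and every $\epsilon>0$ \[V(x,Q)\ll_\epsilon x^\epsilon\big(xQ+x^{2-1/k}\big)\ \text{ if }k>2,\qquad V(x,Q)\ll_\epsilon x^\epsilon\, xQ\ \text{ if }k=2.\]
   Context: $d_k(n)$ is the number of ordered $k$-tuples of positive integers with product $n$. For $q,a\in\mathbb N$ and $x\geq1$, \[f_x(q,a)=\frac{q}{\phi\big(q/(q,a)\big)}\,\mathrm{Res}_{s=1}\Big\{\frac{x^{s-1}}{s}\sum_{\substack{n\geq1\\ (n,q)=(q,a)}}\frac{d_k(n)}{n^s}\Big\}.\] *)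

theory Defs
  imports "HOL-Complex_Analysis.Complex_Analysis" "HOL-Number_Theory.Totient" "HOL-Number_Theory.Cong"
begin

definition divisor_fun :: "nat \<Rightarrow> nat \<Rightarrow> nat" where
  "divisor_fun k n =
     card {ms :: nat list. length ms = k \<and> (\<forall>m\<in>set ms. 0 < m) \<and> prod_list ms = n}"

text \<open>The series converges (absolutely) exactly when \<open>Re s > 1\<close>; elsewhere the value of the
  infinite sum is meaningless and must not be used.\<close>

definition divisor_series :: "nat \<Rightarrow> nat \<Rightarrow> nat \<Rightarrow> complex \<Rightarrow> complex" where
  "divisor_series k q a s =
     (\<Sum>\<^sub>\<infinity>n\<in>{n::nat. 1 \<le> n \<and> gcd n q = gcd q a}. of_nat (divisor_fun k n) / of_nat n powr s)"

text \<open>The residue at \<open>s = 1\<close> refers to the analytic continuation of the series across the line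
  \<open>Re s = 1\<close>. On the connected open set \<open>{s. 0 < Re s} - {1}\<close> the continuation is unique by the
  identity theorem, so the choice operator only leaves the values outside that set undetermined,
  and the residue at 1 does not depend on those.\<close>

definition divisor_series_cont :: "nat \<Rightarrow> nat \<Rightarrow> nat \<Rightarrow> complex \<Rightarrow> complex" where
  "divisor_series_cont k q a =
     (SOME F. F holomorphic_on ({s. 0 < Re s} - {1}) \<and>
              (\<forall>s. 1 < Re s \<longrightarrow> F s = divisor_series k q a s))"

definition main_coeff :: "nat \<Rightarrow> real \<Rightarrow> nat \<Rightarrow> nat \<Rightarrow> complex" where
  "main_coeff k x q a =
     of_nat q / of_nat (totient (q div gcd q a)) *
     residue (\<lambda>s. of_real x powr (s - 1) / s * divisor_series_cont k q a s) 1"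

definition AP_error :: "nat \<Rightarrow> real \<Rightarrow> nat \<Rightarrow> nat \<Rightarrow> complex" where
  "AP_error k x q a =
     (\<Sum>n\<in>{n::nat. 1 \<le> n \<and> real n \<le> x \<and> [n = a] (mod q)}. of_nat (divisor_fun k n))
     - of_real x * main_coeff k x q a / of_nat q"

definition AP_variance :: "nat \<Rightarrow> real \<Rightarrow> real \<Rightarrow> real" where
  "AP_variance k x Q =
     (\<Sum>q\<in>{q::nat. 1 \<le> q \<and> real q \<le> Q}. \<Sum>a=1..q. (cmod (AP_error k x q a))\<^sup>2)"

end

theory Submission
  imports Defs "HOL-Computational_Algebra.Fundamental_Theorem_Algebra"
begin

text \<open>
  Replace the main term of the progression \<open>a mod q\<close> by the average of the progression sums over all
  residues with the same gcd with \<open>q\<close>. This average is a least squares approximation, so the variance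
  around it is at most the variance around any other function of \<open>gcd(a, q)\<close>. By Parseval modulo
  \<open>q\<close> one is left with the sum over \<open>r \<le> Q\<close> and \<open>h\<close> coprime to \<open>r\<close> of \<open>|S(h/r) - c\<^sub>r|\<^sup>2 / r\<close>, where
  \<open>S(t) = \<Sum>\<^sub>n\<^sub>\<le>\<^sub>x d\<^sub>k(n) e(nt)\<close> and the \<open>c\<^sub>r\<close> may be chosen freely. For \<open>r \<le> x\<^sup>1\<^sup>/\<^sup>k\<close> the Dirichlet hyperbola method
  (the product of some \<open>k - 1\<close> factors is at most \<open>x\<^sup>1\<^sup>-\<^sup>1\<^sup>/\<^sup>k\<close>, and the sum over the last one is geometric) gives
  \<open>S(h/r) - c\<^sub>r \<lless> x\<^sup>1\<^sup>-\<^sup>1\<^sup>/\<^sup>k\<^sup>+\<^sup>\<epsilon>\<close>; larger \<open>r\<close> are handled by the large sieve inequality.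

  The averages are compared with the residues through the elementary asymptotics
  \<open>y P(log y) + O(y\<^sup>1\<^sup>-\<^sup>1\<^sup>/\<^sup>k\<^sup>+\<^sup>\<epsilon>)\<close> of the sum of \<open>d\<^sub>k(n)\<close> over \<open>n \<le> y\<close>. The polynomial \<open>P\<close> is identified with the
  residue of \<open>y\<^sup>s\<^sup>-\<^sup>1 \<zeta>(s)\<^sup>k / s\<close> at 1 by letting \<open>s\<close> tend to 1 from the right in the Dirichlet series. The
  condition \<open>gcd(n, q) = g\<close> is removed by writing the restricted divisor function as the convolution
  of \<open>d\<^sub>k\<close> with a weight of small mass that is supported on multiples of \<open>g\<close>.
\<close>

section \<open>Dirichlet convolution and the divisor functions\<close>

text \<open>The freedom in the choice of c_r is that of replacing the averages by another function
  of gcd(a, q): such functions are the ones whose transform modulo q depends on b only through r = q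
  / gcd(b, q). The choice made below collects the cofactors divisible by r, for which the geometric
  sums degenerate. The cut at R = x^(1/k) balances R x^(2-2/k) from the pointwise bound against x^2
  / R from the large sieve; both equal x^(2-1/k). For k = 2 this term must not survive: if Q <= R
  only the first range occurs and costs Q x, and if Q > R then x^(3/2) <= x Q. The dependence on
  min(R, Q) is therefore kept until the very end. The comparison with the residues costs x^(2-2/k)
  after squaring and summing, which is below x^(2-1/k) and equals x for k = 2. So the elementary
  exponent 1 - 1/k is good enough, and no functional equation or contour integral enters. Since
  x^eps absorbs logarithms and divisor functions, crude forms of the large sieve and of the lower
  bound for the totient suffice.\<close>

definition divs :: "nat \<Rightarrow> (nat \<times> nat) set" where
  "divs n = {(a, b). 0 < n \<and> a * b = n}"

text \<open>The condition \<open>0 < n\<close> in \<open>divs\<close> keeps the index set finite at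
  0 and makes every convolution vanish there.\<close>

definition dconv :: "(nat \<Rightarrow> real) \<Rightarrow> (nat \<Rightarrow> real) \<Rightarrow> nat \<Rightarrow> real" where
  "dconv f g n = (\<Sum>(a, b)\<in>divs n. f a * g b)"

lemma finite_divs [simp, intro]: "finite (divs n)"
proof -
  have "divs n \<subseteq> {..n} \<times> {..n}"
    by (auto simp: divs_def)
  then show ?thesis
    by (rule finite_subset) auto
qed

lemma dconv_0 [simp]: "dconv f g 0 = 0"
  by (simp add: dconv_def divs_def)

lemma dconv_commute: "dconv f g n = dconv g f n"
  unfolding dconv_def
  by (rule sum.reindex_bij_witness[where i = "\<lambda>(a, b). (b, a)" and j = "\<lambda>(a, b). (b, a)"])
     (auto simp: divs_def mult.commute)

lemma dconv_assoc: "dconv (dconv f g) h n = dconv f (dconv g h) n"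
proof -
  have "dconv (dconv f g) h n = (\<Sum>(x, c)\<in>divs n. \<Sum>(a, b)\<in>divs x. f a * g b * h c)"
    unfolding dconv_def by (intro sum.cong refl) (auto simp: sum_distrib_right case_prod_unfold)
  also have "\<dots> = (\<Sum>((x, c), (a, b))\<in>Sigma (divs n) (\<lambda>(x, c). divs x). f a * g b * h c)"
    by (subst sum.Sigma [symmetric]) (auto simp: case_prod_unfold)
  also have "\<dots> = (\<Sum>((a, y), (b, c))\<in>Sigma (divs n) (\<lambda>(a, y). divs y). f a * g b * h c)"
    by (rule sum.reindex_bij_witness[where i = "\<lambda>((a, y), (b, c)). ((a * b, c), (a, b))"
          and j = "\<lambda>((x, c), (a, b)). ((a, b * c), (b, c))"]) (auto simp: divs_def)
  also have "\<dots> = (\<Sum>(a, y)\<in>divs n. \<Sum>(b, c)\<in>divs y. f a * g b * h c)"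
    by (subst sum.Sigma [symmetric]) (auto simp: case_prod_unfold)
  also have "\<dots> = dconv f (dconv g h) n"
    unfolding dconv_def
    by (intro sum.cong refl) (auto simp: sum_distrib_left case_prod_unfold mult.assoc)
  finally show ?thesis .
qed

lemma dconv_add_left: "dconv (\<lambda>n. f n + g n) h n = dconv f h n + dconv g h n"
  unfolding dconv_def by (simp add: case_prod_unfold ring_distribs sum.distrib)

lemma dconv_add_right: "dconv h (\<lambda>n. f n + g n) n = dconv h f n + dconv h g n"
  unfolding dconv_def by (simp add: case_prod_unfold ring_distribs sum.distrib)

lemma dconv_sum_left: "dconv (\<lambda>n. \<Sum>i\<in>I. f i n) h n = (\<Sum>i\<in>I. dconv (f i) h n)"
  unfolding dconv_def
  by (subst sum.swap) (simp add: case_prod_unfold sum_distrib_right)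

lemma dconv_cong:
  assumes "\<And>n. n > 0 \<Longrightarrow> f n = f' n" "\<And>n. n > 0 \<Longrightarrow> g n = g' n"
  shows "dconv f g n = dconv f' g' n"
  unfolding dconv_def
proof (rule sum.cong[OF refl], clarify)
  fix a b assume "(a, b) \<in> divs n"
  then have "a > 0" "b > 0"
    by (auto simp: divs_def intro!: Nat.gr0I)
  with assms show "f a * g b = f' a * g' b"
    by simp
qed

lemma dconv_mono:
  assumes "\<And>n. 0 \<le> f n" "\<And>n. f n \<le> f' n" "\<And>n. 0 \<le> g n" "\<And>n. g n \<le> g' n"
  shows "dconv f g n \<le> dconv f' g' n"
  unfolding dconv_def
  by (intro sum_mono) (auto intro!: mult_mono assms order_trans[OF assms(1) assms(2)])

lemma dconv_nonneg:
  assumes "\<And>n. 0 \<le> f n" "\<And>n. 0 \<le> g n"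
  shows "0 \<le> dconv f g n"
  unfolding dconv_def by (intro sum_nonneg) (auto intro!: mult_nonneg_nonneg assms)

text \<open>Sort the pairs (a, b) with a b <= N by b; what remains is a <= N div b. The values of
  \<open>\<phi>\<close> lie in an arbitrary real vector space, so that one identity serves plain
  counting (with the constant 1) and exponential sums.\<close>

lemma sum_dconv:
  fixes \<phi> :: "nat \<Rightarrow> 'a::real_vector"
  shows "(\<Sum>n=1..N. dconv f g n *\<^sub>R \<phi> n) = (\<Sum>b=1..N. g b *\<^sub>R (\<Sum>a=1..N div b. f a *\<^sub>R \<phi> (a * b)))"
proof -
  have "(\<Sum>n=1..N. dconv f g n *\<^sub>R \<phi> n) = (\<Sum>n=1..N. \<Sum>(a, b)\<in>divs n. (f a * g b) *\<^sub>R \<phi> n)"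
    unfolding dconv_def by (intro sum.cong refl) (simp add: scaleR_sum_left case_prod_unfold)
  also have "\<dots> = (\<Sum>(n, (a, b))\<in>Sigma {1..N} divs. (f a * g b) *\<^sub>R \<phi> n)"
    by (subst sum.Sigma) auto
  also have "\<dots> = (\<Sum>(b, a)\<in>Sigma {1..N} (\<lambda>b. {1..N div b}). (f a * g b) *\<^sub>R \<phi> (a * b))"
  proof (rule sum.reindex_bij_witness[where i = "\<lambda>(b, a). (a * b, (a, b))" and j = "\<lambda>(n, (a, b)). (b, a)"])
    fix x assume x: "x \<in> Sigma {1..N} divs"
    obtain n a b where xe: "x = (n, (a, b))"
      using prod_cases3 by blast
    have h: "0 < a * b" "a * b \<le> N" "n = a * b"
      using x xe by (auto simp: divs_def)
    have "1 \<le> a"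
      using h(1) by (cases a) auto
    then have "1 * b \<le> a * b"
      by (intro mult_right_mono) auto
    then have "b \<le> N"
      using h(2) by linarith
    moreover have "a \<le> N div b"
      using h by (metis div_le_mono nonzero_mult_div_cancel_right mult_0_right less_irrefl)
    ultimately show "(case x of (n, a, b) \<Rightarrow> (b, a)) \<in> Sigma {1..N} (\<lambda>b. {1..N div b})"
      using h xe by auto
    show "(case case x of (n, a, b) \<Rightarrow> (b, a) of (b, a) \<Rightarrow> (a * b, a, b)) = x"
      using h xe by auto
    show "(case case x of (n, a, b) \<Rightarrow> (b, a) of (b, a) \<Rightarrow> (f a * g b) *\<^sub>R \<phi> (a * b)) =
         (case x of (n, a, b) \<Rightarrow> (f a * g b) *\<^sub>R \<phi> n)"
      using h xe by auto
  next
    fix y assume y: "y \<in> Sigma {1..N} (\<lambda>b. {1..N div b})"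
    obtain b a where ye: "y = (b, a)" by force
    have h: "1 \<le> b" "1 \<le> a" "a \<le> N div b" using y ye by auto
    have "a * b \<le> N div b * b"
      using h by (intro mult_right_mono) auto
    also have "\<dots> \<le> N" by simp
    finally have "a * b \<le> N" .
    then show "(case y of (b, a) \<Rightarrow> (a * b, a, b)) \<in> Sigma {1..N} divs"
      using h ye by (auto simp: divs_def)
    show "(case case y of (b, a) \<Rightarrow> (a * b, a, b) of (n, a, b) \<Rightarrow> (b, a)) = y"
      using ye by simp
  qed
  also have "\<dots> = (\<Sum>b=1..N. \<Sum>a=1..N div b. (f a * g b) *\<^sub>R \<phi> (a * b))"
    by (subst sum.Sigma) auto
  also have "\<dots> = (\<Sum>b=1..N. g b *\<^sub>R (\<Sum>a=1..N div b. f a *\<^sub>R \<phi> (a * b)))"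
    by (simp add: scaleR_sum_right mult.commute)
  finally show ?thesis .
qed

section \<open>Divisor functions as convolution powers\<close>

abbreviation dk :: "nat \<Rightarrow> nat \<Rightarrow> real" where
  "dk k n \<equiv> real (divisor_fun k n)"

text \<open>Each entry of a tuple of positive integers is at most the product. Finiteness matters
  because \<open>card\<close> returns 0 on infinite sets.\<close>

lemma divisor_fun_finite: "finite {ms :: nat list. length ms = k \<and> (\<forall>m\<in>set ms. 0 < m) \<and> prod_list ms = n}"
proof -
  have "m \<le> prod_list ms" if "\<forall>m\<in>set ms. 0 < m" "m \<in> set ms" for m :: nat and ms
    using that
  proof (induction ms)
    case (Cons a ms)
    have p: "prod_list ms > 0"
      using Cons.prems(1) by (induction ms) auto
    show ?case
    proof (cases "m = a")
      case True
      then show ?thesis using p by simp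
    next
      case False
      then have "m \<le> 1 * prod_list ms" using Cons by simp
      also have "\<dots> \<le> a * prod_list ms"
        using Cons.prems by (intro mult_right_mono) auto
      finally show ?thesis by simp
    qed
  qed auto
  then have "{ms. length ms = k \<and> (\<forall>m\<in>set ms. 0 < m) \<and> prod_list ms = n} \<subseteq> {ms. set ms \<subseteq> {..n} \<and> length ms = k}"
    by auto
  then show ?thesis
    by (rule finite_subset) (rule finite_lists_length_eq, simp)
qed

lemma dk_0: "dk 0 n = (if n = 1 then 1 else 0)"
proof -
  have "{ms :: nat list. length ms = 0 \<and> (\<forall>m\<in>set ms. 0 < m) \<and> prod_list ms = n} = (if n = 1 then {[]} else {})"
    by auto
  then show ?thesis by (simp add: divisor_fun_def)
qed

lemma dk_at_0 [simp]: "divisor_fun k 0 = 0"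
proof -
  have "prod_list ms \<noteq> 0" if "\<forall>m\<in>set ms. 0 < m" for ms :: "nat list"
    using that by (induction ms) auto
  then have "{ms. length ms = k \<and> (\<forall>m\<in>set ms. 0 < m) \<and> prod_list ms = (0::nat)} = {}"
    by blast
  then show ?thesis
    by (simp only: divisor_fun_def card.empty)
qed

text \<open>Removing the head of the list. From here on the tuples are replaced by this recursion,
  which starts at the unit \<open>dk 0\<close> of the convolution.\<close>

lemma dk_Suc: "dk (Suc k) n = dconv (\<lambda>_. 1) (dk k) n"
proof (cases "n = 0")
  case False
  let ?L = "\<lambda>k n. {ms :: nat list. length ms = k \<and> (\<forall>m\<in>set ms. 0 < m) \<and> prod_list ms = n}"
  have "bij_betw (\<lambda>((a, b), ms). a # ms) (Sigma (divs n) (\<lambda>(a, b). ?L k b)) (?L (Suc k) n)"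
  proof (rule bij_betw_imageI)
    show "inj_on (\<lambda>((a, b), ms). a # ms) (Sigma (divs n) (\<lambda>(a, b). ?L k b))"
      by (auto simp: inj_on_def)
    show "(\<lambda>((a, b), ms). a # ms) ` Sigma (divs n) (\<lambda>(a, b). ?L k b) = ?L (Suc k) n"
    proof (intro equalityI subsetI)
      fix xs assume xs: "xs \<in> ?L (Suc k) n"
      then obtain a ms where e: "xs = a # ms"
        by (cases xs) auto
      have "((a, prod_list ms), ms) \<in> Sigma (divs n) (\<lambda>(a, b). ?L k b)"
        using xs e False by (auto simp: divs_def)
      then show "xs \<in> (\<lambda>((a, b), ms). a # ms) ` Sigma (divs n) (\<lambda>(a, b). ?L k b)"
        by (rule rev_image_eqI) (simp add: e)
    next
      fix xs assume "xs \<in> (\<lambda>((a, b), ms). a # ms) ` Sigma (divs n) (\<lambda>(a, b). ?L k b)"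
      then obtain t where t: "t \<in> Sigma (divs n) (\<lambda>(a, b). ?L k b)" "xs = (\<lambda>((a, b), ms). a # ms) t"
        by (rule imageE)
      obtain a b ms where te: "t = ((a, b), ms)"
        by (metis surj_pair)
      have h: "xs = a # ms" "(a, b) \<in> divs n" "ms \<in> ?L k b"
        using t te by simp_all
      have "a > 0" using h(2) by (cases a) (auto simp: divs_def)
      then show "xs \<in> ?L (Suc k) n"
        using h by (simp add: divs_def)
    qed
  qed
  then have "card (?L (Suc k) n) = card (Sigma (divs n) (\<lambda>(a, b). ?L k b))"
    by (rule bij_betw_same_card [symmetric])
  also have "\<dots> = (\<Sum>(a, b)\<in>divs n. card (?L k b))"
    by (subst card_SigmaI) (auto simp: divisor_fun_finite case_prod_unfold)
  finally show ?thesis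
    unfolding divisor_fun_def dconv_def by (simp add: case_prod_unfold)
qed simp

lemma dconv_delta: "dconv f (dk 0) n = (if n = 0 then 0 else f n)"
proof (cases "n = 0")
  case False
  have "dconv f (dk 0) n = (\<Sum>x\<in>divs n. if x = (n, 1) then f n else 0)"
    unfolding dconv_def dk_0 by (intro sum.cong) (auto simp: divs_def split: if_splits)
  also have "\<dots> = f n"
    using False by (subst sum.delta[OF finite_divs]) (auto simp: divs_def)
  finally show ?thesis using False by simp
qed simp

lemma dk_1: "dk 1 n = (if n = 0 then 0 else 1)"
  using dk_Suc[of 0 n] dconv_delta[of "\<lambda>_. 1" n] by simp

section \<open>The divisor bound\<close>

definition tau :: "nat \<Rightarrow> nat" where "tau n = card {d. d dvd n}"

lemma tau_mono: "d dvd n \<Longrightarrow> n > 0 \<Longrightarrow> tau d \<le> tau n"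
  unfolding tau_def by (intro card_mono) (auto intro: dvd_trans)

lemma card_divs: "n > 0 \<Longrightarrow> card (divs n) = tau n"
proof -
  assume n: "n > 0"
  have "bij_betw fst (divs n) {d. d dvd n}"
  proof (rule bij_betw_imageI)
    show "inj_on fst (divs n)"
      by (auto simp: inj_on_def divs_def)
    show "fst ` divs n = {d. d dvd n}"
      using n by (force simp: divs_def image_iff elim!: dvdE)
  qed
  then show ?thesis unfolding tau_def by (rule bij_betw_same_card)
qed

text \<open>Every divisor of a b is a product of a divisor of a and one of b. Submultiplicativity is
  enough for upper bounds, so coprimality is not asked for.\<close>

lemma tau_mult_le: "a > 0 \<Longrightarrow> b > 0 \<Longrightarrow> tau (a * b) \<le> tau a * tau b"
proof -
  assume ab: "a > 0" "b > 0"
  have "{d. d dvd a * b} \<subseteq> (\<lambda>(x, y). x * y) ` ({d. d dvd a} \<times> {d. d dvd b})"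
  proof
    fix d assume "d \<in> {d. d dvd a * b}"
    then obtain x y where "d = x * y" "x dvd a" "y dvd b"
      using dvd_productE by blast
    then show "d \<in> (\<lambda>(x, y). x * y) ` ({d. d dvd a} \<times> {d. d dvd b})"
      by force
  qed
  then have "tau (a * b) \<le> card ((\<lambda>(x, y). x * y) ` ({d. d dvd a} \<times> {d. d dvd b}))"
    unfolding tau_def using ab by (intro card_mono) auto
  also have "\<dots> \<le> card ({d. d dvd a} \<times> {d. d dvd b})"
    using ab by (intro card_image_le) auto
  finally show ?thesis by (simp add: tau_def card_cartesian_product)
qed

lemma tau_prime_power: "prime p \<Longrightarrow> tau (p ^ e) \<le> e + 1"
proof -
  assume p: "prime p"
  have "{d. d dvd p ^ e} = (\<lambda>i. p ^ i) ` {..e}"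
    using p by (auto simp: divides_primepow_nat)
  then have "tau (p ^ e) \<le> card {..e}"
    unfolding tau_def using card_image_le[of "{..e}"] by simp
  then show ?thesis by simp
qed

lemma tau_prod_prime_powers:
  assumes "finite P" "\<And>p. p \<in> P \<Longrightarrow> prime p"
  shows "tau (\<Prod>p\<in>P. p ^ e p) \<le> (\<Prod>p\<in>P. e p + 1)"
  using assms
proof (induction P rule: finite_induct)
  case empty
  then show ?case by (simp add: tau_def)
next
  case (insert p P)
  have "tau (\<Prod>p\<in>insert p P. p ^ e p) = tau (p ^ e p * (\<Prod>p\<in>P. p ^ e p))"
    using insert by simp
  also have "\<dots> \<le> tau (p ^ e p) * tau (\<Prod>p\<in>P. p ^ e p)"
    using insert by (intro tau_mult_le) (auto intro!: prod_pos simp: prime_gt_0_nat)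
  also have "\<dots> \<le> (e p + 1) * (\<Prod>p\<in>P. e p + 1)"
    using insert by (intro mult_le_mono tau_prime_power) auto
  finally show ?case using insert by simp
qed

lemma Suc_le_const_mult_exp:
  fixes c :: real
  assumes "c > 0"
  shows "real e + 1 \<le> max 1 (1 / c) * exp (c * real e)"
proof -
  let ?K = "max 1 (1 / c)"
  have "real e = (1 / c) * (c * real e)" using assms by simp
  also have "\<dots> \<le> ?K * (c * real e)"
    using assms by (intro mult_right_mono) auto
  finally have "real e + 1 \<le> ?K * (c * real e) + ?K" by simp
  also have "\<dots> = ?K * (1 + c * real e)" by (simp add: algebra_simps)
  also have "\<dots> \<le> ?K * exp (c * real e)"
    by (intro mult_left_mono exp_ge_add_one_self) auto
  finally show ?thesis .
qed

text \<open>Compare tau(n) with n^eps prime by prime. If p^eps >= 2, the factor e + 1 is at most 2^e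
  and hence at most p^(e eps). The fewer than B + 1 remaining primes satisfy p^(e eps) >= 2^(e eps)
  = exp(c e) with c = eps ln 2, so that each loses at most the constant K. This gives the total
  constant K^B.\<close>

theorem tau_bound:
  fixes \<epsilon> :: real
  assumes "\<epsilon> > 0"
  obtains C where "C \<ge> 1" "\<And>n. n > 0 \<Longrightarrow> real (tau n) \<le> C * real n powr \<epsilon>"
proof -
  define c where "c = \<epsilon> * ln 2"
  have c: "c > 0" using assms by (simp add: c_def)
  define K where "K = max 1 (1 / c)"
  define B :: nat where "B = nat \<lceil>2 powr (1 / \<epsilon>)\<rceil>"
  have K: "K \<ge> 1" by (simp add: K_def)
  have local_bound: "real e + 1 \<le> (if p < B then K else 1) * (real p ^ e) powr \<epsilon>"
    if p: "prime p" for p e :: nat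
  proof (cases "p < B")
    case True
    have p2: "real p \<ge> 2" using prime_ge_2_nat[OF p] by simp
    have "exp (c * real e) = (2 ^ e) powr \<epsilon>"
      by (simp add: powr_def c_def ln_realpow mult_ac)
    also have "\<dots> \<le> (real p ^ e) powr \<epsilon>"
      using p2 assms by (intro powr_mono2 power_mono) auto
    finally have "K * exp (c * real e) \<le> K * (real p ^ e) powr \<epsilon>"
      using K by (intro mult_left_mono) auto
    then show ?thesis using Suc_le_const_mult_exp[OF c, of e] True by (simp add: K_def)
  next
    case False
    have p0: "real p > 0" using prime_gt_0_nat[OF p] by simp
    have "2 powr (1 / \<epsilon>) \<le> real B" by (simp add: B_def)
    also have "\<dots> \<le> real p" using False by simp
    finally have "(2 powr (1 / \<epsilon>)) powr \<epsilon> \<le> real p powr \<epsilon>"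
      using assms by (intro powr_mono2) auto
    then have 2: "2 \<le> real p powr \<epsilon>" using assms by (simp add: powr_powr)
    have "real e + 1 \<le> 2 ^ e"
      by (induction e) auto
    also have "\<dots> \<le> (real p powr \<epsilon>) ^ e"
      using 2 by (intro power_mono) auto
    also have "\<dots> = (real p ^ e) powr \<epsilon>"
      using p0 by (simp add: powr_realpow[symmetric] powr_powr mult.commute)
    finally show ?thesis using False by simp
  qed
  have "real (tau n) \<le> K ^ B * real n powr \<epsilon>" if n: "n > 0" for n
  proof -
    let ?P = "prime_factors n"
    let ?e = "\<lambda>p. multiplicity p n"
    have ne: "n = (\<Prod>p\<in>?P. p ^ ?e p)"
      using n by (simp add: prime_factorization_nat)
    have "real (tau n) \<le> real (\<Prod>p\<in>?P. ?e p + 1)"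
      by (subst (1) ne, unfold of_nat_le_iff, rule tau_prod_prime_powers) auto
    also have "\<dots> = (\<Prod>p\<in>?P. real (?e p) + 1)" by (simp add: add.commute)
    also have "\<dots> \<le> (\<Prod>p\<in>?P. (if p < B then K else 1) * (real p ^ ?e p) powr \<epsilon>)"
      by (intro prod_mono conjI local_bound) auto
    also have "\<dots> = (\<Prod>p\<in>?P. if p < B then K else 1) * (\<Prod>p\<in>?P. (real p ^ ?e p) powr \<epsilon>)"
      by (simp add: prod.distrib)
    also have "(\<Prod>p\<in>?P. (real p ^ ?e p) powr \<epsilon>) = (\<Prod>p\<in>?P. real p ^ ?e p) powr \<epsilon>"
      by (rule prod_powr_distrib [symmetric])
    also have "(\<Prod>p\<in>?P. real p ^ ?e p) = real n"
      by (subst (2) ne) simp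
    also have "(\<Prod>p\<in>?P. if p < B then K else 1) = K ^ card (?P \<inter> {p. p < B})"
      by (subst prod.If_cases) auto
    also have "\<dots> \<le> K ^ B"
    proof (intro power_increasing K)
      have "card (?P \<inter> {p. p < B}) \<le> card {..<B}"
        by (intro card_mono) auto
      then show "card (?P \<inter> {p. p < B}) \<le> B" by simp
    qed
    finally show ?thesis by (simp add: mult_right_mono)
  qed
  moreover have "K ^ B \<ge> 1" using K by simp
  ultimately show ?thesis using that by blast
qed

text \<open>One factor tau(n) per convolution, because tau(b) <= tau(n) for every divisor b of
  n.\<close>

lemma dk_le_tau: "n > 0 \<Longrightarrow> dk k n \<le> real (tau n) ^ k"
proof (induction k arbitrary: n)
  case 0
  then show ?case by (simp add: dk_0)
next
  case (Suc k)
  have "dk (Suc k) n = (\<Sum>(a, b)\<in>divs n. dk k b)"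
    unfolding dk_Suc dconv_def by simp
  also have "\<dots> \<le> (\<Sum>(a, b)\<in>divs n. real (tau n) ^ k)"
  proof (intro sum_mono, clarify)
    fix a b assume ab: "(a, b) \<in> divs n"
    then have b: "b > 0" "b dvd n" by (auto simp: divs_def intro!: Nat.gr0I)
    have "dk k b \<le> real (tau b) ^ k" using Suc.IH b by simp
    also have "\<dots> \<le> real (tau n) ^ k"
      using tau_mono[OF b(2) Suc.prems] by (intro power_mono) auto
    finally show "dk k b \<le> real (tau n) ^ k" .
  qed
  also have "\<dots> = real (tau n) ^ Suc k"
    using card_divs[OF Suc.prems] by (simp add: case_prod_unfold)
  finally show ?case .
qed

lemma dk_bound:
  fixes \<epsilon> :: real
  assumes "\<epsilon> > 0"
  obtains C where "C \<ge> 1" "\<And>n. n > 0 \<Longrightarrow> dk k n \<le> C * real n powr \<epsilon>"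
proof (cases "k = 0")
  case True
  show ?thesis
    by (rule that[of 1]) (use True assms in \<open>auto simp: dk_0 intro: order.trans[OF _ powr_ge_zero]\<close>)
next
  case False
  then have "\<epsilon> / k > 0" using assms by simp
  then obtain C where C: "C \<ge> 1" "\<And>n. n > 0 \<Longrightarrow> real (tau n) \<le> C * real n powr (\<epsilon> / k)"
    using tau_bound by blast
  have "dk k n \<le> C ^ k * real n powr \<epsilon>" if n: "n > 0" for n
  proof -
    have "dk k n \<le> real (tau n) ^ k" by (rule dk_le_tau[OF n])
    also have "\<dots> \<le> (C * real n powr (\<epsilon> / k)) ^ k"
      by (intro power_mono C n) auto
    also have "\<dots> = C ^ k * real n powr \<epsilon>"
      using False n by (simp add: power_mult_distrib powr_realpow[symmetric] powr_powr)
    finally show ?thesis .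
  qed
  then show ?thesis using that[of "C ^ k"] C(1) by simp
qed

text \<open>Splitting off the first factor exceeding \<open>z\<close>: every \<open>k\<close>-tuple either has all its entries
  at most \<open>z\<close>, or a distinguished entry greater than \<open>z\<close>.\<close>

fun alpha :: "nat \<Rightarrow> nat \<Rightarrow> nat \<Rightarrow> real" where
  "alpha z 0 = dk 0"
| "alpha z (Suc k) = dconv (\<lambda>m. if m \<le> z then 1 else 0) (alpha z k)"

text \<open>The cofactor of the distinguished entry: the entries before it are at most z, those
  after it are free. With u the indicator of [1, z], unrolling gives the sum over j <= k of the j-th
  convolution power of u convolved with \<open>dk (k - j)\<close>.\<close>

fun beta :: "nat \<Rightarrow> nat \<Rightarrow> nat \<Rightarrow> real" where
  "beta z 0 = dk 0"
| "beta z (Suc k) = (\<lambda>n. dconv (\<lambda>m. if m \<le> z then 1 else 0) (beta z k) n + dk (Suc k) n)"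

text \<open>Write 1 = u + v with u, v the indicators of m <= z and m > z. In the induction step the
  new first entry is either the distinguished one, which leaves the free cofactor
  \<open>dk (Suc k)\<close>, or it is at most z and the split of the other entries applies.
  Commuting v to the front collects both cases in \<open>beta\<close>.\<close>

lemma dk_split:
  "dk (Suc k) n = dconv (\<lambda>m. if m \<le> z then 1 else 0) (alpha z k) n
                + dconv (\<lambda>m. if m > z then 1 else 0) (beta z k) n"
proof (induction k arbitrary: n)
  case 0
  show ?case
    using dk_1[of n] dconv_delta[of "\<lambda>m. if m \<le> z then 1 else 0" n]
      dconv_delta[of "\<lambda>m. if m > z then 1 else 0" n] by simp
next
  case (Suc k)
  let ?u = "\<lambda>m::nat. if m \<le> z then 1 else 0 :: real"
  let ?v = "\<lambda>m::nat. if m > z then 1 else 0 :: real"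
  have "dk (Suc (Suc k)) n = dconv (\<lambda>m. ?u m + ?v m) (dk (Suc k)) n"
    unfolding dk_Suc[of "Suc k"] by (intro dconv_cong) auto
  also have "\<dots> = dconv ?u (dk (Suc k)) n + dconv ?v (dk (Suc k)) n"
    by (rule dconv_add_left)
  also have "dconv ?u (dk (Suc k)) n = dconv ?u (\<lambda>n. dconv ?u (alpha z k) n + dconv ?v (beta z k) n) n"
    using Suc.IH by (intro dconv_cong) auto
  also have "\<dots> = dconv ?u (dconv ?u (alpha z k)) n + dconv ?u (dconv ?v (beta z k)) n"
    by (rule dconv_add_right)
  also have "dconv ?u (dconv ?v (beta z k)) n = dconv (dconv ?u ?v) (beta z k) n"
    by (simp add: dconv_assoc)
  also have "\<dots> = dconv (dconv ?v ?u) (beta z k) n"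
    by (intro dconv_cong dconv_commute refl)
  also have "\<dots> = dconv ?v (dconv ?u (beta z k)) n"
    by (simp add: dconv_assoc)
  finally show ?case by (simp add: dconv_add_right)
qed

lemma alpha_nonneg: "alpha z k n \<ge> 0"
  by (induction k arbitrary: n) (auto intro!: dconv_nonneg)

lemma beta_nonneg: "beta z k n \<ge> 0"
  by (induction k arbitrary: n) (auto intro!: dconv_nonneg add_nonneg_nonneg)

lemma alpha_le: "alpha z k n \<le> dk k n"
proof (induction k arbitrary: n)
  case (Suc k)
  show ?case unfolding dk_Suc alpha.simps
    by (intro dconv_mono Suc.IH alpha_nonneg) auto
qed simp

text \<open>There are k + 1 positions for the distinguished entry, and each contributes at most
  \<open>dk k n\<close>.\<close>

lemma beta_le: "beta z k n \<le> real (Suc k) * dk k n"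
proof (induction k arbitrary: n)
  case (Suc k)
  have "beta z (Suc k) n \<le> dconv (\<lambda>_. 1) (\<lambda>n. real (Suc k) * dk k n) n + dk (Suc k) n"
    unfolding beta.simps
    by (intro add_mono dconv_mono Suc.IH beta_nonneg order.refl) auto
  also have "dconv (\<lambda>_. 1) (\<lambda>n. real (Suc k) * dk k n) n = real (Suc k) * dk (Suc k) n"
    unfolding dk_Suc dconv_def by (simp add: sum_distrib_left case_prod_unfold)
  finally show ?case by (simp add: algebra_simps)
qed simp

text \<open>This dictates the choice z = x^(1/(k+1)): if all entries are at most z, the product of k
  of them is at most x^(1-1/(k+1)).\<close>

lemma alpha_support: "alpha z k n \<noteq> 0 \<Longrightarrow> n \<le> z ^ k"
proof (induction k arbitrary: n)
  case 0
  then show ?case by (simp add: dk_0 split: if_splits)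
next
  case (Suc k)
  from Suc.prems have "\<exists>x\<in>divs n. (case x of (a, b) \<Rightarrow> (if a \<le> z then 1 else 0) * alpha z k b) \<noteq> 0"
    unfolding alpha.simps dconv_def by (rule contrapos_np) (auto intro!: sum.neutral)
  then obtain a b where ab: "(a, b) \<in> divs n" "a \<le> z" "alpha z k b \<noteq> 0"
    by (auto split: if_splits)
  then have "a * b \<le> z * z ^ k"
    using Suc.IH by (intro mult_le_mono) auto
  then show ?case using ab(1) by (simp add: divs_def)
qed

section \<open>Exponential sums and the large sieve\<close>

lemma sum_inverse_le_ln:
  assumes "n \<ge> 1"
  shows "(\<Sum>l=1..n. 1 / real l) \<le> 1 + ln (real n)"
proof -
  obtain m where m: "n = Suc m" using assms by (cases n) auto
  have "harm (Suc m) - ln (real (Suc m)) \<le> harm (Suc 0) - ln (real (Suc 0))"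
    using decseq_harm_diff_ln by (rule decseqD) simp
  then show ?thesis
    by (simp add: harm_def m inverse_eq_divide)
qed

section \<open>Additive characters and geometric sums\<close>

definition ee :: "real \<Rightarrow> complex" where "ee t = cis (2 * pi * t)"

lemma ee_add: "ee (s + t) = ee s * ee t"
  by (simp add: ee_def cis_mult ring_distribs)

lemma ee_0 [simp]: "ee 0 = 1"
  by (simp add: ee_def)

lemma ee_int: "t \<in> \<int> \<Longrightarrow> ee t = 1"
  by (simp add: ee_def)

lemma norm_ee [simp]: "norm (ee t) = 1"
  by (simp add: ee_def)

lemma cnj_ee: "cnj (ee t) = ee (-t)"
  by (simp add: ee_def cis_cnj)

lemma ee_mult_nat: "ee (real n * t) = ee t ^ n"
  by (simp add: ee_def Complex.DeMoivre mult_ac)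

lemma ee_cong: "s - t \<in> \<int> \<Longrightarrow> ee s = ee t"
  using ee_add[of "s - t" t] by (simp add: ee_int)

text \<open>Jordan's inequality: the sine is concave on [0, pi], hence above its chord from 0 to pi
  / 2.\<close>

lemma sin_pi_ge:
  assumes "0 \<le> f" "f \<le> 1 / 2"
  shows "sin (pi * f) \<ge> 2 * f"
proof -
  have "convex_on {0..pi} (\<lambda>x. - sin x)"
    by (rule f''_ge0_imp_convex[where f' = "\<lambda>x. - cos x" and f'' = sin])
       (auto intro!: derivative_eq_intros sin_ge_zero)
  then have "- sin ((1 - 2 * f) * 0 + (2 * f) * (pi / 2)) \<le> (1 - 2 * f) * (- sin 0) + (2 * f) * (- sin (pi / 2))"
    using convex_onD[of "{0..pi}" "\<lambda>x. - sin x" "2 * f" 0 "pi / 2"] assms by auto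
  then show ?thesis by (simp add: mult.commute)
qed

text \<open>With f = frac t the left side is 2 |sin(pi f)|, which is at least 4 min(f, 1 - f) and so
  at least 4 f (1 - f). The product form avoids the distance to the nearest integer.\<close>

lemma norm_1_minus_ee:
  "norm (1 - ee t) \<ge> 4 * (frac t * (1 - frac t))"
proof -
  define f where "f = frac t"
  have f: "0 \<le> f" "f < 1" by (auto simp: f_def frac_lt_1)
  have "ee t = ee f" by (rule ee_cong) (simp add: f_def frac_def)
  then have "norm (1 - ee t) = norm (ee f - 1)" by (simp add: norm_minus_commute)
  also have "\<dots> = 2 * \<bar>sin (pi * f)\<bar>"
    using dist_exp_i_1[of "2 * pi * f"] by (simp add: ee_def cis_conv_exp)
  also have "\<dots> \<ge> 4 * (f * (1 - f))"
  proof (cases "f \<le> 1 / 2")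
    case True
    have "f * (1 - f) \<le> f * 1" using f by (intro mult_left_mono) auto
    then show ?thesis using sin_pi_ge[OF f(1) True] by simp
  next
    case False
    have "(1 - f) * f \<le> (1 - f) * 1" using f by (intro mult_left_mono) auto
    moreover have "sin (pi * (1 - f)) \<ge> 2 * (1 - f)"
      using False f by (intro sin_pi_ge) auto
    moreover have "sin (pi * (1 - f)) = sin (pi * f)"
      by (simp add: right_diff_distrib sin_diff)
    ultimately show ?thesis by (simp add: mult.commute)
  qed
  finally show ?thesis by (simp add: f_def)
qed

text \<open>For t not an integer this is 1 / (f (1 - f)) with f = frac t, which agrees up to a
  factor 2 with the reciprocal distance to the nearest integer. As a sum of two terms it splits sums
  over separated points into two one-sided ones.\<close>

definition kbound :: "real \<Rightarrow> real" where
  "kbound t = 1 / frac t + 1 / (1 - frac t)"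

lemma frac_pos: "t \<notin> \<int> \<Longrightarrow> frac t > 0"
  using frac_ge_0[of t] frac_eq_0_iff[of t] by linarith

lemma kbound_nonneg: "kbound t \<ge> 0"
  using frac_lt_1[of t] frac_ge_0[of t] by (auto simp: kbound_def intro!: add_nonneg_nonneg)

text \<open>The geometric sum is at most 2 / |1 - e(t)|, whatever the endpoints.\<close>

lemma norm_exp_sum_le:
  assumes "t \<notin> \<int>"
  shows "norm (\<Sum>m\<in>{a<..b}. ee (real m * t)) \<le> kbound t"
proof (cases "a \<le> b")
  case True
  let ?w = "ee t"
  let ?p = "frac t * (1 - frac t)"
  have p: "?p > 0" using frac_pos[OF assms] frac_lt_1[of t] by simp
  have "(1 - ?w) * (\<Sum>m\<in>{a<..b}. ee (real m * t)) = (1 - ?w) * (\<Sum>m=Suc a..b. ?w ^ m)"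
    by (simp add: ee_mult_nat atLeastSucAtMost_greaterThanAtMost)
  also have "\<dots> = ?w ^ Suc a - ?w ^ Suc b"
  proof (cases "a = b")
    case False
    then show ?thesis using True by (subst sum_gp_multiplied) auto
  qed simp
  finally have "norm (1 - ?w) * norm (\<Sum>m\<in>{a<..b}. ee (real m * t)) = norm (?w ^ Suc a - ?w ^ Suc b)"
    by (metis norm_mult)
  also have "\<dots> \<le> norm (?w ^ Suc a) + norm (?w ^ Suc b)" by (rule norm_triangle_ineq4)
  also have "\<dots> = 2" by (simp add: norm_power norm_mult)
  finally have 1: "norm (1 - ?w) * norm (\<Sum>m\<in>{a<..b}. ee (real m * t)) \<le> 2" .
  have "4 * ?p * norm (\<Sum>m\<in>{a<..b}. ee (real m * t)) \<le> norm (1 - ?w) * norm (\<Sum>m\<in>{a<..b}. ee (real m * t))"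
    using norm_1_minus_ee[of t] by (intro mult_right_mono) auto
  with 1 have "4 * ?p * norm (\<Sum>m\<in>{a<..b}. ee (real m * t)) \<le> 2" by linarith
  then have "norm (\<Sum>m\<in>{a<..b}. ee (real m * t)) \<le> 1 / (2 * ?p)"
    using p by (simp add: field_simps)
  also have "\<dots> \<le> 1 / ?p" using p by (simp add: field_simps)
  also have "1 / ?p = kbound t"
    using frac_pos[OF assms] frac_lt_1[of t] by (simp add: kbound_def field_simps)
  finally show ?thesis .
qed (simp add: kbound_nonneg)

text \<open>The numbers floor(t_j / delta) are distinct integers between 1 and 1 / delta, and t_j is
  at least delta times its number. The sum is therefore dominated by a harmonic sum divided by
  delta.\<close>

lemma sum_inverse_separated:
  fixes t :: "'a \<Rightarrow> real"
  assumes J: "finite J" and d: "0 < \<delta>" "\<delta> \<le> 1"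
    and t: "\<And>j. j \<in> J \<Longrightarrow> \<delta> \<le> t j" "\<And>j. j \<in> J \<Longrightarrow> t j \<le> 1"
    and sep: "\<And>i j. i \<in> J \<Longrightarrow> j \<in> J \<Longrightarrow> i \<noteq> j \<Longrightarrow> \<delta> \<le> \<bar>t i - t j\<bar>"
  shows "(\<Sum>j\<in>J. 1 / t j) \<le> (1 + ln (1 / \<delta>)) / \<delta>"
proof -
  define l where "l = (\<lambda>j. nat \<lfloor>t j / \<delta>\<rfloor>)"
  define L where "L = nat \<lfloor>1 / \<delta>\<rfloor>"
  have L: "L \<ge> 1" "real L \<le> 1 / \<delta>"
    using d by (auto simp: L_def le_nat_iff le_floor_iff)
  have l: "l j \<in> {1..L}" "real (l j) \<le> t j / \<delta>" if "j \<in> J" for j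
  proof -
    have "1 \<le> t j / \<delta>" using t(1)[OF that] d by simp
    moreover have "t j / \<delta> \<le> 1 / \<delta>" using t(2)[OF that] d by (simp add: divide_right_mono)
    ultimately show "l j \<in> {1..L}" "real (l j) \<le> t j / \<delta>"
      by (auto simp: l_def L_def le_nat_iff le_floor_iff intro!: nat_mono floor_mono)
  qed
  have inj: "inj_on l J"
  proof (rule inj_onI, rule ccontr)
    fix i j assume ij: "i \<in> J" "j \<in> J" "l i = l j" "i \<noteq> j"
    have "\<lfloor>t i / \<delta>\<rfloor> = \<lfloor>t j / \<delta>\<rfloor>"
      using ij l[OF ij(1)] l[OF ij(2)] by (auto simp: l_def)
    then have "\<bar>t i / \<delta> - t j / \<delta>\<bar> < 1" by linarith
    then have "\<bar>t i - t j\<bar> / \<delta> < 1"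
      using d by (simp add: diff_divide_distrib[symmetric] abs_divide)
    then have "\<bar>t i - t j\<bar> < \<delta>" using d by (simp add: field_simps)
    with sep[OF ij(1,2,4)] show False by simp
  qed
  have "(\<Sum>j\<in>J. 1 / t j) \<le> (\<Sum>j\<in>J. (1 / \<delta>) * (1 / real (l j)))"
  proof (rule sum_mono)
    fix j assume j: "j \<in> J"
    have "real (l j) * \<delta> \<le> t j" using l[OF j] d by (simp add: field_simps)
    then have "1 / t j \<le> 1 / (real (l j) * \<delta>)"
      using l[OF j] d t(1)[OF j] by (intro divide_left_mono mult_pos_pos) auto
    then show "1 / t j \<le> (1 / \<delta>) * (1 / real (l j))" by (simp add: mult.commute)
  qed
  also have "\<dots> = (1 / \<delta>) * (\<Sum>m\<in>l ` J. 1 / real m)"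
    by (simp add: sum_distrib_left sum.reindex[OF inj])
  also have "\<dots> \<le> (1 / \<delta>) * (\<Sum>m=1..L. 1 / real m)"
    using d l by (intro mult_left_mono sum_mono2) auto
  also have "\<dots> \<le> (1 / \<delta>) * (1 + ln (real L))"
    using d L by (intro mult_left_mono sum_inverse_le_ln) auto
  also have "\<dots> \<le> (1 / \<delta>) * (1 + ln (1 / \<delta>))"
    using d L by (intro mult_left_mono add_left_mono ln_mono) auto
  finally show ?thesis by simp
qed

text \<open>The free integer \<open>z\<close> expresses separation modulo 1. It makes both the
  fractional parts and their complements to 1 separated points of [delta, 1].\<close>

lemma sum_kbound_separated:
  fixes \<theta> :: "'a \<Rightarrow> real"
  assumes J: "finite J" and d: "0 < \<delta>" "\<delta> \<le> 1"
    and t: "\<And>j z. j \<in> J \<Longrightarrow> \<delta> \<le> \<bar>\<theta> j - of_int z\<bar>"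
    and sep: "\<And>i j z. i \<in> J \<Longrightarrow> j \<in> J \<Longrightarrow> i \<noteq> j \<Longrightarrow> \<delta> \<le> \<bar>\<theta> i - \<theta> j - of_int z\<bar>"
  shows "(\<Sum>j\<in>J. kbound (\<theta> j)) \<le> 2 * (1 + ln (1 / \<delta>)) / \<delta>"
proof -
  have a: "\<delta> \<le> frac (\<theta> j)" "\<delta> \<le> 1 - frac (\<theta> j)" if "j \<in> J" for j
  proof -
    show "\<delta> \<le> frac (\<theta> j)" using t[OF that, of "\<lfloor>\<theta> j\<rfloor>"] frac_ge_0[of "\<theta> j"] by (simp add: frac_def)
    show "\<delta> \<le> 1 - frac (\<theta> j)"
      using t[OF that, of "\<lfloor>\<theta> j\<rfloor> + 1"] frac_lt_1[of "\<theta> j"] by (simp add: frac_def)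
  qed
  have b: "\<delta> \<le> \<bar>frac (\<theta> i) - frac (\<theta> j)\<bar>" if "i \<in> J" "j \<in> J" "i \<noteq> j" for i j
    using sep[OF that, of "\<lfloor>\<theta> i\<rfloor> - \<lfloor>\<theta> j\<rfloor>"] by (simp add: frac_def algebra_simps)
  have "(\<Sum>j\<in>J. kbound (\<theta> j)) = (\<Sum>j\<in>J. 1 / frac (\<theta> j)) + (\<Sum>j\<in>J. 1 / (1 - frac (\<theta> j)))"
    by (simp add: kbound_def sum.distrib)
  also have "\<dots> \<le> (1 + ln (1 / \<delta>)) / \<delta> + (1 + ln (1 / \<delta>)) / \<delta>"
    using J d a b less_imp_le[OF frac_lt_1] frac_ge_0
    by (intro add_mono sum_inverse_separated) (auto simp: less_imp_le abs_minus_commute)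
  finally show ?thesis by simp
qed

lemma rational_dist_int:
  fixes u z :: int and r :: nat
  assumes "r > 0" "\<not> int r dvd u"
  shows "1 / real r \<le> \<bar>of_int u / real r - of_int z\<bar>"
proof -
  have "u - z * int r \<noteq> 0" using assms(2) by (metis dvd_triv_right eq_iff_diff_eq_0)
  then have "1 \<le> \<bar>u - z * int r\<bar>" by linarith
  then have "real_of_int 1 \<le> real_of_int \<bar>u - z * int r\<bar>" by (simp only: of_int_le_iff)
  then have "1 \<le> \<bar>of_int u - of_int z * real r\<bar>" by simp
  then have "1 / real r \<le> \<bar>of_int u - of_int z * real r\<bar> / real r" by (intro divide_right_mono) auto
  also have "\<dots> = \<bar>(of_int u - of_int z * real r) / real r\<bar>" by simp
  also have "(of_int u - of_int z * real r) / real r = of_int u / real r - of_int z"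
    using assms(1) by (simp add: field_simps)
  finally show ?thesis .
qed

lemma rational_in_Ints_iff:
  assumes "r > 0"
  shows "real h * real M / real r \<in> \<int> \<longleftrightarrow> r dvd h * M"
proof
  assume "real h * real M / real r \<in> \<int>"
  then obtain z where "real h * real M / real r = of_int z" by (elim Ints_cases)
  then have "real (h * M) = of_int z * real r" using assms by (simp add: field_simps)
  then have "int (h * M) = z * int r" by (metis of_int_eq_iff of_int_mult of_int_of_nat_eq)
  then have "int r dvd int (h * M)" by simp
  then show "r dvd h * M" by (simp only: of_nat_dvd_iff)
next
  assume "r dvd h * M"
  then obtain c where "h * M = r * c" by (elim dvdE)
  then have "real h * real M = real r * real c" by (metis of_nat_mult)
  then show "real h * real M / real r \<in> \<int>" using assms by simp
qed

text \<open>In a block of r consecutive M the residues h M modulo r are distinct, and nonzero unless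
  r divides M. The points h M / r are thus 1/r-separated modulo 1 and away from the integers, and
  each block costs r log r up to a constant.\<close>

lemma sum_kbound_multiples:
  assumes r: "r > 0" and cop: "coprime h r"
  shows "(\<Sum>M | M \<in> {1..Y} \<and> \<not> r dvd M. kbound (real h * real M / real r))
           \<le> (real Y + real r) * (2 * (1 + ln (real r)))"
proof -
  \<comment> \<open>One block beyond Y div r is needed to cover 1..Y; it is responsible for the
    summand r in the bound.\<close>
  define B where "B = Y div r + 1"
  define f where "f = (\<lambda>M. if r dvd M then 0 else kbound (real h * real M / real r))"
  have sub: "{1..Y} \<subseteq> {..<B * r}"
  proof
    fix x assume "x \<in> {1..Y}"
    then have "x \<le> Y" by simp
    also have "Y < B * r" unfolding B_def using r dividend_less_div_times[of r Y] by (simp add: add.commute)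
    finally show "x \<in> {..<B * r}" by simp
  qed
  have blk: "sum f {m * r..<m * r + r} \<le> 2 * (1 + ln (real r)) * real r" for m
  proof -
    let ?J = "{M \<in> {m * r..<m * r + r}. \<not> r dvd M}"
    have "sum f {m * r..<m * r + r} = (\<Sum>M\<in>?J. kbound (real h * real M / real r))"
      by (rule sum.mono_neutral_cong_right) (auto simp: f_def)
    also have "\<dots> \<le> 2 * (1 + ln (1 / (1 / real r))) / (1 / real r)"
    proof (rule sum_kbound_separated)
      show "1 / real r \<le> \<bar>real h * real j / real r - of_int z\<bar>" if "j \<in> ?J" for j z
      proof -
        have "\<not> int r dvd int h * int j"
          using that cop by (simp flip: of_nat_mult add: coprime_dvd_mult_right_iff coprime_commute)
        from rational_dist_int[OF r this, of z] show ?thesis by simp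
      qed
      show "1 / real r \<le> \<bar>real h * real i / real r - real h * real j / real r - of_int z\<bar>"
        if "i \<in> ?J" "j \<in> ?J" "i \<noteq> j" for i j z
      proof -
        have "\<not> int r dvd int h * (int i - int j)"
        proof
          assume "int r dvd int h * (int i - int j)"
          then have "int r dvd int i - int j"
            using cop by (simp add: coprime_dvd_mult_right_iff coprime_commute)
          moreover have "\<bar>int i - int j\<bar> < int r" using that by auto
          ultimately have "int i - int j = 0"
            using dvd_imp_le_int[of "int i - int j" "int r"] by linarith
          then show False using that by simp
        qed
        from rational_dist_int[OF r this, of z] show ?thesis
          by (simp add: algebra_simps diff_divide_distrib)
      qed
    qed (use r in auto)
    also have "\<dots> = 2 * (1 + ln (real r)) * real r" by simp
    finally show ?thesis .
  qed
  have "(\<Sum>M | M \<in> {1..Y} \<and> \<not> r dvd M. kbound (real h * real M / real r)) = sum f {1..Y}"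
    by (rule sum.mono_neutral_cong_left) (auto simp: f_def)
  also have "\<dots> \<le> sum f {..<B * r}"
    using sub by (intro sum_mono2) (auto simp: f_def kbound_nonneg)
  also have "\<dots> = (\<Sum>m<B. sum f {m * r..<m * r + r})" by (rule sum.nat_group [symmetric])
  also have "\<dots> \<le> (\<Sum>m<B. 2 * (1 + ln (real r)) * real r)" by (intro sum_mono blk)
  also have "\<dots> = (real B * real r) * (2 * (1 + ln (real r)))" by (simp add: mult_ac)
  also have "\<dots> \<le> (real Y + real r) * (2 * (1 + ln (real r)))"
  proof (rule mult_right_mono)
    have "B * r \<le> Y + r" by (simp add: B_def)
    then show "real B * real r \<le> real Y + real r" by (metis of_nat_add of_nat_le_iff of_nat_mult)
  qed (use r in auto)
  finally show ?thesis .
qed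

text \<open>Duality. If X is the left side, then X is the inner product of a with a combination c of
  the vectors, and Cauchy-Schwarz gives X^2 <= A |c|^2. Expanding |c|^2 produces the Gram matrix. By
  |b_j b_i| <= (|b_j|^2 + |b_i|^2) / 2 and the symmetry of its absolute values, the row sums bound
  this quadratic form by B X; one factor X cancels.\<close>

lemma selberg_bombieri_inequality:
  fixes \<phi> :: "'j \<Rightarrow> 'n \<Rightarrow> complex" and a :: "'n \<Rightarrow> complex"
  assumes J: "J \<noteq> {}" and row: "\<And>j. j \<in> J \<Longrightarrow> (\<Sum>i\<in>J. norm (\<Sum>n\<in>N. \<phi> j n * cnj (\<phi> i n))) \<le> B"
  shows "(\<Sum>j\<in>J. (norm (\<Sum>n\<in>N. a n * \<phi> j n))\<^sup>2) \<le> B * (\<Sum>n\<in>N. (norm (a n))\<^sup>2)"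
proof -
  define b where "b = (\<lambda>j. cnj (\<Sum>n\<in>N. a n * \<phi> j n))"
  define c where "c = (\<lambda>n. \<Sum>j\<in>J. b j * \<phi> j n)"
  define K where "K = (\<lambda>j i. \<Sum>n\<in>N. \<phi> j n * cnj (\<phi> i n))"
  define X where "X = (\<Sum>j\<in>J. (norm (b j))\<^sup>2)"
  define A where "A = (\<Sum>n\<in>N. (norm (a n))\<^sup>2)"
  have X0: "X \<ge> 0" by (auto simp: X_def intro!: sum_nonneg)
  have Ksym: "norm (K j i) = norm (K i j)" for i j
  proof -
    have "K j i = cnj (K i j)" by (simp add: K_def mult.commute)
    then show ?thesis by simp
  qed
  have "complex_of_real X = (\<Sum>j\<in>J. b j * (\<Sum>n\<in>N. a n * \<phi> j n))"
    unfolding X_def of_real_sum complex_norm_square by (simp add: b_def)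
  also have "\<dots> = (\<Sum>n\<in>N. a n * c n)"
    unfolding c_def sum_distrib_left by (subst sum.swap) (simp add: mult_ac)
  finally have Xac: "complex_of_real X = (\<Sum>n\<in>N. a n * c n)" .
  have "X = norm (\<Sum>n\<in>N. a n * c n)" using X0 Xac by (metis abs_of_nonneg norm_of_real)
  also have "\<dots> \<le> (\<Sum>n\<in>N. norm (a n) * norm (c n))"
    by (rule order_trans[OF norm_sum]) (simp add: norm_mult)
  finally have "X\<^sup>2 \<le> (\<Sum>n\<in>N. norm (a n) * norm (c n))\<^sup>2" using X0 by (intro power_mono) auto
  also have "\<dots> \<le> A * (\<Sum>n\<in>N. (norm (c n))\<^sup>2)"
    unfolding A_def by (rule Cauchy_Schwarz_ineq_sum)
  finally have 1: "X\<^sup>2 \<le> A * (\<Sum>n\<in>N. (norm (c n))\<^sup>2)" .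
  have "complex_of_real (\<Sum>n\<in>N. (norm (c n))\<^sup>2) = (\<Sum>n\<in>N. c n * cnj (c n))"
    unfolding of_real_sum complex_norm_square ..
  also have "\<dots> = (\<Sum>n\<in>N. \<Sum>j\<in>J. \<Sum>i\<in>J. b j * cnj (b i) * (\<phi> j n * cnj (\<phi> i n)))"
    unfolding c_def cnj_sum sum_product by (intro sum.cong refl) (simp add: mult_ac)
  also have "\<dots> = (\<Sum>j\<in>J. \<Sum>i\<in>J. \<Sum>n\<in>N. b j * cnj (b i) * (\<phi> j n * cnj (\<phi> i n)))"
    by (subst sum.swap, intro sum.cong refl, subst sum.swap, rule refl)
  also have "\<dots> = (\<Sum>j\<in>J. \<Sum>i\<in>J. b j * cnj (b i) * K j i)"
    by (simp add: K_def sum_distrib_left)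
  finally have eq: "complex_of_real (\<Sum>n\<in>N. (norm (c n))\<^sup>2) = (\<Sum>j\<in>J. \<Sum>i\<in>J. b j * cnj (b i) * K j i)" .
  have "(\<Sum>n\<in>N. (norm (c n))\<^sup>2) = norm (\<Sum>j\<in>J. \<Sum>i\<in>J. b j * cnj (b i) * K j i)"
    unfolding eq[symmetric] norm_of_real by (simp add: sum_nonneg)
  also have "\<dots> \<le> (\<Sum>j\<in>J. \<Sum>i\<in>J. norm (b j) * norm (b i) * norm (K j i))"
    by (intro order_trans[OF norm_sum] sum_mono order_trans[OF norm_sum]) (simp add: norm_mult)
  also have "\<dots> \<le> (\<Sum>j\<in>J. \<Sum>i\<in>J. ((norm (b j))\<^sup>2 / 2 + (norm (b i))\<^sup>2 / 2) * norm (K j i))"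
  proof (intro sum_mono mult_right_mono)
    fix j i
    show "norm (b j) * norm (b i) \<le> (norm (b j))\<^sup>2 / 2 + (norm (b i))\<^sup>2 / 2"
      using sum_squares_bound[of "norm (b j)" "norm (b i)"] by simp
  qed auto
  also have "\<dots> = (\<Sum>j\<in>J. \<Sum>i\<in>J. (norm (b j))\<^sup>2 / 2 * norm (K j i)) + (\<Sum>j\<in>J. \<Sum>i\<in>J. (norm (b i))\<^sup>2 / 2 * norm (K j i))"
    by (simp add: ring_distribs sum.distrib)
  also have "(\<Sum>j\<in>J. \<Sum>i\<in>J. (norm (b i))\<^sup>2 / 2 * norm (K j i)) = (\<Sum>i\<in>J. \<Sum>j\<in>J. (norm (b i))\<^sup>2 / 2 * norm (K i j))"
    by (subst sum.swap) (simp add: Ksym)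
  also have "(\<Sum>j\<in>J. \<Sum>i\<in>J. (norm (b j))\<^sup>2 / 2 * norm (K j i)) + \<dots> = (\<Sum>j\<in>J. (norm (b j))\<^sup>2 * (\<Sum>i\<in>J. norm (K j i)))"
    unfolding sum.distrib[symmetric] sum_distrib_left by (intro sum.cong refl) (simp add: field_simps)
  also have "\<dots> \<le> (\<Sum>j\<in>J. (norm (b j))\<^sup>2 * B)"
    using row by (intro sum_mono mult_left_mono) (auto simp: K_def)
  also have "\<dots> = X * B" by (simp add: X_def sum_distrib_right)
  finally have 2: "(\<Sum>n\<in>N. (norm (c n))\<^sup>2) \<le> X * B" .
  have "A \<ge> 0" by (auto simp: A_def intro!: sum_nonneg)
  then have "A * (\<Sum>n\<in>N. (norm (c n))\<^sup>2) \<le> A * (X * B)" by (rule mult_left_mono[OF 2])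
  with 1 have 3: "X * X \<le> (B * A) * X" by (simp add: power2_eq_square mult_ac)
  have "X \<le> B * A"
  proof (cases "X = 0")
    case True
    obtain j where "j \<in> J" using J by blast
    from row[OF this] have "B \<ge> 0" by (rule order_trans[rotated]) (auto intro!: sum_nonneg)
    then show ?thesis using \<open>A \<ge> 0\<close> True by simp
  next
    case False
    then have "X > 0" using X0 by simp
    then show ?thesis using 3 by simp
  qed
  then show ?thesis unfolding X_def A_def b_def complex_mod_cnj .
qed

section \<open>Farey fractions and the large sieve\<close>

definition farey :: "nat \<Rightarrow> (nat \<times> nat) set" where
  "farey R = {(r, h). 1 \<le> r \<and> r \<le> R \<and> h \<in> totatives r}"

lemma farey_Sigma: "farey R = Sigma {1..R} totatives"
  by (auto simp: farey_def)

lemma finite_farey [simp, intro]: "finite (farey R)"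
  by (simp add: farey_Sigma)

text \<open>The fractions h / r lie in (0, 1], with 0 represented by 1/1, so that distinct pairs
  stay distinct modulo 1. Over the common denominator r r' <= R^2 the numerator of the difference is
  not a multiple of r r', which leaves a distance of at least 1 / (r r') to every integer.\<close>

lemma farey_separated:
  assumes "(r, h) \<in> farey R" "(r', h') \<in> farey R" "(r, h) \<noteq> (r', h')"
  shows "1 / (real R)\<^sup>2 \<le> \<bar>real h / real r - real h' / real r' - of_int z\<bar>"
proof -
  have r: "1 \<le> r" "r \<le> R" "0 < h" "h \<le> r" "coprime h r"
    and r': "1 \<le> r'" "r' \<le> R" "0 < h'" "h' \<le> r'" "coprime h' r'"
    using assms by (auto simp: farey_def in_totatives_iff)
  define u where "u = int h * int r' - int h' * int r"
  have nd: "\<not> int (r * r') dvd u"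
  proof
    assume dvd: "int (r * r') dvd u"
    have "int r dvd int (r * r')" by simp
    then have "int r dvd u" using dvd by (rule dvd_trans)
    then have "int r dvd u + int h' * int r" by simp
    then have "int r dvd int h * int r'" by (simp add: u_def)
    then have "r dvd h * r'" by (simp flip: of_nat_mult)
    then have 1: "r dvd r'" using r(5) by (simp add: coprime_dvd_mult_right_iff coprime_commute)
    have "int r' dvd int (r * r')" by simp
    then have "int r' dvd u" using dvd by (rule dvd_trans)
    then have "int r' dvd int h * int r' - u" by simp
    then have "int r' dvd int h' * int r" by (simp add: u_def)
    then have "r' dvd h' * r" by (simp flip: of_nat_mult)
    then have "r' dvd r" using r'(5) by (simp add: coprime_dvd_mult_right_iff coprime_commute)
    with 1 have eq: "r = r'" by (rule dvd_antisym)
    then have "u = int r * (int h - int h')" by (simp add: u_def algebra_simps)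
    then have "int r dvd int h - int h'" using dvd eq r(1) by simp
    moreover have "\<bar>int h - int h'\<bar> < int r" using r r' eq by auto
    ultimately have "int h - int h' = 0"
      using dvd_imp_le_int[of "int h - int h'" "int r"] by linarith
    then show False using assms(3) eq by simp
  qed
  have pos: "r * r' > 0" using r r' by simp
  have "1 / (real R)\<^sup>2 \<le> 1 / real (r * r')"
  proof (intro divide_left_mono)
    have "r * r' \<le> R * R" using r r' by (intro mult_le_mono)
    then show "real (r * r') \<le> (real R)\<^sup>2" by (simp add: power2_eq_square flip: of_nat_mult)
  qed (use pos r in auto)
  also have "\<dots> \<le> \<bar>of_int u / real (r * r') - of_int z\<bar>" by (rule rational_dist_int[OF pos nd])
  also have "of_int u / real (r * r') = real h / real r - real h' / real r'"
    using r r' by (simp add: u_def field_simps)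
  finally show ?thesis .
qed

text \<open>Duality with the vectors n -> e(n h / r). The diagonal entry is N; the other entries of
  a row are geometric sums at the R^(-2)-separated differences, which add up to R^2 times a
  logarithm. The logarithm could be avoided but disappears in x^eps.\<close>

theorem large_sieve:
  fixes a :: "nat \<Rightarrow> complex"
  assumes "R \<ge> 1"
  shows "(\<Sum>(r, h)\<in>farey R. (norm (\<Sum>n=1..N. a n * ee (real n * (real h / real r))))\<^sup>2)
           \<le> (real N + 2 * (1 + 2 * ln (real R)) * (real R)\<^sup>2) * (\<Sum>n=1..N. (norm (a n))\<^sup>2)"
proof -
  define al where "al = (\<lambda>(r, h). real h / real r)"
  have "(\<Sum>j\<in>farey R. (norm (\<Sum>n=1..N. a n * ee (real n * al j)))\<^sup>2)
           \<le> (real N + 2 * (1 + 2 * ln (real R)) * (real R)\<^sup>2) * (\<Sum>n=1..N. (norm (a n))\<^sup>2)"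
  proof (rule selberg_bombieri_inequality)
    fix j assume j: "j \<in> farey R"
    have eq: "ee (real n * al j) * cnj (ee (real n * al i)) = ee (real n * (al j - al i))" for n i
      by (simp add: cnj_ee ee_add[symmetric] right_diff_distrib)
    have nint: "al j - al i \<notin> \<int>" if "i \<in> farey R - {j}" for i
    proof
      assume "al j - al i \<in> \<int>"
      then obtain z where "al j - al i = of_int z" by (elim Ints_cases)
      moreover have "1 / (real R)\<^sup>2 \<le> \<bar>al j - al i - of_int z\<bar>"
        using farey_separated[of "fst j" "snd j" R "fst i" "snd i" z] that j
        by (auto simp: al_def case_prod_unfold)
      ultimately show False using assms by simp
    qed
    have "(\<Sum>i\<in>farey R. norm (\<Sum>n=1..N. ee (real n * al j) * cnj (ee (real n * al i))))
        = norm (\<Sum>n=1..N. ee (real n * (al j - al j))) + (\<Sum>i\<in>farey R - {j}. norm (\<Sum>n=1..N. ee (real n * (al j - al i))))"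
      unfolding eq using j by (subst sum.remove[of _ j]) auto
    also have "\<dots> \<le> real N + (\<Sum>i\<in>farey R - {j}. kbound (al j - al i))"
    proof (intro add_mono sum_mono)
      fix i assume i: "i \<in> farey R - {j}"
      have "norm (\<Sum>n\<in>{0<..N}. ee (real n * (al j - al i))) \<le> kbound (al j - al i)"
        by (rule norm_exp_sum_le[OF nint[OF i]])
      then show "norm (\<Sum>n=1..N. ee (real n * (al j - al i))) \<le> kbound (al j - al i)"
        by (simp add: atLeastSucAtMost_greaterThanAtMost)
    qed simp
    also have "(\<Sum>i\<in>farey R - {j}. kbound (al j - al i)) \<le> 2 * (1 + ln (1 / (1 / (real R)\<^sup>2))) / (1 / (real R)\<^sup>2)"
    proof (rule sum_kbound_separated)
      show "1 / (real R)\<^sup>2 \<le> \<bar>al j - al i - of_int z\<bar>" if "i \<in> farey R - {j}" for i z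
        using farey_separated[of "fst j" "snd j" R "fst i" "snd i" z] that j
        by (auto simp: al_def case_prod_unfold)
      show "1 / (real R)\<^sup>2 \<le> \<bar>al j - al i - (al j - al i') - of_int z\<bar>"
        if "i \<in> farey R - {j}" "i' \<in> farey R - {j}" "i \<noteq> i'" for i i' z
        using farey_separated[of "fst i'" "snd i'" R "fst i" "snd i" z] that
        by (auto simp: al_def case_prod_unfold prod_eq_iff)
    qed (use assms in auto)
    also have "2 * (1 + ln (1 / (1 / (real R)\<^sup>2))) / (1 / (real R)\<^sup>2) = 2 * (1 + 2 * ln (real R)) * (real R)\<^sup>2"
      using assms by (simp add: ln_realpow)
    finally show "(\<Sum>i\<in>farey R. norm (\<Sum>n=1..N. ee (real n * al j) * cnj (ee (real n * al i))))
        \<le> real N + 2 * (1 + 2 * ln (real R)) * (real R)\<^sup>2" by simp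
  next
    have "(1, 1) \<in> farey R" using assms by (simp add: farey_def)
    then show "farey R \<noteq> {}" by blast
  qed
  then show ?thesis by (simp add: al_def case_prod_unfold)
qed

section \<open>Fourier analysis modulo q\<close>

lemma ee_eq_1_iff: "ee t = 1 \<longleftrightarrow> t \<in> \<int>"
proof
  assume "ee t = 1"
  then have "frac t * (1 - frac t) \<le> 0" using norm_1_minus_ee[of t] by simp
  then show "t \<in> \<int>"
    using frac_pos[of t] frac_lt_1[of t] by (meson diff_gt_0_iff_gt mult_pos_pos not_le)
qed (rule ee_int)

lemma sum_ee_full:
  fixes u :: int
  assumes q: "q > 0"
  shows "(\<Sum>b=1..q. ee (real b * (of_int u / real q))) = (if int q dvd u then of_nat q else 0)"
proof -
  let ?t = "of_int u / real q"
  have iff: "?t \<in> \<int> \<longleftrightarrow> int q dvd u"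
  proof
    assume "?t \<in> \<int>"
    then obtain z where "?t = of_int z" by (elim Ints_cases)
    then have "real_of_int u = of_int (z * int q)" using q by (simp add: field_simps)
    then have "u = z * int q" by (simp only: of_int_eq_iff)
    then show "int q dvd u" by simp
  next
    assume "int q dvd u"
    then obtain c where "u = int q * c" by (elim dvdE)
    then show "?t \<in> \<int>" using q by simp
  qed
  show ?thesis
  proof (cases "int q dvd u")
    case True
    then have "ee ?t = 1" using iff by (simp add: ee_int)
    then show ?thesis unfolding ee_mult_nat using True by simp
  next
    case False
    then have w: "ee ?t \<noteq> 1" using iff ee_eq_1_iff by blast
    have wq: "ee ?t ^ q = 1"
    proof -
      have "ee (real q * ?t) = 1" using q by (intro ee_int) simp
      then show ?thesis by (simp only: ee_mult_nat)
    qed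
    have "(1 - ee ?t) * (\<Sum>b=1..q. ee ?t ^ b) = ee ?t ^ 1 - ee ?t ^ Suc q"
      using q by (intro sum_gp_multiplied) auto
    also have "\<dots> = 0" by (simp add: wq)
    finally have "(\<Sum>b=1..q. ee ?t ^ b) = 0" using w by (simp only: mult_eq_0_iff) auto
    then show ?thesis unfolding ee_mult_nat using False by simp
  qed
qed

lemma dvd_diff_imp_eq:
  assumes "int q dvd int a - int b" "a \<in> {1..q}" "b \<in> {1..q}"
  shows "a = b"
proof (rule ccontr)
  assume "a \<noteq> b"
  then have "int a - int b \<noteq> 0" by simp
  from dvd_imp_le_int[OF this assms(1)] have "int q \<le> \<bar>int a - int b\<bar>" by simp
  moreover have "\<bar>int a - int b\<bar> < int q" using assms(2,3) by auto
  ultimately show False by simp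
qed

lemma parseval_mod:
  fixes f :: "nat \<Rightarrow> complex"
  assumes q: "q > 0"
  shows "(\<Sum>b=1..q. (norm (\<Sum>a=1..q. f a * ee (real a * (real b / real q))))\<^sup>2)
           = real q * (\<Sum>a=1..q. (norm (f a))\<^sup>2)"
proof -
  have orth: "(\<Sum>b=1..q. ee (real a * (real b / real q)) * cnj (ee (real a' * (real b / real q))))
      = (if a = a' then of_nat q else 0)" if "a \<in> {1..q}" "a' \<in> {1..q}" for a a'
  proof -
    have "(\<Sum>b=1..q. ee (real a * (real b / real q)) * cnj (ee (real a' * (real b / real q))))
        = (\<Sum>b=1..q. ee (real b * (of_int (int a - int a') / real q)))"
      by (intro sum.cong refl)
         (simp add: cnj_ee ee_add[symmetric] diff_divide_distrib algebra_simps)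
    also have "\<dots> = (if int q dvd int a - int a' then of_nat q else 0)" by (rule sum_ee_full[OF q])
    also have "int q dvd int a - int a' \<longleftrightarrow> a = a'"
      using dvd_diff_imp_eq that by auto
    finally show ?thesis .
  qed
  have "complex_of_real (\<Sum>b=1..q. (norm (\<Sum>a=1..q. f a * ee (real a * (real b / real q))))\<^sup>2)
      = (\<Sum>b=1..q. \<Sum>a=1..q. \<Sum>a'=1..q. f a * cnj (f a') * (ee (real a * (real b / real q)) * cnj (ee (real a' * (real b / real q)))))"
    unfolding of_real_sum complex_norm_square cnj_sum sum_product
    by (intro sum.cong refl) (simp add: mult_ac)
  also have "\<dots> = (\<Sum>a=1..q. \<Sum>a'=1..q. f a * cnj (f a') * (\<Sum>b=1..q. ee (real a * (real b / real q)) * cnj (ee (real a' * (real b / real q)))))"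
    unfolding sum_distrib_left by (subst sum.swap, rule sum.cong[OF refl], rule sum.swap)
  also have "\<dots> = (\<Sum>a=1..q. \<Sum>a'=1..q. if a = a' then of_nat q * (f a * cnj (f a')) else 0)"
    by (intro sum.cong refl, subst orth) auto
  also have "\<dots> = (\<Sum>a=1..q. of_nat q * (f a * cnj (f a)))" by simp
  also have "\<dots> = complex_of_real (real q * (\<Sum>a=1..q. (norm (f a))\<^sup>2))"
    unfolding of_real_mult of_real_sum complex_norm_square by (simp add: sum_distrib_left)
  finally show ?thesis by (simp only: of_real_eq_iff)
qed

lemma sum_cong_class:
  fixes \<phi> :: "nat \<Rightarrow> 'a::comm_monoid_add"
  assumes q: "q > 0" and \<phi>: "\<And>a. [n = a] (mod q) \<Longrightarrow> \<phi> a = \<phi> n"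
  shows "(\<Sum>a=1..q. if [n = a] (mod q) then \<phi> a else 0) = \<phi> n"
proof -
  \<comment> \<open>Residues are represented in 1..q, as in the variance, hence q in place of
    0.\<close>
  define a0 where "a0 = (if q dvd n then q else n mod q)"
  have a0: "a0 \<in> {1..q}" "[n = a0] (mod q)"
    using q by (auto simp: a0_def cong_def mod_greater_zero_iff_not_dvd Suc_le_eq intro: less_imp_le)
  have uniq: "a = a0" if "a \<in> {1..q}" "[n = a] (mod q)" for a
  proof -
    have "[a = a0] (mod q)" using that(2) a0(2) cong_sym cong_trans by blast
    then have "[int a = int a0] (mod int q)" by (simp add: cong_int_iff)
    then have "int q dvd int a - int a0" by (simp add: cong_iff_dvd_diff)
    then show ?thesis using dvd_diff_imp_eq that(1) a0(1) by blast
  qed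
  have "(\<Sum>a=1..q. if [n = a] (mod q) then \<phi> a else 0) = (\<Sum>a=1..q. if a = a0 then \<phi> n else 0)"
  proof (intro sum.cong refl)
    fix a assume a: "a \<in> {1..q}"
    show "(if [n = a] (mod q) then \<phi> a else 0) = (if a = a0 then \<phi> n else 0)"
    proof (cases "[n = a] (mod q)")
      case True
      then show ?thesis using uniq[OF a True] \<phi>[OF True] by simp
    next
      case False
      then have "a \<noteq> a0" using a0(2) by auto
      then show ?thesis using False by simp
    qed
  qed
  also have "\<dots> = \<phi> n" using a0(1) by (subst sum.delta) auto
  finally show ?thesis .
qed

text \<open>The left side is symmetric in b and M. Applied twice it shows that q / gcd(M, q) divides
  b iff q / gcd(b, q) divides M, and this exchange computes the transform of \<open>G\<close>
  below.\<close>

lemma dvd_mult_gcd_iff: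
  fixes q b M :: nat
  assumes "q > 0"
  shows "q dvd b * M \<longleftrightarrow> (q div gcd M q) dvd b"
proof -
  define g where "g = gcd M q"
  have g: "g > 0" "g dvd M" "g dvd q" using assms by (auto simp: g_def)
  obtain M' q' where e: "M = g * M'" "q = g * q'" using g by (elim dvdE)
  have "coprime (M div g) (q div g)"
    unfolding g_def using assms by (intro div_gcd_coprime) auto
  then have cop: "coprime M' q'"
    using e g by simp
  have "q dvd b * M \<longleftrightarrow> g * q' dvd g * (b * M')" by (simp add: e mult_ac)
  also have "\<dots> \<longleftrightarrow> q' dvd b * M'" using g by simp
  also have "\<dots> \<longleftrightarrow> q' dvd b" using cop by (simp add: coprime_dvd_mult_left_iff coprime_commute)
  finally have "q dvd b * M \<longleftrightarrow> q' dvd b" .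
  moreover have "q div g = q'" using e(2) g(1) by simp
  ultimately show ?thesis by (simp add: g_def)
qed

text \<open>Reducing b / q to lowest terms h / r is a bijection, with inverse b = h (q / r).\<close>

lemma sum_by_reduced_fraction:
  fixes F :: "nat \<Rightarrow> nat \<Rightarrow> 'a::comm_monoid_add"
  assumes q: "q > 0"
  shows "(\<Sum>b=1..q. F (q div gcd b q) (b div gcd b q)) = (\<Sum>r | r dvd q. \<Sum>h\<in>totatives r. F r h)"
proof -
  have "(\<Sum>r | r dvd q. \<Sum>h\<in>totatives r. F r h) = (\<Sum>(r, h)\<in>Sigma {r. r dvd q} totatives. F r h)"
    using q by (subst sum.Sigma) auto
  also have "\<dots> = (\<Sum>b=1..q. F (q div gcd b q) (b div gcd b q))"
  proof (rule sum.reindex_bij_witness[where j = "\<lambda>(r, h). h * (q div r)" and i = "\<lambda>b. (q div gcd b q, b div gcd b q)"])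
    fix x assume "x \<in> Sigma {r. r dvd q} totatives"
    then obtain r h where x: "x = (r, h)" "r dvd q" "h \<in> totatives r" by auto
    then obtain s where s: "q = r * s" by (elim dvdE)
    have sp: "s > 0" "r > 0" using q s by auto
    have qs: "q div r = s" using s sp by simp
    have h: "0 < h" "h \<le> r" "coprime h r" using x by (auto simp: in_totatives_iff)
    have "gcd (h * s) (r * s) = gcd h r * s" by (simp add: gcd_mult_distrib_nat mult.commute)
    then have gc: "gcd (h * s) q = s" using h s by simp
    show "(\<lambda>b. (q div gcd b q, b div gcd b q)) ((\<lambda>(r, h). h * (q div r)) x) = x"
      using sp by (simp add: x(1) qs gc) (simp add: s)
    show "(\<lambda>(r, h). h * (q div r)) x \<in> {1..q}"
      using h sp by (simp add: x(1) qs) (simp add: s)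
    show "F (q div gcd ((\<lambda>(r, h). h * (q div r)) x) q) ((\<lambda>(r, h). h * (q div r)) x div gcd ((\<lambda>(r, h). h * (q div r)) x) q) = (case x of (r, h) \<Rightarrow> F r h)"
      using sp by (simp add: x(1) qs gc) (simp add: s)
  next
    fix b assume b: "b \<in> {1..q}"
    define g where "g = gcd b q"
    have g: "g > 0" "g dvd b" "g dvd q" using q by (auto simp: g_def)
    obtain b' q' where e: "b = g * b'" "q = g * q'" using g by (elim dvdE)
    have "coprime (b div g) (q div g)"
      unfolding g_def using q by (intro div_gcd_coprime) auto
    then have cop: "coprime b' q'"
      using e g by simp
    have q': "q' > 0" "b' > 0" "b' \<le> q'" using e q g b by auto
    show "(\<lambda>(r, h). h * (q div r)) (q div gcd b q, b div gcd b q) = b"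
      using g q' by (simp add: g_def[symmetric]) (simp add: e)
    show "(q div gcd b q, b div gcd b q) \<in> Sigma {r. r dvd q} totatives"
      using g q' cop by (simp add: g_def[symmetric] in_totatives_iff) (simp add: e)
  qed
  finally show ?thesis ..
qed

lemma gcd_cong_nat: "[n = a] (mod q) \<Longrightarrow> gcd n q = gcd a (q::nat)"
  by (simp add: cong_def) (metis gcd_red_nat gcd.commute)

text \<open>Expand around the mean; the cross term vanishes. This is the least squares property that
  permits any comparison value t in place of the mean.\<close>

lemma sum_square_deviation_le:
  fixes f :: "'a \<Rightarrow> real"
  assumes "finite C" "C \<noteq> {}"
  shows "(\<Sum>a\<in>C. (f a - sum f C / card C)\<^sup>2) \<le> (\<Sum>a\<in>C. (f a - t)\<^sup>2)"
proof -
  define m where "m = sum f C / card C"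
  have c: "real (card C) > 0" using assms by (simp add: card_gt_0_iff)
  have s: "sum f C = m * card C" using c by (simp add: m_def)
  have "(\<Sum>a\<in>C. (f a - t)\<^sup>2) = (\<Sum>a\<in>C. (f a - m)\<^sup>2 + 2 * (m - t) * (f a - m) + (m - t)\<^sup>2)"
    by (intro sum.cong refl) (simp add: power2_eq_square algebra_simps)
  also have "\<dots> = (\<Sum>a\<in>C. (f a - m)\<^sup>2) + 2 * (m - t) * (sum f C - m * card C) + card C * (m - t)\<^sup>2"
    by (simp add: sum.distrib sum_distrib_left[symmetric] sum_subtractf)
  also have "\<dots> \<ge> (\<Sum>a\<in>C. (f a - m)\<^sup>2)" using c by (simp add: s)
  finally show ?thesis by (simp add: m_def)
qed

lemma sum_inverse_multiples_le:
  assumes r: "r > 0" and Y: "Y \<ge> 1"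
  shows "(\<Sum>M | M \<in> {1..Y} \<and> r dvd M. 1 / real M) \<le> (1 + ln (real Y)) / real r"
proof (cases "r \<le> Y")
  case True
  have "(\<Sum>M | M \<in> {1..Y} \<and> r dvd M. 1 / real M) = (\<Sum>j=1..Y div r. 1 / real (r * j))"
  proof (rule sum.reindex_bij_witness[where j = "\<lambda>M. M div r" and i = "\<lambda>j. r * j"])
    fix M assume "M \<in> {M. M \<in> {1..Y} \<and> r dvd M}"
    then show "r * (M div r) = M" "M div r \<in> {1..Y div r}" "1 / real (r * (M div r)) = 1 / real M"
      using r by (auto simp: div_le_mono Suc_le_eq div_greater_zero_iff dvd_imp_le)
  next
    fix j assume j: "j \<in> {1..Y div r}"
    show "r * j div r = j" using r by simp
    have "r * j \<le> Y" using j r by (metis atLeastAtMost_iff less_eq_div_iff_mult_less_eq mult.commute)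
    then show "r * j \<in> {M. M \<in> {1..Y} \<and> r dvd M}" using r j by simp
  qed
  also have "\<dots> = 1 / real r * (\<Sum>j=1..Y div r. 1 / real j)"
    by (simp add: sum_distrib_left)
  also have "\<dots> \<le> 1 / real r * (1 + ln (real (Y div r)))"
    using True r by (intro mult_left_mono sum_inverse_le_ln) (auto simp: Suc_le_eq div_greater_zero_iff)
  also have "\<dots> \<le> 1 / real r * (1 + ln (real Y))"
  proof -
    have "0 < Y div r" using True r by (simp add: div_greater_zero_iff)
    then have "ln (real (Y div r)) \<le> ln (real Y)" by (intro ln_mono) auto
    then show ?thesis by (intro mult_left_mono) auto
  qed
  finally show ?thesis by simp
next
  case False
  then have e: "{M. M \<in> {1..Y} \<and> r dvd M} = {}" by (auto dest: dvd_imp_le)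
  show ?thesis unfolding e using Y by simp
qed

text \<open>What the treatment of the exponential sums needs to know about c: up to N it is a
  combination of runs m M in arithmetic progression with cofactors M <= Y, where the runs m <= z
  carry the weight \<open>al M\<close> and the runs m > z the weight \<open>be M\<close>.
  \<open>D\<close> absorbs the size x^eps of the weights.\<close>

locale hyperbola_split =
  fixes c al be :: "nat \<Rightarrow> real" and N Y z :: nat and D :: real
  assumes split: "\<And>\<phi>::nat \<Rightarrow> complex. (\<Sum>n=1..N. c n *\<^sub>R \<phi> n) =
     (\<Sum>M=1..Y. al M *\<^sub>R (\<Sum>m\<in>{0<..min z (N div M)}. \<phi> (m * M)) + be M *\<^sub>R (\<Sum>m\<in>{z<..N div M}. \<phi> (m * M)))"
    and al_nonneg: "\<And>M. al M \<ge> 0" and be_nonneg: "\<And>M. be M \<ge> 0"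
    and weights_le: "\<And>M. M \<in> {1..Y} \<Longrightarrow> al M + be M \<le> D"
    and D_nonneg: "D \<ge> 0"
begin

definition S :: "real \<Rightarrow> complex" where "S t = (\<Sum>n=1..N. c n *\<^sub>R ee (real n * t))"

text \<open>The M-th term of the split for the constant function 1.\<close>

definition lam :: "nat \<Rightarrow> real" where
  "lam M = al M * real (min z (N div M)) + be M * real (N div M - z)"

text \<open>The chosen c_r. For r dividing M all exponentials e(m h M / r) are 1, so these terms add
  up to a number that does not depend on h.\<close>

definition cr :: "nat \<Rightarrow> real" where "cr r = (\<Sum>M | M \<in> {1..Y} \<and> r dvd M. lam M)"

lemma lam_nonneg: "lam M \<ge> 0"
  by (simp add: lam_def al_nonneg be_nonneg)

lemma lam_le: "M \<in> {1..Y} \<Longrightarrow> lam M \<le> D * real N / real M"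
proof -
  assume M: "M \<in> {1..Y}"
  have "lam M \<le> al M * real (N div M) + be M * real (N div M)"
    unfolding lam_def by (intro add_mono mult_left_mono al_nonneg be_nonneg) auto
  also have "\<dots> = (al M + be M) * real (N div M)" by (simp add: algebra_simps)
  also have "\<dots> \<le> D * (real N / real M)"
    using weights_le[OF M] D_nonneg by (intro mult_mono of_nat_div_le_of_nat) auto
  finally show ?thesis by simp
qed

lemma S_frac:
  assumes r: "r > 0" and cop: "coprime h r"
  shows "S (real h / real r) = complex_of_real (cr r) + (\<Sum>M | M \<in> {1..Y} \<and> \<not> r dvd M.
     al M *\<^sub>R (\<Sum>m\<in>{0<..min z (N div M)}. ee (real m * (real h * real M / real r)))
   + be M *\<^sub>R (\<Sum>m\<in>{z<..N div M}. ee (real m * (real h * real M / real r))))"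
    (is "_ = _ + (\<Sum>M | _. ?T M)")
proof -
  have "S (real h / real r) = (\<Sum>M=1..Y. ?T M)"
    unfolding S_def split by (simp add: mult_ac)
  also have "\<dots> = (\<Sum>M | M \<in> {1..Y} \<and> r dvd M. ?T M) + (\<Sum>M | M \<in> {1..Y} \<and> \<not> r dvd M. ?T M)"
    by (subst sum.union_disjoint [symmetric]) (auto intro!: sum.cong)
  also have "(\<Sum>M | M \<in> {1..Y} \<and> r dvd M. ?T M) = (\<Sum>M | M \<in> {1..Y} \<and> r dvd M. complex_of_real (lam M))"
  proof (intro sum.cong refl)
    fix M assume "M \<in> {M. M \<in> {1..Y} \<and> r dvd M}"
    then have i: "real h * real M / real r \<in> \<int>"
      using r by (subst rational_in_Ints_iff) auto
    have "ee (real m * (real h * real M / real r)) = 1" for m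
      by (rule ee_int) (use i in \<open>intro Ints_mult\<close>, auto)
    then show "?T M = complex_of_real (lam M)"
      by (simp add: lam_def scaleR_conv_of_real)
  qed
  finally show ?thesis by (simp add: cr_def)
qed

text \<open>If r does not divide M, the runs of the M-th term are geometric sums with ratio e(h M /
  r), different from 1 because h is coprime to r. Their bounds are summed over M by
  \<open>sum_kbound_multiples\<close>.\<close>

lemma S_minus_cr_le:
  assumes r: "r > 0" and cop: "coprime h r"
  shows "norm (S (real h / real r) - complex_of_real (cr r)) \<le> D * ((real Y + real r) * (2 * (1 + ln (real r))))"
proof -
  let ?th = "\<lambda>M. real h * real M / real r"
  have "norm (S (real h / real r) - complex_of_real (cr r)) \<le> (\<Sum>M | M \<in> {1..Y} \<and> \<not> r dvd M. D * kbound (?th M))"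
    unfolding S_frac[OF assms] add_diff_cancel_left'
  proof (rule sum_norm_le)
    fix M assume M: "M \<in> {M. M \<in> {1..Y} \<and> \<not> r dvd M}"
    have "\<not> r dvd h * M" using M cop by (simp add: coprime_dvd_mult_right_iff coprime_commute)
    then have ni: "?th M \<notin> \<int>" using rational_in_Ints_iff[OF r] by blast
    have "norm (al M *\<^sub>R (\<Sum>m\<in>{0<..min z (N div M)}. ee (real m * ?th M)) + be M *\<^sub>R (\<Sum>m\<in>{z<..N div M}. ee (real m * ?th M)))
       \<le> al M * norm (\<Sum>m\<in>{0<..min z (N div M)}. ee (real m * ?th M)) + be M * norm (\<Sum>m\<in>{z<..N div M}. ee (real m * ?th M))"
      using al_nonneg[of M] be_nonneg[of M] by (intro order_trans[OF norm_triangle_ineq]) simp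
    also have "\<dots> \<le> al M * kbound (?th M) + be M * kbound (?th M)"
      by (intro add_mono mult_left_mono norm_exp_sum_le ni al_nonneg be_nonneg)
    also have "\<dots> = (al M + be M) * kbound (?th M)" by (simp add: algebra_simps)
    also have "\<dots> \<le> D * kbound (?th M)"
      using weights_le[of M] M by (intro mult_right_mono kbound_nonneg) auto
    finally show "norm (al M *\<^sub>R (\<Sum>m\<in>{0<..min z (N div M)}. ee (real m * ?th M)) + be M *\<^sub>R (\<Sum>m\<in>{z<..N div M}. ee (real m * ?th M))) \<le> D * kbound (?th M)" .
  qed
  also have "\<dots> = D * (\<Sum>M | M \<in> {1..Y} \<and> \<not> r dvd M. kbound (?th M))" by (simp add: sum_distrib_left)
  also have "\<dots> \<le> D * ((real Y + real r) * (2 * (1 + ln (real r))))"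
    by (intro mult_left_mono sum_kbound_multiples r cop D_nonneg)
  finally show ?thesis .
qed

text \<open>For large r there is no gain from subtracting c_r. The decay 1 / r then makes it
  harmless next to the large sieve bound for the sums S.\<close>

lemma cr_le:
  assumes r: "r > 0" and Y: "Y \<ge> 1"
  shows "cr r \<le> D * real N * ((1 + ln (real Y)) / real r)"
proof -
  have "cr r \<le> (\<Sum>M | M \<in> {1..Y} \<and> r dvd M. D * real N * (1 / real M))"
    unfolding cr_def by (intro sum_mono order_trans[OF lam_le]) auto
  also have "\<dots> = D * real N * (\<Sum>M | M \<in> {1..Y} \<and> r dvd M. 1 / real M)"
    by (rule sum_distrib_left [symmetric])
  also have "\<dots> \<le> D * real N * ((1 + ln (real Y)) / real r)"
    using D_nonneg by (intro mult_left_mono sum_inverse_multiples_le assms) auto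
  finally show ?thesis .
qed

lemma cr_nonneg: "cr r \<ge> 0"
  unfolding cr_def by (intro sum_nonneg lam_nonneg)

definition A :: "nat \<Rightarrow> nat \<Rightarrow> real" where
  "A q a = (\<Sum>n | n \<in> {1..N} \<and> [n = a] (mod q). c n)"

text \<open>A model for \<open>A\<close>: the multiples of M fall into the q / gcd(M, q) classes
  divisible by gcd(M, q), and the mass \<open>lam M\<close> is spread evenly over them. As a
  function of a it depends only on gcd(a, q).\<close>

definition G :: "nat \<Rightarrow> nat \<Rightarrow> real" where
  "G q a = (\<Sum>M=1..Y. lam M * (if gcd M q dvd a then real (gcd M q) / real q else 0))"

definition W :: "nat \<Rightarrow> real" where
  "W r = (\<Sum>h\<in>totatives r. (norm (S (real h / real r) - complex_of_real (cr r)))\<^sup>2)"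

lemma A_hat:
  assumes q: "q > 0"
  shows "(\<Sum>a=1..q. complex_of_real (A q a) * ee (real a * (real b / real q))) = S (real b / real q)"
proof -
  have "(\<Sum>a=1..q. complex_of_real (A q a) * ee (real a * (real b / real q)))
     = (\<Sum>a=1..q. \<Sum>n=1..N. complex_of_real (c n) * (if [n = a] (mod q) then ee (real a * (real b / real q)) else 0))"
    by (intro sum.cong refl) (simp add: A_def sum_distrib_right sum.inter_filter[symmetric] if_distrib cong: if_cong)
  also have "\<dots> = (\<Sum>n=1..N. complex_of_real (c n) * (\<Sum>a=1..q. if [n = a] (mod q) then ee (real a * (real b / real q)) else 0))"
    by (subst sum.swap) (simp add: sum_distrib_left)
  also have "\<dots> = (\<Sum>n=1..N. complex_of_real (c n) * ee (real n * (real b / real q)))"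
  proof (intro sum.cong refl arg_cong2[where f = "(*)"] sum_cong_class q)
    fix n a assume "[n = a] (mod q)"
    then have "[a = n] (mod q)" by (rule cong_sym)
    then have "[int a = int n] (mod int q)" by (simp add: cong_int_iff)
    then have "int q dvd int a - int n" by (simp add: cong_iff_dvd_diff)
    then obtain t where "int a - int n = int q * t" by (elim dvdE)
    then have "real_of_int (int a - int n) = of_int (int q * t)" by (simp only:)
    then have t: "real a - real n = real q * of_int t" by simp
    have "real a * (real b / real q) - real n * (real b / real q) = (real a - real n) * real b / real q"
      by (simp add: diff_divide_distrib left_diff_distrib)
    also have "\<dots> = of_int t * real b" using q by (simp add: t)
    finally show "ee (real a * (real b / real q)) = ee (real n * (real b / real q))"
      by (intro ee_cong) simp
  qed
  also have "\<dots> = S (real b / real q)" by (simp add: S_def scaleR_conv_of_real)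
  finally show ?thesis .
qed

text \<open>The indicator of the multiples of g, normalised by g / q, transforms into the indicator
  of the multiples of q / g. With g = gcd(M, q) the roles of b and M are then exchanged, and the
  condition on M becomes the one in \<open>cr\<close>.\<close>

lemma G_hat:
  assumes q: "q > 0"
  shows "(\<Sum>a=1..q. complex_of_real (G q a) * ee (real a * (real b / real q)))
           = complex_of_real (cr (q div gcd b q))"
proof -
  have inner: "(\<Sum>a=1..q. (if g dvd a then complex_of_real (real g / real q) else 0) * ee (real a * (real b / real q)))
      = (if (q div g) dvd b then 1 else 0)" if g: "g dvd q" for g
  proof -
    obtain q' where e: "q = g * q'" using g by (elim dvdE)
    have pos: "g > 0" "q' > 0" using q e by auto
    have "(\<Sum>a=1..q. (if g dvd a then complex_of_real (real g / real q) else 0) * ee (real a * (real b / real q)))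
        = (\<Sum>a | a \<in> {1..q} \<and> g dvd a. complex_of_real (real g / real q) * ee (real a * (real b / real q)))"
      by (subst sum.inter_filter) (auto intro!: sum.cong)
    also have "\<dots> = (\<Sum>a'=1..q'. complex_of_real (1 / real q') * ee (real a' * (of_int (int b) / real q')))"
      by (rule sum.reindex_bij_witness[where j = "\<lambda>a. a div g" and i = "\<lambda>a'. g * a'"])
         (use pos in \<open>auto simp: e Suc_le_eq dvd_imp_le elim!: dvdE\<close>)
    also have "\<dots> = complex_of_real (1 / real q') * (if int q' dvd int b then of_nat q' else 0)"
      unfolding sum_distrib_left[symmetric] sum_ee_full[OF pos(2)] ..
    also have "\<dots> = (if (q div g) dvd b then 1 else 0)" using pos by (simp add: e)
    finally show ?thesis .
  qed
  have "(\<Sum>a=1..q. complex_of_real (G q a) * ee (real a * (real b / real q)))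
     = (\<Sum>a=1..q. \<Sum>M=1..Y. complex_of_real (lam M) * ((if gcd M q dvd a then complex_of_real (real (gcd M q) / real q) else 0) * ee (real a * (real b / real q))))"
    unfolding G_def of_real_sum sum_distrib_right
    by (intro sum.cong refl) simp
  also have "\<dots> = (\<Sum>M=1..Y. complex_of_real (lam M) * (if (q div gcd M q) dvd b then 1 else 0))"
    by (subst sum.swap, intro sum.cong refl, unfold sum_distrib_left[symmetric], subst inner) auto
  also have "\<dots> = (\<Sum>M=1..Y. if (q div gcd b q) dvd M then complex_of_real (lam M) else 0)"
  proof (intro sum.cong refl)
    fix M
    have "(q div gcd M q) dvd b \<longleftrightarrow> (q div gcd b q) dvd M"
      using dvd_mult_gcd_iff[OF q, of b M] dvd_mult_gcd_iff[OF q, of M b] by (simp add: mult.commute)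
    then show "complex_of_real (lam M) * (if (q div gcd M q) dvd b then 1 else 0) = (if (q div gcd b q) dvd M then complex_of_real (lam M) else 0)"
      by simp
  qed
  also have "\<dots> = complex_of_real (cr (q div gcd b q))"
    unfolding cr_def of_real_sum by (rule sum.inter_filter [symmetric]) simp
  finally show ?thesis .
qed

text \<open>Parseval applied to A - G; each frequency b / q is then reduced to lowest terms.\<close>

lemma sum_A_minus_G:
  assumes q: "q > 0"
  shows "real q * (\<Sum>a=1..q. (A q a - G q a)\<^sup>2) = (\<Sum>r | r dvd q. W r)"
proof -
  have "real q * (\<Sum>a=1..q. (A q a - G q a)\<^sup>2) = real q * (\<Sum>a=1..q. (norm (complex_of_real (A q a - G q a)))\<^sup>2)"
    unfolding norm_of_real power2_abs ..
  also have "\<dots> = (\<Sum>b=1..q. (norm (\<Sum>a=1..q. complex_of_real (A q a - G q a) * ee (real a * (real b / real q))))\<^sup>2)"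
    by (rule parseval_mod[OF q, symmetric])
  also have "\<dots> = (\<Sum>b=1..q. (norm (S (real b / real q) - complex_of_real (cr (q div gcd b q))))\<^sup>2)"
    unfolding of_real_diff left_diff_distrib sum_subtractf A_hat[OF q] G_hat[OF q] ..
  also have "\<dots> = (\<Sum>b=1..q. (norm (S (real (b div gcd b q) / real (q div gcd b q)) - complex_of_real (cr (q div gcd b q))))\<^sup>2)"
  proof (intro sum.cong refl)
    fix b
    define g where "g = gcd b q"
    have g: "g > 0" "g dvd b" "g dvd q" using q by (auto simp: g_def)
    have "real b / real q = real (b div g) / real (q div g)"
      using g q by (simp add: real_of_nat_div)
    then show "(norm (S (real b / real q) - complex_of_real (cr (q div gcd b q))))\<^sup>2 = (norm (S (real (b div gcd b q) / real (q div gcd b q)) - complex_of_real (cr (q div gcd b q))))\<^sup>2"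
      by (simp add: g_def)
  qed
  also have "\<dots> = (\<Sum>r | r dvd q. W r)"
    unfolding W_def by (rule sum_by_reduced_fraction[OF q])
  finally show ?thesis .
qed

definition avg :: "nat \<Rightarrow> nat \<Rightarrow> real" where
  "avg q a = (\<Sum>n | n \<in> {1..N} \<and> gcd n q = gcd a q. c n) / real (totient (q div gcd a q))"

text \<open>On each class gcd(a, q) = g, which has totient(q / g) members, \<open>avg\<close> is the
  mean of \<open>A\<close> while \<open>G\<close> is constant. The least squares property applies
  class by class.\<close>

lemma sum_A_minus_avg:
  assumes q: "q > 0"
  shows "(\<Sum>a=1..q. (A q a - avg q a)\<^sup>2) \<le> (\<Sum>r | r dvd q. W r) / real q"
proof -
  define Cl where "Cl = (\<lambda>g. {a \<in> {1..q}. gcd a q = g})"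
  have part: "(\<Sum>a=1..q. f a) = (\<Sum>g | g dvd q. \<Sum>a\<in>Cl g. f a)" for f :: "nat \<Rightarrow> real"
    unfolding Cl_def using q by (intro sum.group [symmetric]) auto
  have "(\<Sum>a=1..q. (A q a - avg q a)\<^sup>2) = (\<Sum>g | g dvd q. \<Sum>a\<in>Cl g. (A q a - avg q a)\<^sup>2)" by (rule part)
  also have "\<dots> \<le> (\<Sum>g | g dvd q. \<Sum>a\<in>Cl g. (A q a - G q a)\<^sup>2)"
  proof (rule sum_mono)
    fix g assume "g \<in> {g. g dvd q}"
    then have g: "g dvd q" by simp
    then have gp: "g > 0" "g \<le> q" using q by (auto intro: Nat.gr0I dvd_imp_le)
    have "g \<in> Cl g" using g gp by (auto simp: Cl_def)
    then have ne: "Cl g \<noteq> {}" by blast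
    have fin: "finite (Cl g)" by (simp add: Cl_def)
    have card: "card (Cl g) = totient (q div g)"
    proof -
      have "Cl g = {a \<in> {0<..q}. gcd a q = g}" by (auto simp: Cl_def)
      then show ?thesis using card_gcd_eq_totient[OF q g] by simp
    qed
    have "sum (A q) (Cl g) = (\<Sum>n=1..N. \<Sum>a=1..q. if [n = a] (mod q) then (if gcd a q = g then c n else 0) else 0)"
    proof -
      have "sum (A q) (Cl g) = (\<Sum>a=1..q. if gcd a q = g then A q a else 0)"
        unfolding Cl_def by (rule sum.inter_filter) simp
      also have "\<dots> = (\<Sum>a=1..q. \<Sum>n=1..N. if [n = a] (mod q) then (if gcd a q = g then c n else 0) else 0)"
        by (intro sum.cong refl) (auto simp: A_def sum.inter_filter[symmetric])
      finally show ?thesis by (subst (asm) sum.swap)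
    qed
    also have "\<dots> = (\<Sum>n=1..N. if gcd n q = g then c n else 0)"
    proof (intro sum.cong refl sum_cong_class q)
      fix n a assume "[n = a] (mod q)"
      then show "(if gcd a q = g then c n else 0) = (if gcd n q = g then c n else 0)"
        by (simp add: gcd_cong_nat)
    qed
    also have "\<dots> = (\<Sum>n | n \<in> {1..N} \<and> gcd n q = g. c n)"
      by (rule sum.inter_filter [symmetric]) simp
    finally have sA: "sum (A q) (Cl g) = (\<Sum>n | n \<in> {1..N} \<and> gcd n q = g. c n)" .
    have mean: "avg q a = sum (A q) (Cl g) / card (Cl g)" if "a \<in> Cl g" for a
    proof -
      have "gcd a q = g" using that by (simp add: Cl_def)
      then show ?thesis by (simp only: avg_def sA card)
    qed
    have Gc: "G q a = G q g" if "a \<in> Cl g" for a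
    proof -
      have "gcd M q dvd a \<longleftrightarrow> gcd M q dvd g" for M
        using that g unfolding Cl_def by (auto intro: dvd_trans gcd_greatest)
      then show ?thesis by (simp add: G_def)
    qed
    have "(\<Sum>a\<in>Cl g. (A q a - avg q a)\<^sup>2) = (\<Sum>a\<in>Cl g. (A q a - sum (A q) (Cl g) / card (Cl g))\<^sup>2)"
      by (intro sum.cong refl) (simp add: mean)
    also have "\<dots> \<le> (\<Sum>a\<in>Cl g. (A q a - G q g)\<^sup>2)"
      by (rule sum_square_deviation_le[OF fin ne])
    also have "\<dots> = (\<Sum>a\<in>Cl g. (A q a - G q a)\<^sup>2)"
      by (intro sum.cong refl) (simp add: Gc)
    finally show "(\<Sum>a\<in>Cl g. (A q a - avg q a)\<^sup>2) \<le> (\<Sum>a\<in>Cl g. (A q a - G q a)\<^sup>2)" .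
  qed
  also have "\<dots> = (\<Sum>a=1..q. (A q a - G q a)\<^sup>2)" by (rule part [symmetric])
  also have "\<dots> = (\<Sum>r | r dvd q. W r) / real q"
    using sum_A_minus_G[OF q] q by (simp add: field_simps)
  finally show ?thesis .
qed

end

section \<open>The variance around the averages over gcd classes\<close>

text \<open>A telescoping sum. The hypothesis reaches down to the empty sum a = b + 1, where both
  sides are 0.\<close>

lemma sum_reciprocal_consecutive:
  assumes "1 \<le> a" "a \<le> Suc b"
  shows "(\<Sum>t=a..b. 1 / (real t * (real t + 1))) = 1 / real a - 1 / (real b + 1)"
  using assms(2)
proof (induction b)
  case 0
  then have "a = 1" using assms(1) by simp
  then show ?case by simp
next
  case (Suc b)
  show ?case
  proof (cases "a = Suc (Suc b)")
    case False
    then have ab: "a \<le> Suc b" using Suc.prems by simp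
    have "1 / (real (Suc b) * (real (Suc b) + 1)) = 1 / (real b + 1) - 1 / (real (Suc b) + 1)"
      by (simp add: field_simps)
    then show ?thesis using Suc.IH[OF ab] ab by (simp only: sum.cl_ivl_Suc) simp
  qed (auto simp: add.commute)
qed

text \<open>Partial summation: 1 / r is written as 1 / (Q + 1) plus the sum of 1 / (t (t + 1)) over
  r <= t <= Q, and after interchanging the sums only the partial sums of V up to t occur. It
  converts the large sieve bound into one with the weight 1 / r.\<close>

lemma sum_weighted_le:
  fixes V :: "nat \<Rightarrow> real"
  assumes V: "\<And>r. V r \<ge> 0" and B: "\<And>t. t \<in> {1..Q} \<Longrightarrow> (\<Sum>r=1..t. V r) \<le> K * (N + (real t)\<^sup>2)"
    and K: "K \<ge> 0" and N: "N \<ge> 0" and R: "R < Q"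
  shows "(\<Sum>r=Suc R..Q. V r / real r) \<le> K * (2 * N / (real R + 1) + 2 * real Q)"
proof -
  have "(\<Sum>r=Suc R..Q. V r / real r) = (\<Sum>r=Suc R..Q. V r * (1 / (real Q + 1) + (\<Sum>t=r..Q. 1 / (real t * (real t + 1)))))"
    by (intro sum.cong refl) (simp add: sum_reciprocal_consecutive)
  also have "\<dots> = (\<Sum>r=Suc R..Q. V r) / (real Q + 1) + (\<Sum>r=Suc R..Q. \<Sum>t=r..Q. V r * (1 / (real t * (real t + 1))))"
    by (simp add: ring_distribs sum.distrib sum_divide_distrib sum_distrib_left)
  also have "(\<Sum>r=Suc R..Q. \<Sum>t=r..Q. V r * (1 / (real t * (real t + 1)))) = (\<Sum>t=Suc R..Q. \<Sum>r=Suc R..t. V r * (1 / (real t * (real t + 1))))"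
    by (subst sum.Sigma, simp, simp, subst sum.Sigma, simp, simp,
        rule sum.reindex_bij_witness[where i = "\<lambda>(t, r). (r, t)" and j = "\<lambda>(r, t). (t, r)"]) auto
  also have "\<dots> = (\<Sum>t=Suc R..Q. (\<Sum>r=Suc R..t. V r) * (1 / (real t * (real t + 1))))"
    by (intro sum.cong refl) (simp only: sum_distrib_right)
  also have "(\<Sum>r=Suc R..Q. V r) / (real Q + 1) + \<dots> \<le>
      K * (N + (real Q)\<^sup>2) / (real Q + 1) + (\<Sum>t=Suc R..Q. K * (N * (1 / (real t * (real t + 1))) + 1))"
  proof (intro add_mono divide_right_mono sum_mono)
    have 1: "(\<Sum>r=Suc R..t. V r) \<le> K * (N + (real t)\<^sup>2)" if "t \<in> {1..Q}" for t
    proof -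
      have "(\<Sum>r=Suc R..t. V r) \<le> (\<Sum>r=1..t. V r)"
        using V by (intro sum_mono2) auto
      also have "\<dots> \<le> K * (N + (real t)\<^sup>2)" by (rule B[OF that])
      finally show ?thesis .
    qed
    show "(\<Sum>r=Suc R..Q. V r) \<le> K * (N + (real Q)\<^sup>2)" using R by (intro 1) auto
    fix t assume t: "t \<in> {Suc R..Q}"
    have "(\<Sum>r=Suc R..t. V r) * (1 / (real t * (real t + 1))) \<le> K * (N + (real t)\<^sup>2) * (1 / (real t * (real t + 1)))"
      using t by (intro mult_right_mono 1) auto
    also have "\<dots> = K * (N * (1 / (real t * (real t + 1))) + (real t)\<^sup>2 / (real t * (real t + 1)))"
      by (simp add: ring_distribs add_divide_distrib)
    also have "\<dots> \<le> K * (N * (1 / (real t * (real t + 1))) + 1)"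
      using t K by (intro mult_left_mono add_left_mono) (auto simp: power2_eq_square)
    finally show "(\<Sum>r=Suc R..t. V r) * (1 / (real t * (real t + 1))) \<le> K * (N * (1 / (real t * (real t + 1))) + 1)" .
  qed auto
  also have "(\<Sum>t=Suc R..Q. K * (N * (1 / (real t * (real t + 1))) + 1)) = K * (N * (\<Sum>t=Suc R..Q. 1 / (real t * (real t + 1))) + real (Q - R))"
    by (simp only: sum_distrib_left[symmetric] sum.distrib) simp
  also have "\<dots> \<le> K * (N * (1 / (real R + 1)) + real Q)"
  proof (intro mult_left_mono add_mono K N)
    show "(\<Sum>t=Suc R..Q. 1 / (real t * (real t + 1))) \<le> 1 / (real R + 1)"
      using R by (subst sum_reciprocal_consecutive) (auto simp: add.commute)
  qed auto
  also have "K * (N + (real Q)\<^sup>2) / (real Q + 1) \<le> K * (N / (real R + 1) + real Q)"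
  proof -
    have "N / (real Q + 1) \<le> N / (real R + 1)" using R N by (intro divide_left_mono) auto
    moreover have "(real Q)\<^sup>2 / (real Q + 1) \<le> real Q" by (simp add: power2_eq_square field_simps)
    ultimately have "(N + (real Q)\<^sup>2) / (real Q + 1) \<le> N / (real R + 1) + real Q" by (simp add: add_divide_distrib)
    then have "K * ((N + (real Q)\<^sup>2) / (real Q + 1)) \<le> K * (N / (real R + 1) + real Q)" using K by (rule mult_left_mono)
    then show ?thesis by simp
  qed
  finally show ?thesis by (simp add: algebra_simps)
qed

text \<open>The pointwise bound on c feeds the mean square in the large sieve; Y <= N allows every
  logarithm to be replaced by that of N.\<close>

locale bounded_hyperbola_split = hyperbola_split +
  assumes c_le: "\<And>n. n \<in> {1..N} \<Longrightarrow> \<bar>c n\<bar> \<le> D" and Y: "1 \<le> Y" "Y \<le> N"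
begin

lemma W_nonneg: "W r \<ge> 0"
  by (simp add: W_def sum_nonneg)

text \<open>Interchange q and r: the reciprocals of the multiples q <= Q of r sum to at most (1 + ln
  Q) / r, so only the weight 1 / r and one logarithm remain.\<close>

lemma sum_variance_le_W:
  assumes Q: "Q \<ge> 1"
  shows "(\<Sum>q=1..Q. \<Sum>a=1..q. (A q a - avg q a)\<^sup>2) \<le> (1 + ln (real Q)) * (\<Sum>r=1..Q. W r / real r)"
proof -
  have "(\<Sum>q=1..Q. \<Sum>a=1..q. (A q a - avg q a)\<^sup>2) \<le> (\<Sum>q=1..Q. (\<Sum>r | r dvd q. W r) / real q)"
    by (intro sum_mono sum_A_minus_avg) auto
  also have "\<dots> = (\<Sum>q=1..Q. \<Sum>r=1..Q. if r dvd q then W r * (1 / real q) else 0)"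
  proof (intro sum.cong refl)
    fix q assume q: "q \<in> {1..Q}"
    have "{r. r dvd q} = {r \<in> {1..Q}. r dvd q}"
      using q by (auto dest: dvd_imp_le intro: Nat.gr0I simp: Suc_le_eq)
    then have "(\<Sum>r | r dvd q. W r) / real q = (\<Sum>r | r \<in> {1..Q} \<and> r dvd q. W r * (1 / real q))"
      by (simp add: sum_divide_distrib)
    also have "\<dots> = (\<Sum>r=1..Q. if r dvd q then W r * (1 / real q) else 0)"
      by (rule sum.inter_filter) simp
    finally show "(\<Sum>r | r dvd q. W r) / real q = (\<Sum>r=1..Q. if r dvd q then W r * (1 / real q) else 0)" .
  qed
  also have "\<dots> = (\<Sum>r=1..Q. W r * (\<Sum>q | q \<in> {1..Q} \<and> r dvd q. 1 / real q))"
    unfolding sum_distrib_left by (rule trans[OF sum.swap], rule sum.cong[OF refl], rule sum.inter_filter [symmetric]) simp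
  also have "\<dots> \<le> (\<Sum>r=1..Q. W r * ((1 + ln (real Q)) / real r))"
    using Q by (intro sum_mono mult_left_mono sum_inverse_multiples_le W_nonneg) auto
  also have "\<dots> = (1 + ln (real Q)) * (\<Sum>r=1..Q. W r / real r)"
    by (simp add: sum_distrib_left mult.commute)
  finally show ?thesis .
qed

lemma card_totatives_le: "real (card (totatives r)) \<le> real r"
  using totient_le[of r] by (simp add: totient_def)

text \<open>At most r values of h, each with the pointwise bound. For r <= Y one has Y + r <= 2 Y,
  and together with the factor 2 of that bound this gives 4, hence 16 after squaring.\<close>

lemma W_small:
  assumes "1 \<le> r" "r \<le> Y"
  shows "W r / real r \<le> 16 * (D * real Y * (1 + ln (real N)))\<^sup>2"
proof -
  have r: "r > 0" using assms by simp
  let ?b = "D * ((real Y + real r) * (2 * (1 + ln (real r))))"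
  let ?b' = "4 * (D * real Y * (1 + ln (real N)))"
  have "?b \<le> D * ((2 * real Y) * (2 * (1 + ln (real N))))"
    using assms D_nonneg Y by (intro mult_left_mono mult_mono add_left_mono ln_mono) auto
  then have b: "?b \<le> ?b'" by (simp add: mult_ac)
  have "W r \<le> (\<Sum>h\<in>totatives r. ?b'\<^sup>2)"
    unfolding W_def
  proof (intro sum_mono power_mono)
    fix h assume "h \<in> totatives r"
    then have "coprime h r" by (simp add: in_totatives_iff)
    from order_trans[OF S_minus_cr_le[OF r this] b]
    show "norm (S (real h / real r) - complex_of_real (cr r)) \<le> ?b'" .
  qed auto
  also have "\<dots> = real (card (totatives r)) * ?b'\<^sup>2" by simp
  also have "\<dots> \<le> real r * ?b'\<^sup>2" by (intro mult_right_mono card_totatives_le) auto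
  finally have "W r / real r \<le> ?b'\<^sup>2" using r by (simp add: divide_le_eq mult.commute)
  then show ?thesis by (simp only: power_mult_distrib) simp
qed

text \<open>The square of S - c_r is at most 2 |S|^2 + 2 c_r^2. The first part goes to the large
  sieve and partial summation. In the second, c_r <= E / r leaves the tail of the sum of 1 / r^2
  beyond R, which is of order 1 / R.\<close>

lemma sum_W_large:
  assumes R: "R < Q" and Q: "Q \<le> N"
  shows "(\<Sum>r=Suc R..Q. W r / real r) \<le> D\<^sup>2 * (1 + ln (real N))\<^sup>2 * (20 * (real N)\<^sup>2 / (real R + 1) + 16 * real N * real Q)"
proof -
  let ?L = "1 + ln (real N)"
  have N1: "N \<ge> 1" using Y by simp
  have L1: "?L \<ge> 1" using N1 by simp
  define V where "V = (\<lambda>r. \<Sum>h\<in>totatives r. (norm (S (real h / real r)))\<^sup>2)"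
  have V0: "V r \<ge> 0" for r by (simp add: V_def sum_nonneg)
  \<comment> \<open>The large sieve factor 2 (1 + 2 ln t) is at most 4 L, and the mean square of the
    coefficients is at most N D^2.\<close>
  define K where "K = 4 * ?L * (real N * D\<^sup>2)"
  have K0: "K \<ge> 0" using L1 by (simp add: K_def)
  have B: "(\<Sum>r=1..t. V r) \<le> K * (real N + (real t)\<^sup>2)" if t: "t \<in> {1..Q}" for t
  proof -
    have "(\<Sum>r=1..t. V r) = (\<Sum>(r, h)\<in>farey t. (norm (\<Sum>n=1..N. complex_of_real (c n) * ee (real n * (real h / real r))))\<^sup>2)"
      unfolding V_def farey_Sigma S_def scaleR_conv_of_real by (subst sum.Sigma) auto
    also have "\<dots> \<le> (real N + 2 * (1 + 2 * ln (real t)) * (real t)\<^sup>2) * (\<Sum>n=1..N. (norm (complex_of_real (c n)))\<^sup>2)"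
      using t by (intro large_sieve) auto
    also have "\<dots> \<le> (4 * ?L * (real N + (real t)\<^sup>2)) * (real N * D\<^sup>2)"
    proof (intro mult_mono)
      have "ln (real t) \<le> ln (real N)" using t Q by (intro ln_mono) auto
      then have "2 * (1 + 2 * ln (real t)) \<le> 4 * ?L" by simp
      then have "2 * (1 + 2 * ln (real t)) * (real t)\<^sup>2 \<le> 4 * ?L * (real t)\<^sup>2" by (intro mult_right_mono) auto
      moreover have "1 * real N \<le> (4 * ?L) * real N" using L1 by (intro mult_right_mono) auto
      ultimately show "real N + 2 * (1 + 2 * ln (real t)) * (real t)\<^sup>2 \<le> 4 * ?L * (real N + (real t)\<^sup>2)"
        by (simp add: ring_distribs)
      have "(\<Sum>n=1..N. (norm (complex_of_real (c n)))\<^sup>2) \<le> (\<Sum>n=1..N. D\<^sup>2)"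
        using c_le by (intro sum_mono power_mono) auto
      then show "(\<Sum>n=1..N. (norm (complex_of_real (c n)))\<^sup>2) \<le> real N * D\<^sup>2" by simp
    qed (use L1 in \<open>auto intro!: sum_nonneg mult_nonneg_nonneg\<close>)
    finally show ?thesis by (simp add: K_def mult_ac)
  qed
  have alg: "D\<^sup>2 * (16 * L\<^sup>2 * (n + m) + 4 * L\<^sup>2 * n) = D\<^sup>2 * L\<^sup>2 * (20 * n + 16 * m)" for L n m :: real
    by (simp add: algebra_simps)
  define E where "E = D * real N * ?L"
  have E0: "E \<ge> 0" using D_nonneg L1 by (simp add: E_def)
  have W: "W r / real r \<le> 2 * (V r / real r) + 4 * E\<^sup>2 * (1 / (real r * (real r + 1)))" if r: "r \<in> {Suc R..Q}" for r
  proof -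
    have rp: "r > 0" using r by simp
    have "cr r \<le> D * real N * ((1 + ln (real Y)) / real r)" by (rule cr_le[OF rp Y(1)])
    also have "\<dots> \<le> D * real N * (?L / real r)"
      using Y D_nonneg by (intro mult_left_mono divide_right_mono add_left_mono ln_mono) auto
    finally have cr: "cr r \<le> E / real r" by (simp add: E_def)
    have cr2: "(cr r)\<^sup>2 \<le> (E / real r)\<^sup>2" by (intro power_mono cr cr_nonneg)
    have "W r \<le> (\<Sum>h\<in>totatives r. 2 * (norm (S (real h / real r)))\<^sup>2 + 2 * (cr r)\<^sup>2)"
      unfolding W_def
    proof (rule sum_mono)
      fix h
      have "norm (S (real h / real r) - complex_of_real (cr r)) \<le> norm (S (real h / real r)) + cr r"
        using norm_triangle_ineq4[of "S (real h / real r)" "complex_of_real (cr r)"] cr_nonneg[of r] by simp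
      then have "(norm (S (real h / real r) - complex_of_real (cr r)))\<^sup>2 \<le> (norm (S (real h / real r)) + cr r)\<^sup>2"
        by (intro power_mono) auto
      also have "\<dots> \<le> 2 * (norm (S (real h / real r)))\<^sup>2 + 2 * (cr r)\<^sup>2"
        using sum_squares_bound[of "norm (S (real h / real r))" "cr r"] by (simp add: power2_sum)
      finally show "(norm (S (real h / real r) - complex_of_real (cr r)))\<^sup>2 \<le> 2 * (norm (S (real h / real r)))\<^sup>2 + 2 * (cr r)\<^sup>2" .
    qed
    also have "\<dots> = 2 * V r + real (card (totatives r)) * (2 * (cr r)\<^sup>2)"
      by (simp add: sum.distrib V_def sum_distrib_left)
    also have "\<dots> \<le> 2 * V r + real r * (2 * (E / real r)\<^sup>2)"
      using cr2 by (intro add_left_mono mult_mono card_totatives_le) auto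
    finally have "W r / real r \<le> (2 * V r + real r * (2 * (E / real r)\<^sup>2)) / real r" by (intro divide_right_mono) auto
    also have "\<dots> = 2 * (V r / real r) + 2 * E\<^sup>2 * (1 / (real r)\<^sup>2)"
      using rp by (simp add: field_simps power2_eq_square)
    \<comment> \<open>The passage to 1 / (r (r + 1)) lets the tail telescope.\<close>
    also have "2 * E\<^sup>2 * (1 / (real r)\<^sup>2) \<le> 2 * E\<^sup>2 * (2 / (real r * (real r + 1)))"
    proof (intro mult_left_mono)
      have "1 \<le> real r" using rp by simp
      then have "real r * (real r + 1) \<le> real r * (2 * real r)" by (intro mult_left_mono) auto
      then have "2 / (real r * (2 * real r)) \<le> 2 / (real r * (real r + 1))"
        using rp by (intro divide_left_mono mult_pos_pos) auto
      then show "1 / (real r)\<^sup>2 \<le> 2 / (real r * (real r + 1))"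
        by (simp add: power2_eq_square)
    qed auto
    finally show ?thesis by simp
  qed
  have "(\<Sum>r=Suc R..Q. W r / real r) \<le> (\<Sum>r=Suc R..Q. 2 * (V r / real r) + 4 * E\<^sup>2 * (1 / (real r * (real r + 1))))"
    by (intro sum_mono W)
  also have "\<dots> = 2 * (\<Sum>r=Suc R..Q. V r / real r) + 4 * E\<^sup>2 * (\<Sum>r=Suc R..Q. 1 / (real r * (real r + 1)))"
    by (simp add: sum.distrib sum_distrib_left)
  also have "\<dots> \<le> 2 * (K * (2 * real N / (real R + 1) + 2 * real Q)) + 4 * E\<^sup>2 * (1 / (real R + 1))"
  proof (intro add_mono mult_left_mono)
    show "(\<Sum>r=Suc R..Q. V r / real r) \<le> K * (2 * real N / (real R + 1) + 2 * real Q)"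
      by (rule sum_weighted_le[OF V0 B K0 _ R]) auto
    show "(\<Sum>r=Suc R..Q. 1 / (real r * (real r + 1))) \<le> 1 / (real R + 1)"
      using R by (subst sum_reciprocal_consecutive) (auto simp: add.commute)
  qed auto
  also have "\<dots> = D\<^sup>2 * (16 * ?L * ((real N)\<^sup>2 / (real R + 1) + real N * real Q) + 4 * ?L\<^sup>2 * ((real N)\<^sup>2 / (real R + 1)))"
    by (simp add: K_def E_def field_simps power2_eq_square)
  also have "\<dots> \<le> D\<^sup>2 * (16 * ?L\<^sup>2 * ((real N)\<^sup>2 / (real R + 1) + real N * real Q) + 4 * ?L\<^sup>2 * ((real N)\<^sup>2 / (real R + 1)))"
  proof -
    have "?L * 1 \<le> ?L * ?L" using L1 by (intro mult_left_mono) auto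
    then have "?L \<le> ?L\<^sup>2" by (simp add: power2_eq_square)
    then show ?thesis by (intro mult_left_mono add_right_mono mult_right_mono) auto
  qed
  also have "\<dots> = D\<^sup>2 * ?L\<^sup>2 * (20 * ((real N)\<^sup>2 / (real R + 1)) + 16 * (real N * real Q))"
    by (simp only: alg)
  finally show ?thesis by (simp add: mult.assoc)
qed

text \<open>The cut R is still free. The minimum and the conditional record that for Q <= R the
  large sieve range is empty, which the bound without a term x^(3/2) requires when the number of
  factors is 2.\<close>

lemma variance_le:
  assumes Q: "1 \<le> Q" "Q \<le> N" and R: "R \<le> Y"
  shows "(\<Sum>q=1..Q. \<Sum>a=1..q. (A q a - avg q a)\<^sup>2) \<le> D\<^sup>2 * (1 + ln (real N)) ^ 3 *
     (16 * real (min R Q) * (real Y)\<^sup>2 + (if R < Q then 20 * (real N)\<^sup>2 / (real R + 1) + 16 * real N * real Q else 0))"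
proof -
  let ?L = "1 + ln (real N)"
  have L1: "?L \<ge> 1" using Y by simp
  let ?X = "if R < Q then 20 * (real N)\<^sup>2 / (real R + 1) + 16 * real N * real Q else 0"
  have X0: "?X \<ge> 0" by simp
  have alg: "m * (16 * (D * y * L)\<^sup>2) + D\<^sup>2 * L\<^sup>2 * X = D\<^sup>2 * L\<^sup>2 * (16 * m * y\<^sup>2 + X)" for m y L X :: real
    by (simp add: power_mult_distrib algebra_simps)
  have small: "(\<Sum>r=1..min R Q. W r / real r) \<le> real (min R Q) * (16 * (D * real Y * ?L)\<^sup>2)"
  proof -
    have "(\<Sum>r=1..min R Q. W r / real r) \<le> (\<Sum>r=1..min R Q. 16 * (D * real Y * ?L)\<^sup>2)"
      using R by (intro sum_mono W_small) auto
    then show ?thesis by simp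
  qed
  have "(\<Sum>r=1..Q. W r / real r) \<le> real (min R Q) * (16 * (D * real Y * ?L)\<^sup>2) + D\<^sup>2 * ?L\<^sup>2 * ?X"
  proof (cases "R < Q")
    case True
    have "{1..Q} = {1..R} \<union> {Suc R..Q}" using True by auto
    then have "(\<Sum>r=1..Q. W r / real r) = (\<Sum>r\<in>{1..R} \<union> {Suc R..Q}. W r / real r)" by (rule arg_cong)
    also have "\<dots> = (\<Sum>r=1..R. W r / real r) + (\<Sum>r=Suc R..Q. W r / real r)"
      by (rule sum.union_disjoint) auto
    finally have "(\<Sum>r=1..Q. W r / real r) = (\<Sum>r=1..R. W r / real r) + (\<Sum>r=Suc R..Q. W r / real r)" .
    then show ?thesis using True small sum_W_large[OF True Q(2)] by (simp add: min_def)
  next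
    case False
    then have "min R Q = Q" by simp
    then show ?thesis using False small by simp
  qed
  also have "\<dots> = D\<^sup>2 * ?L\<^sup>2 * (16 * real (min R Q) * (real Y)\<^sup>2 + ?X)"
    by (rule alg)
  finally have 1: "(\<Sum>r=1..Q. W r / real r) \<le> D\<^sup>2 * ?L\<^sup>2 * (16 * real (min R Q) * (real Y)\<^sup>2 + ?X)" .
  have "(\<Sum>q=1..Q. \<Sum>a=1..q. (A q a - avg q a)\<^sup>2) \<le> (1 + ln (real Q)) * (\<Sum>r=1..Q. W r / real r)"
    by (rule sum_variance_le_W[OF Q(1)])
  also have "\<dots> \<le> ?L * (D\<^sup>2 * ?L\<^sup>2 * (16 * real (min R Q) * (real Y)\<^sup>2 + ?X))"
    using Q L1 by (intro mult_mono 1 add_left_mono ln_mono sum_nonneg divide_nonneg_nonneg W_nonneg) auto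
  also have "\<dots> = D\<^sup>2 * ?L ^ 3 * (16 * real (min R Q) * (real Y)\<^sup>2 + ?X)"
    by (simp only: power2_eq_square power3_eq_cube mult_ac)
  finally show ?thesis .
qed

end

section \<open>The Piltz divisor problem\<close>

text \<open>f(y) = O(y^(theta + eps)) on y >= 1 for every eps. In this calculus polynomials in log y
  have exponent 0 and exponents add under products, so that no explicit powers of logarithms have to
  be followed.\<close>

definition pb :: "real \<Rightarrow> (real \<Rightarrow> real) \<Rightarrow> bool" where
  "pb \<theta> f \<longleftrightarrow> (\<forall>\<epsilon>>0. \<exists>C. \<forall>y\<ge>1. \<bar>f y\<bar> \<le> C * y powr (\<theta> + \<epsilon>))"

lemma pbI:
  assumes "\<And>\<epsilon>. \<epsilon> > 0 \<Longrightarrow> \<exists>C. \<forall>y\<ge>1. \<bar>f y\<bar> \<le> C * y powr (\<theta> + \<epsilon>)"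
  shows "pb \<theta> f"
  using assms by (simp add: pb_def)

lemma pbE:
  assumes "pb \<theta> f" "\<epsilon> > 0"
  obtains C where "C \<ge> 0" "\<And>y. y \<ge> 1 \<Longrightarrow> \<bar>f y\<bar> \<le> C * y powr (\<theta> + \<epsilon>)"
proof -
  obtain C where C: "\<forall>y\<ge>1. \<bar>f y\<bar> \<le> C * y powr (\<theta> + \<epsilon>)"
    using assms by (auto simp: pb_def)
  have "\<bar>f y\<bar> \<le> \<bar>C\<bar> * y powr (\<theta> + \<epsilon>)" if "y \<ge> 1" for y
  proof -
    have "C * y powr (\<theta> + \<epsilon>) \<le> \<bar>C\<bar> * y powr (\<theta> + \<epsilon>)" by (intro mult_right_mono) auto
    moreover have "\<bar>f y\<bar> \<le> C * y powr (\<theta> + \<epsilon>)" using C that by blast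
    ultimately show ?thesis by linarith
  qed
  then show ?thesis using that[of "\<bar>C\<bar>"] by simp
qed

lemma pb_dominated:
  assumes "pb \<theta> g" "\<And>y. y \<ge> 1 \<Longrightarrow> \<bar>f y\<bar> \<le> \<bar>g y\<bar>"
  shows "pb \<theta> f"
  using assms unfolding pb_def by (meson order_trans)

lemma pb_cong:
  assumes "pb \<theta> g" "\<And>y. y \<ge> 1 \<Longrightarrow> f y = g y"
  shows "pb \<theta> f"
  using assms by (intro pb_dominated[of \<theta> g f]) auto

lemma pb_mono:
  assumes "pb \<theta> f" "\<theta> \<le> \<theta>'"
  shows "pb \<theta>' f"
proof (rule pbI)
  fix \<epsilon> :: real assume "\<epsilon> > 0"
  then obtain C where C: "C \<ge> 0" "\<And>y. y \<ge> 1 \<Longrightarrow> \<bar>f y\<bar> \<le> C * y powr (\<theta> + \<epsilon>)"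
    using pbE[OF assms(1)] by blast
  have "\<bar>f y\<bar> \<le> C * y powr (\<theta>' + \<epsilon>)" if "y \<ge> 1" for y
  proof -
    have "y powr (\<theta> + \<epsilon>) \<le> y powr (\<theta>' + \<epsilon>)" using that assms(2) by (intro powr_mono) auto
    then show ?thesis using C that by (meson order_trans mult_left_mono)
  qed
  then show "\<exists>C. \<forall>y\<ge>1. \<bar>f y\<bar> \<le> C * y powr (\<theta>' + \<epsilon>)" by blast
qed

lemma pb_add:
  assumes "pb \<theta> f" "pb \<theta> g"
  shows "pb \<theta> (\<lambda>y. f y + g y)"
proof (rule pbI)
  fix \<epsilon> :: real assume e: "\<epsilon> > 0"
  obtain C where C: "\<And>y. y \<ge> 1 \<Longrightarrow> \<bar>f y\<bar> \<le> C * y powr (\<theta> + \<epsilon>)" using pbE[OF assms(1) e] by blast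
  obtain C' where C': "\<And>y. y \<ge> 1 \<Longrightarrow> \<bar>g y\<bar> \<le> C' * y powr (\<theta> + \<epsilon>)" using pbE[OF assms(2) e] by blast
  have "\<bar>f y + g y\<bar> \<le> (C + C') * y powr (\<theta> + \<epsilon>)" if "y \<ge> 1" for y
    using C[OF that] C'[OF that] by (simp add: algebra_simps)
  then show "\<exists>C. \<forall>y\<ge>1. \<bar>f y + g y\<bar> \<le> C * y powr (\<theta> + \<epsilon>)" by blast
qed

lemma pb_mult:
  assumes "pb a f" "pb b g"
  shows "pb (a + b) (\<lambda>y. f y * g y)"
proof (rule pbI)
  fix \<epsilon> :: real assume "\<epsilon> > 0"
  then have e: "\<epsilon> / 2 > 0" by simp
  obtain C where C: "C \<ge> 0" "\<And>y. y \<ge> 1 \<Longrightarrow> \<bar>f y\<bar> \<le> C * y powr (a + \<epsilon> / 2)" using pbE[OF assms(1) e] by blast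
  obtain C' where C': "C' \<ge> 0" "\<And>y. y \<ge> 1 \<Longrightarrow> \<bar>g y\<bar> \<le> C' * y powr (b + \<epsilon> / 2)" using pbE[OF assms(2) e] by blast
  have "\<bar>f y * g y\<bar> \<le> (C * C') * y powr (a + b + \<epsilon>)" if "y \<ge> 1" for y
  proof -
    have "\<bar>f y * g y\<bar> \<le> (C * y powr (a + \<epsilon> / 2)) * (C' * y powr (b + \<epsilon> / 2))"
      unfolding abs_mult using C C' that by (intro mult_mono) auto
    also have "\<dots> = (C * C') * (y powr (a + \<epsilon> / 2) * y powr (b + \<epsilon> / 2))" by simp
    also have "y powr (a + \<epsilon> / 2) * y powr (b + \<epsilon> / 2) = y powr (a + b + \<epsilon>)"
      unfolding powr_add[symmetric] by (rule arg_cong2[where f = "(powr)"]) auto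
    finally show ?thesis .
  qed
  then show "\<exists>C. \<forall>y\<ge>1. \<bar>f y * g y\<bar> \<le> C * y powr (a + b + \<epsilon>)" by blast
qed

lemma pb_const: "pb 0 (\<lambda>_. c)"
proof (rule pbI)
  fix \<epsilon> :: real assume e: "\<epsilon> > 0"
  have "\<bar>c\<bar> \<le> \<bar>c\<bar> * y powr (0 + \<epsilon>)" if "y \<ge> 1" for y
    using mult_left_mono[of 1 "y powr \<epsilon>" "\<bar>c\<bar>"] ge_one_powr_ge_zero[of y \<epsilon>] that e by simp
  then show "\<exists>C. \<forall>y\<ge>1. \<bar>c\<bar> \<le> C * y powr (0 + \<epsilon>)" by blast
qed

lemma pb_cmult: "pb \<theta> f \<Longrightarrow> pb \<theta> (\<lambda>y. c * f y)"
  using pb_mult[OF pb_const, of \<theta> f c] by simp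

lemma pb_diff: "pb \<theta> f \<Longrightarrow> pb \<theta> g \<Longrightarrow> pb \<theta> (\<lambda>y. f y - g y)"
  using pb_add[of \<theta> f "\<lambda>y. (-1) * g y"] pb_cmult[of \<theta> g "-1"] by simp

lemma pb_powr: "pb a (\<lambda>y. y powr a)"
proof (rule pbI)
  fix \<epsilon> :: real assume e: "\<epsilon> > 0"
  have "\<bar>y powr a\<bar> \<le> 1 * y powr (a + \<epsilon>)" if "y \<ge> 1" for y
    using that e by (simp add: powr_mono)
  then show "\<exists>C. \<forall>y\<ge>1. \<bar>y powr a\<bar> \<le> C * y powr (a + \<epsilon>)" by blast
qed

lemma pb_ident: "pb 1 (\<lambda>y. y)"
  by (rule pb_cong[OF pb_powr[of 1]]) simp

lemma pb_inverse: "pb (-1) (\<lambda>y. 1 / y)"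
  by (rule pb_cong[OF pb_powr[of "-1"]]) (simp add: powr_minus inverse_eq_divide)

lemma pb_ln: "pb 0 ln"
proof (rule pbI)
  fix \<epsilon> :: real assume e: "\<epsilon> > 0"
  have "\<bar>ln y\<bar> \<le> (1 / \<epsilon>) * y powr (0 + \<epsilon>)" if "y \<ge> 1" for y
    using ln_powr_bound[OF that e] that by simp
  then show "\<exists>C. \<forall>y\<ge>1. \<bar>ln y\<bar> \<le> C * y powr (0 + \<epsilon>)" by blast
qed

lemma pb_poly_ln: "pb 0 (\<lambda>y. poly p (ln y))"
proof (induction p)
  case 0
  then show ?case using pb_const[of 0] by simp
next
  case (pCons a p)
  have "pb (0 + 0) (\<lambda>y. ln y * poly p (ln y))" by (intro pb_mult pb_ln pCons.IH)
  then have "pb 0 (\<lambda>y. a + ln y * poly p (ln y))" using pb_add[OF pb_const] by simp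
  then show ?case by simp
qed

lemma pb_compose:
  assumes "pb a f" "c > 0"
  shows "pb (c * a) (\<lambda>y. f (y powr c))"
proof (rule pbI)
  fix \<epsilon> :: real assume "\<epsilon> > 0"
  then have e: "\<epsilon> / c > 0" using assms by simp
  obtain C where C: "\<And>y. y \<ge> 1 \<Longrightarrow> \<bar>f y\<bar> \<le> C * y powr (a + \<epsilon> / c)" using pbE[OF assms(1) e] by blast
  have "\<bar>f (y powr c)\<bar> \<le> C * y powr (c * a + \<epsilon>)" if "y \<ge> 1" for y
  proof -
    have "y powr c \<ge> 1" using that assms by (intro ge_one_powr_ge_zero) auto
    from C[OF this] show ?thesis using assms by (simp add: powr_powr ring_distribs)
  qed
  then show "\<exists>C. \<forall>y\<ge>1. \<bar>f (y powr c)\<bar> \<le> C * y powr (c * a + \<epsilon>)" by blast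
qed

section \<open>Constants of summation and their tails\<close>

lemma powr_MVT_decreasing:
  fixes \<eta> :: real
  assumes "\<eta> > 0" "n \<ge> 1"
  shows "real (Suc n) powr (-1 - \<eta>) \<le> (real n powr (-\<eta>) - real (Suc n) powr (-\<eta>)) / \<eta>"
proof -
  have "\<exists>z. real n < z \<and> z < real (Suc n) \<and>
     real (Suc n) powr (-\<eta>) - real n powr (-\<eta>) = (real (Suc n) - real n) * (-\<eta> * z powr (-\<eta> - 1))"
    by (rule MVT2) (use assms in \<open>auto intro!: derivative_eq_intros\<close>)
  then obtain z where z: "real n < z" "z < real (Suc n)"
    "real (Suc n) powr (-\<eta>) - real n powr (-\<eta>) = -\<eta> * z powr (-\<eta> - 1)" by auto
  have "real (Suc n) powr (-1 - \<eta>) \<le> z powr (-1 - \<eta>)"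
    using z assms by (intro powr_mono2') auto
  also have "\<dots> = (real n powr (-\<eta>) - real (Suc n) powr (-\<eta>)) / \<eta>"
  proof -
    have e: "-\<eta> - 1 = -1 - \<eta>" by simp
    have "real n powr (-\<eta>) - real (Suc n) powr (-\<eta>) = \<eta> * z powr (-1 - \<eta>)"
      using z(3) unfolding e by linarith
    then show ?thesis using assms by simp
  qed
  finally show ?thesis .
qed

lemma nat_floor_bounds:
  assumes "y \<ge> (1::real)"
  shows "real (nat \<lfloor>y\<rfloor>) \<le> y" "y < real (nat \<lfloor>y\<rfloor>) + 1" "nat \<lfloor>y\<rfloor> \<ge> 1" "y \<le> 2 * real (nat \<lfloor>y\<rfloor>)"
proof -
  show a: "real (nat \<lfloor>y\<rfloor>) \<le> y" "y < real (nat \<lfloor>y\<rfloor>) + 1" using assms by linarith+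
  show b: "nat \<lfloor>y\<rfloor> \<ge> 1" using assms by (simp add: le_nat_iff le_floor_iff)
  show "y \<le> 2 * real (nat \<lfloor>y\<rfloor>)" using a(2) b by linarith
qed

text \<open>By the mean value theorem (n + 1)^(-1-eta) is at most (n^(-eta) - (n + 1)^(-eta)) / eta,
  so the tail is dominated by a telescoping series.\<close>

lemma tail_sum_bound:
  fixes b :: "nat \<Rightarrow> real"
  assumes \<eta>: "\<eta> > 0" and b: "\<And>n. n \<ge> 1 \<Longrightarrow> \<bar>b n\<bar> \<le> C * real n powr (-1 - \<eta>)" and C: "C \<ge> 0"
  shows "summable (\<lambda>n. b (Suc n))"
    and "n \<ge> 1 \<Longrightarrow> \<bar>(\<Sum>i=1..n. b i) - (\<Sum>i. b (Suc i))\<bar> \<le> C / \<eta> * real n powr (-\<eta>)"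
proof -
  have "summable (\<lambda>n. real n powr (-1 - \<eta>))" using \<eta> by (simp add: summable_real_powr_iff)
  then have s1: "summable (\<lambda>n. real (Suc n) powr (-1 - \<eta>))" by (subst summable_Suc_iff)
  have "norm (b (Suc n)) \<le> C * real (Suc n) powr (-1 - \<eta>)" for n using b[of "Suc n"] by simp
  then show s: "summable (\<lambda>n. b (Suc n))"
    by (intro summable_comparison_test'[OF summable_mult[OF s1, of C]]) auto
  assume n: "n \<ge> 1"
  have tele: "(\<lambda>i. (real (i + n) powr (-\<eta>) - real (Suc (i + n)) powr (-\<eta>)) / \<eta>) sums (real n powr (-\<eta>) / \<eta>)"
  proof -
    have "(\<lambda>i. real i powr (-\<eta>)) \<longlonglongrightarrow> 0"
      using \<eta> by (intro tendsto_neg_powr filterlim_real_sequentially) auto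
    then have "(\<lambda>i. real (i + n) powr (-\<eta>)) \<longlonglongrightarrow> 0" by (rule LIMSEQ_ignore_initial_segment)
    from telescope_sums'[OF this]
    have "(\<lambda>i. real (i + n) powr (-\<eta>) - real (Suc i + n) powr (-\<eta>)) sums (real (0 + n) powr (-\<eta>) - 0)" .
    from sums_divide[OF this, of \<eta>] show ?thesis by simp
  qed
  have sn: "summable (\<lambda>i. b (Suc (i + n)))" using s by (rule summable_ignore_initial_segment)
  have "(\<Sum>i. b (Suc i)) = (\<Sum>i. b (Suc (i + n))) + (\<Sum>i<n. b (Suc i))"
    by (rule suminf_split_initial_segment[OF s])
  also have "(\<Sum>i<n. b (Suc i)) = (\<Sum>i=1..n. b i)"
    by (rule sum.reindex_bij_witness[where i = "\<lambda>i. i - 1" and j = Suc]) auto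
  finally have "\<bar>(\<Sum>i=1..n. b i) - (\<Sum>i. b (Suc i))\<bar> = norm (\<Sum>i. b (Suc (i + n)))" by simp
  also have "\<dots> \<le> (\<Sum>i. C * ((real (i + n) powr (-\<eta>) - real (Suc (i + n)) powr (-\<eta>)) / \<eta>))"
  proof (rule norm_suminf_le)
    show "summable (\<lambda>i. C * ((real (i + n) powr (-\<eta>) - real (Suc (i + n)) powr (-\<eta>)) / \<eta>))"
      using tele by (intro summable_mult) (simp add: sums_iff)
    fix i
    have "norm (b (Suc (i + n))) \<le> C * real (Suc (i + n)) powr (-1 - \<eta>)" using b[of "Suc (i + n)"] by simp
    also have "\<dots> \<le> C * ((real (i + n) powr (-\<eta>) - real (Suc (i + n)) powr (-\<eta>)) / \<eta>)"
      using C n \<eta> by (intro mult_left_mono powr_MVT_decreasing) auto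
    finally show "norm (b (Suc (i + n))) \<le> C * ((real (i + n) powr (-\<eta>) - real (Suc (i + n)) powr (-\<eta>)) / \<eta>)" .
  qed
  also have "\<dots> = C * (real n powr (-\<eta>) / \<eta>)"
    using tele by (intro sums_unique [symmetric] sums_mult)
  finally show "\<bar>(\<Sum>i=1..n. b i) - (\<Sum>i. b (Suc i))\<bar> \<le> C / \<eta> * real n powr (-\<eta>)" by simp
qed


lemma pb_tail_sum:
  fixes b :: "nat \<Rightarrow> real"
  assumes \<eta>: "\<eta> > 0"
    and b: "\<And>\<epsilon>. \<epsilon> > 0 \<Longrightarrow> \<exists>C\<ge>0. \<forall>n\<ge>1. \<bar>b n\<bar> \<le> C * real n powr (-1 - \<eta> + \<epsilon>)"
  shows "pb (-\<eta>) (\<lambda>y. (\<Sum>i=1..nat \<lfloor>y\<rfloor>. b i) - (\<Sum>i. b (Suc i)))"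
proof (rule pbI)
  fix \<epsilon> :: real assume e: "\<epsilon> > 0"
  \<comment> \<open>Capping the loss at eta / 2 keeps the majorant summable; larger losses only
    weaken the claim.\<close>
  define e' where "e' = min \<epsilon> (\<eta> / 2)"
  have e': "e' > 0" "e' \<le> \<epsilon>" "e' < \<eta>" using e \<eta> by (auto simp: e'_def)
  obtain C where C: "C \<ge> 0" "\<And>n. n \<ge> 1 \<Longrightarrow> \<bar>b n\<bar> \<le> C * real n powr (-1 - \<eta> + e')"
    using b[OF e'(1)] by blast
  define h where "h = \<eta> - e'"
  have h: "h > 0" using e' by (simp add: h_def)
  have bh: "\<bar>b n\<bar> \<le> C * real n powr (-1 - h)" if "n \<ge> 1" for n
    using C(2)[OF that] by (simp add: h_def algebra_simps)
  have "\<bar>(\<Sum>i=1..nat \<lfloor>y\<rfloor>. b i) - (\<Sum>i. b (Suc i))\<bar> \<le> (C / h * 2 powr h) * y powr (-\<eta> + \<epsilon>)" if y: "y \<ge> 1" for y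
  proof -
    note f = nat_floor_bounds[OF y]
    have "\<bar>(\<Sum>i=1..nat \<lfloor>y\<rfloor>. b i) - (\<Sum>i. b (Suc i))\<bar> \<le> C / h * real (nat \<lfloor>y\<rfloor>) powr (-h)"
      by (rule tail_sum_bound(2)[OF h bh C(1) f(3)])
    also have "\<dots> \<le> C / h * (y / 2) powr (-h)"
      using f y h C(1) by (intro mult_left_mono powr_mono2') auto
    also have "(y / 2) powr (-h) = 2 powr h * y powr (-h)"
      using y by (simp add: powr_divide powr_minus field_simps)
    also have "C / h * (2 powr h * y powr (-h)) \<le> C / h * (2 powr h * y powr (-\<eta> + \<epsilon>))"
      using y e' h C(1) by (intro mult_left_mono powr_mono) (auto simp: h_def)
    finally show ?thesis by (simp add: mult_ac)
  qed
  then show "\<exists>C. \<forall>y\<ge>1. \<bar>(\<Sum>i=1..nat \<lfloor>y\<rfloor>. b i) - (\<Sum>i. b (Suc i))\<bar> \<le> C * y powr (-\<eta> + \<epsilon>)" by blast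
qed

lemma poly_antiderivative: "\<exists>P :: real poly. pderiv P = p"
proof
  show "pderiv (\<Sum>i\<le>degree p. monom (coeff p i / real (Suc i)) (Suc i)) = p"
    by (intro poly_eqI) (simp add: coeff_pderiv coeff_sum coeff_eq_0 del: of_nat_Suc)
qed

text \<open>The slack u <= 2 y covers intermediate points from the mean value theorem, which lie
  between y and the next integer.\<close>

lemma poly_ln_bound:
  fixes p :: "real poly" and \<epsilon> :: real
  assumes "\<epsilon> > 0"
  obtains C where "C \<ge> 0" "\<And>u y. 1 \<le> u \<Longrightarrow> u \<le> 2 * y \<Longrightarrow> \<bar>poly p (ln u)\<bar> \<le> C * y powr \<epsilon>"
proof -
  obtain C where C: "C \<ge> 0" "\<And>u. u \<ge> 1 \<Longrightarrow> \<bar>poly p (ln u)\<bar> \<le> C * u powr (0 + \<epsilon>)"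
    using pbE[OF pb_poly_ln[of p] assms] by blast
  have "\<bar>poly p (ln u)\<bar> \<le> (C * 2 powr \<epsilon>) * y powr \<epsilon>" if u: "1 \<le> u" "u \<le> 2 * y" for u y
  proof -
    have "\<bar>poly p (ln u)\<bar> \<le> C * u powr \<epsilon>" using C(2)[OF u(1)] by simp
    also have "\<dots> \<le> C * (2 * y) powr \<epsilon>" using u assms C(1) by (intro mult_left_mono powr_mono2) auto
    also have "\<dots> = (C * 2 powr \<epsilon>) * y powr \<epsilon>" using u by (simp add: powr_mult)
    finally show ?thesis .
  qed
  then show ?thesis using that[of "C * 2 powr \<epsilon>"] C(1) by simp
qed

lemma poly_ln_deriv:
  assumes "u > 0"
  shows "((\<lambda>u. poly P (ln u)) has_real_derivative poly (pderiv P) (ln u) / u) (at u)"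
  using assms by (auto intro!: derivative_eq_intros DERIV_chain'[OF DERIV_ln poly_DERIV] simp: divide_inverse)

text \<open>Comparison with the integral. The antiderivative F of p(log u) / u is again a polynomial
  in log u, and f(n) - (F(n + 1) - F(n)) is of order n^(-2) up to logarithms. These differences sum
  to a constant B with tail O(y^(-1+eps)).\<close>

lemma sum_poly_ln_over_n:
  fixes p :: "real poly"
  shows "\<exists>P. pb (-1) (\<lambda>y. (\<Sum>n=1..nat \<lfloor>y\<rfloor>. poly p (ln (real n)) / real n) - poly P (ln y))"
proof -
  obtain P0 :: "real poly" where P0: "pderiv P0 = p" using poly_antiderivative by blast
  define F where "F = (\<lambda>u. poly P0 (ln u))"
  define f where "f = (\<lambda>u. poly p (ln u) / u)"
  define b where "b = (\<lambda>n. f (real n) - (F (real (Suc n)) - F (real n)))"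
  have F': "(F has_real_derivative f u) (at u)" if "u > 0" for u
    unfolding F_def f_def using poly_ln_deriv[OF that, of P0] P0 by simp
  have f': "(f has_real_derivative (poly (pderiv p - p) (ln u) / u\<^sup>2)) (at u)" if "u > 0" for u
    unfolding f_def using that
    by (auto intro!: derivative_eq_intros poly_ln_deriv simp: field_simps power2_eq_square)
  have b_le: "\<exists>C\<ge>0. \<forall>n\<ge>1. \<bar>b n\<bar> \<le> C * real n powr (-1 - 1 + \<epsilon>)" if e: "\<epsilon> > 0" for \<epsilon>
  proof -
    obtain C where C: "C \<ge> 0" "\<And>u y. 1 \<le> u \<Longrightarrow> u \<le> 2 * y \<Longrightarrow> \<bar>poly (pderiv p - p) (ln u)\<bar> \<le> C * y powr \<epsilon>"
      using poly_ln_bound[OF e] by blast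
    have "\<bar>b n\<bar> \<le> C * real n powr (-1 - 1 + \<epsilon>)" if n: "n \<ge> 1" for n
    proof -
      have "\<exists>z. real n < z \<and> z < real (Suc n) \<and> F (real (Suc n)) - F (real n) = (real (Suc n) - real n) * f z"
        using n by (intro MVT2 F') auto
      then obtain z where z: "real n < z" "z < real (Suc n)" "F (real (Suc n)) - F (real n) = f z" by auto
      have "\<exists>w. real n < w \<and> w < z \<and> f z - f (real n) = (z - real n) * (poly (pderiv p - p) (ln w) / w\<^sup>2)"
        using n z by (intro MVT2 f') auto
      then obtain w where w: "real n < w" "w < z" "f z - f (real n) = (z - real n) * (poly (pderiv p - p) (ln w) / w\<^sup>2)" by auto
      have "\<bar>b n\<bar> = \<bar>f z - f (real n)\<bar>" by (simp only: b_def z(3) abs_minus_commute)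
      also have "\<dots> = \<bar>z - real n\<bar> * (\<bar>poly (pderiv p - p) (ln w)\<bar> / w\<^sup>2)" by (simp add: w(3) abs_mult)
      also have "\<dots> \<le> 1 * (C * real n powr \<epsilon> / (real n)\<^sup>2)"
      proof (intro mult_mono frac_le C(2))
        show "(real n)\<^sup>2 \<le> w\<^sup>2" using w n by (intro power_mono) auto
      qed (use z w n C(1) in auto)
      also have "\<dots> = C * real n powr (-1 - 1 + \<epsilon>)"
        using n by (simp add: powr_add powr_minus powr_diff powr_numeral divide_inverse)
      finally show ?thesis .
    qed
    then show ?thesis using C(1) by blast
  qed
  define B where "B = (\<Sum>i. b (Suc i))"
  \<comment> \<open>For p = 1 this is log y plus Euler's constant.\<close>
  define P where "P = P0 + [:B - F 1:]"
  have t1: "pb (-1) (\<lambda>y. (\<Sum>i=1..nat \<lfloor>y\<rfloor>. b i) - B)"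
    unfolding B_def by (rule pb_tail_sum) (simp, rule b_le)
  have t2: "pb (-1) (\<lambda>y. F (real (Suc (nat \<lfloor>y\<rfloor>))) - F y)"
  proof (rule pbI)
    fix \<epsilon> :: real assume e: "\<epsilon> > 0"
    obtain C where C: "C \<ge> 0" "\<And>u y. 1 \<le> u \<Longrightarrow> u \<le> 2 * y \<Longrightarrow> \<bar>poly p (ln u)\<bar> \<le> C * y powr \<epsilon>"
      using poly_ln_bound[OF e] by blast
    have "\<bar>F (real (Suc (nat \<lfloor>y\<rfloor>))) - F y\<bar> \<le> C * y powr (-1 + \<epsilon>)" if y: "y \<ge> 1" for y
    proof -
      note fl = nat_floor_bounds[OF y]
      have "\<exists>z. y < z \<and> z < real (Suc (nat \<lfloor>y\<rfloor>)) \<and> F (real (Suc (nat \<lfloor>y\<rfloor>))) - F y = (real (Suc (nat \<lfloor>y\<rfloor>)) - y) * f z"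
      proof (intro MVT2 F')
        show "y < real (Suc (nat \<lfloor>y\<rfloor>))" using fl(2) by simp
      qed (use y in auto)
      then obtain z where z: "y < z" "z < real (Suc (nat \<lfloor>y\<rfloor>))" "F (real (Suc (nat \<lfloor>y\<rfloor>))) - F y = (real (Suc (nat \<lfloor>y\<rfloor>)) - y) * f z" by blast
      have "\<bar>F (real (Suc (nat \<lfloor>y\<rfloor>))) - F y\<bar> = \<bar>real (Suc (nat \<lfloor>y\<rfloor>)) - y\<bar> * (\<bar>poly p (ln z)\<bar> / z)"
        unfolding z(3) abs_mult f_def using z y by simp
      also have "\<dots> \<le> 1 * (C * y powr \<epsilon> / y)"
        using z y fl C by (intro mult_mono frac_le C(2)) auto
      also have "\<dots> = C * y powr (-1 + \<epsilon>)"
        using y by (simp add: powr_diff divide_inverse)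
      finally show ?thesis .
    qed
    then show "\<exists>C. \<forall>y\<ge>1. \<bar>F (real (Suc (nat \<lfloor>y\<rfloor>))) - F y\<bar> \<le> C * y powr (-1 + \<epsilon>)" by blast
  qed
  have "pb (-1) (\<lambda>y. (\<Sum>n=1..nat \<lfloor>y\<rfloor>. poly p (ln (real n)) / real n) - poly P (ln y))"
  proof (rule pb_cong[OF pb_add[OF t1 t2]])
    fix y :: real assume "y \<ge> 1"
    have "(\<Sum>i=1..N. b i) = (\<Sum>n=1..N. poly p (ln (real n)) / real n) - (F (real (Suc N)) - F 1)" for N
      by (induction N) (auto simp: b_def f_def)
    then show "(\<Sum>n=1..nat \<lfloor>y\<rfloor>. poly p (ln (real n)) / real n) - poly P (ln y) =
      (\<Sum>i=1..nat \<lfloor>y\<rfloor>. b i) - B + (F (real (Suc (nat \<lfloor>y\<rfloor>))) - F y)"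
      by (simp add: P_def F_def)
  qed
  then show ?thesis by blast
qed

lemma abel_sum_over_n:
  fixes a :: "nat \<Rightarrow> real"
  shows "(\<Sum>n=1..N. a n / real n) = (\<Sum>n=1..N. a n) / (real N + 1) + (\<Sum>n=1..N. (\<Sum>m=1..n. a m) / (real n * (real n + 1)))"
proof (induction N)
  case (Suc N)
  define x where "x = real N + 1"
  have x: "x > 0" by (simp add: x_def)
  define A where "A = (\<Sum>n=1..N. a n)"
  have "t / x = t / (x + 1) + t / (x * (x + 1))" for t
  proof -
    have "t / (x + 1) + t / (x * (x + 1)) = (t * x + t) / (x * (x + 1))"
      using x by (simp add: add_divide_distrib)
    also have "t * x + t = t * (x + 1)" by (simp add: algebra_simps)
    finally show ?thesis using x by simp
  qed
  from this[of "A + a (Suc N)"]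
  have eq: "A / x + a (Suc N) / x = (A + a (Suc N)) / (x + 1) + (A + a (Suc N)) / (x * (x + 1))"
    by (simp add: add_divide_distrib)
  let ?S = "\<Sum>n=1..N. (\<Sum>m=1..n. a m) / (real n * (real n + 1))"
  have "(\<Sum>n=1..Suc N. a n / real n) = (\<Sum>n=1..N. a n / real n) + a (Suc N) / x"
    by (simp add: x_def add.commute)
  also have "\<dots> = A / x + ?S + a (Suc N) / x" unfolding Suc by (simp add: A_def x_def)
  also have "\<dots> = (A + a (Suc N)) / (x + 1) + (?S + (A + a (Suc N)) / (x * (x + 1)))" using eq by simp
  also have "\<dots> = (\<Sum>n=1..Suc N. a n) / (real (Suc N) + 1) + (\<Sum>n=1..Suc N. (\<Sum>m=1..n. a m) / (real n * (real n + 1)))"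
    by (simp add: A_def x_def add_ac)
  finally show ?case .
qed simp

text \<open>Partial summation. The main term y p(log y) leads to a sum of p(log n) / n, already
  known. The error, divided by n (n + 1), is summable because theta < 1; it contributes a constant
  and a tail with exponent theta - 1.\<close>

lemma sum_over_n_asymp:
  fixes a :: "nat \<Rightarrow> real" and p :: "real poly"
  assumes as: "pb \<theta> (\<lambda>y. (\<Sum>n=1..nat \<lfloor>y\<rfloor>. a n) - y * poly p (ln y))" and \<theta>: "0 \<le> \<theta>" "\<theta> < 1"
  shows "\<exists>P. pb (\<theta> - 1) (\<lambda>y. (\<Sum>n=1..nat \<lfloor>y\<rfloor>. a n / real n) - poly P (ln y))"
proof -
  define A where "A = (\<lambda>y::real. \<Sum>n=1..nat \<lfloor>y\<rfloor>. a n)"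
  define E where "E = (\<lambda>y. A y - y * poly p (ln y))"
  have E: "pb \<theta> E" using as by (simp add: E_def A_def)
  have A1: "pb 1 A"
  proof (rule pb_cong)
    show "pb 1 (\<lambda>y. E y + y * poly p (ln y))"
      using pb_add[OF pb_mono[OF E] pb_mult[OF pb_ident pb_poly_ln[of p], simplified]] \<theta> by simp
  qed (simp add: E_def)
  obtain P1 where P1: "pb (-1) (\<lambda>y. (\<Sum>n=1..nat \<lfloor>y\<rfloor>. poly p (ln (real n)) / real n) - poly P1 (ln y))"
    using sum_poly_ln_over_n by blast
  define b where "b = (\<lambda>n. (E (real n) - poly p (ln (real n))) / (real n * (real n + 1)))"
  have b_le: "\<exists>C\<ge>0. \<forall>n\<ge>1. \<bar>b n\<bar> \<le> C * real n powr (-1 - (1 - \<theta>) + \<epsilon>)" if e: "\<epsilon> > 0" for \<epsilon>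
  proof -
    have "pb \<theta> (\<lambda>y. E y - poly p (ln y))"
      by (intro pb_diff E pb_mono[OF pb_poly_ln]) (use \<theta> in auto)
    then obtain C where C: "C \<ge> 0" "\<And>y. y \<ge> 1 \<Longrightarrow> \<bar>E y - poly p (ln y)\<bar> \<le> C * y powr (\<theta> + \<epsilon>)"
      using pbE[OF _ e] by blast
    have "\<bar>b n\<bar> \<le> C * real n powr (-1 - (1 - \<theta>) + \<epsilon>)" if n: "n \<ge> 1" for n
    proof -
      have "\<bar>b n\<bar> = \<bar>E (real n) - poly p (ln (real n))\<bar> / (real n * (real n + 1))"
        by (simp add: b_def abs_mult)
      also have "\<dots> \<le> C * real n powr (\<theta> + \<epsilon>) / (real n * real n)"
        using n C by (intro frac_le C(2) mult_left_mono) auto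
      also have "\<dots> = C * real n powr (-1 - (1 - \<theta>) + \<epsilon>)"
      proof -
        have "real n powr (-1 - (1 - \<theta>) + \<epsilon>) = real n powr ((\<theta> + \<epsilon>) - 2)" by (simp add: algebra_simps)
        also have "\<dots> = real n powr (\<theta> + \<epsilon>) / (real n * real n)"
          using n by (simp add: powr_diff powr_numeral power2_eq_square)
        finally show ?thesis by simp
      qed
      finally show ?thesis .
    qed
    then show ?thesis using C(1) by blast
  qed
  define B where "B = (\<Sum>i. b (Suc i))"
  have t1: "pb (\<theta> - 1) (\<lambda>y. (\<Sum>i=1..nat \<lfloor>y\<rfloor>. b i) - B)"
    using pb_tail_sum[of "1 - \<theta>" b] b_le \<theta> by (simp add: B_def)
  have t2: "pb (\<theta> - 1) (\<lambda>y. A y / (real (nat \<lfloor>y\<rfloor>) + 1) - A y / y)"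
  proof (rule pb_dominated)
    show "pb (\<theta> - 1) (\<lambda>y. A y * (1 / y * (1 / y)))"
      using pb_mult[OF A1 pb_mult[OF pb_inverse pb_inverse]] by (rule pb_mono) (use \<theta> in simp)
    fix y :: real assume y: "y \<ge> 1"
    note fl = nat_floor_bounds[OF y]
    define N where "N = real (nat \<lfloor>y\<rfloor>) + 1"
    have N: "y \<le> N" "N \<le> y + 1" using fl by (auto simp: N_def)
    have "A y / N - A y / y = A y * ((y - N) / (N * y))" using N y by (simp add: field_simps)
    then have "\<bar>A y / N - A y / y\<bar> = \<bar>A y\<bar> * ((N - y) / (N * y))"
      using N y by (simp add: abs_mult)
    also have "\<dots> \<le> \<bar>A y\<bar> * (1 / (y * y))"
      using N y by (intro mult_left_mono frac_le mult_right_mono) auto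
    also have "\<dots> = \<bar>A y * (1 / y * (1 / y))\<bar>" using y by (simp add: abs_mult)
    finally show "\<bar>A y / (real (nat \<lfloor>y\<rfloor>) + 1) - A y / y\<bar> \<le> \<bar>A y * (1 / y * (1 / y))\<bar>" by (simp add: N_def)
  qed
  have t3: "pb (\<theta> - 1) (\<lambda>y. E y * (1 / y))"
    using pb_mult[OF E pb_inverse] by simp
  have t4: "pb (\<theta> - 1) (\<lambda>y. (\<Sum>n=1..nat \<lfloor>y\<rfloor>. poly p (ln (real n)) / real n) - poly P1 (ln y))"
    using P1 by (rule pb_mono) (use \<theta> in simp)
  have "pb (\<theta> - 1) (\<lambda>y. (\<Sum>n=1..nat \<lfloor>y\<rfloor>. a n / real n) - poly (p + P1 + [:B:]) (ln y))"
  proof (rule pb_cong[OF pb_add[OF pb_add[OF t1 t2] pb_add[OF t3 t4]]])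
    fix y :: real assume y: "y \<ge> 1"
    define N where "N = nat \<lfloor>y\<rfloor>"
    have tm: "(\<Sum>m=1..n. a m) / (real n * (real n + 1)) = poly p (ln (real n)) / real n + b n" if "n \<in> {1..N}" for n
    proof -
      have "(\<Sum>m=1..n. a m) = E (real n) + real n * poly p (ln (real n))" by (simp add: E_def A_def)
      moreover have "(e + x * P) / (x * (x + 1)) = P / x + (e - P) / (x * (x + 1))" if "x > 0" for e x P :: real
      proof -
        have "P / x + (e - P) / (x * (x + 1)) = (P * (x + 1) + (e - P)) / (x * (x + 1))"
          using that by (simp add: add_divide_distrib)
        also have "P * (x + 1) + (e - P) = e + x * P" by (simp add: algebra_simps)
        finally show ?thesis by simp
      qed
      ultimately show ?thesis using that by (simp add: b_def)
    qed
    have "(\<Sum>n=1..N. a n / real n) = A y / (real N + 1) + (\<Sum>n=1..N. poly p (ln (real n)) / real n + b n)"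
      unfolding abel_sum_over_n[of a N] using tm by (simp add: A_def N_def)
    also have "A y / (real N + 1) = (A y / (real N + 1) - A y / y) + (E y * (1 / y) + poly p (ln y))"
    proof -
      have "E y * (1 / y) + poly p (ln y) = A y / y" using y by (simp add: E_def diff_divide_distrib)
      then show ?thesis by simp
    qed
    finally show "(\<Sum>n=1..nat \<lfloor>y\<rfloor>. a n / real n) - poly (p + P1 + [:B:]) (ln y) =
        (\<Sum>i=1..nat \<lfloor>y\<rfloor>. b i) - B + (A y / (real (nat \<lfloor>y\<rfloor>) + 1) - A y / y)
        + (E y * (1 / y) + ((\<Sum>n=1..nat \<lfloor>y\<rfloor>. poly p (ln (real n)) / real n) - poly P1 (ln y)))"
      by (simp add: N_def sum.distrib)
  qed
  then show ?thesis by blast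
qed

text \<open>Induction on p, with r arbitrary: a further factor ln y - ln m is either ln y, which
  leaves the sum, or ln m, which is moved into r as a multiplication by the variable. Cutting at y^c
  makes the error exponent -c.\<close>

lemma sum_shifted_poly:
  fixes p r :: "real poly"
  assumes c: "c > 0"
  shows "\<exists>P. pb (-c) (\<lambda>y. (\<Sum>m=1..nat \<lfloor>y powr c\<rfloor>. poly p (ln y - ln (real m)) * poly r (ln (real m)) / real m) - poly P (ln y))"
proof (induction p arbitrary: r)
  case 0
  have "pb (-c) (\<lambda>y. 0)" using pb_cmult[OF pb_powr, of "-c" 0] by simp
  then show ?case by (intro exI[of _ 0]) simp
next
  case (pCons a p)
  obtain P0 where P0: "pb (-1) (\<lambda>y. (\<Sum>n=1..nat \<lfloor>y\<rfloor>. poly r (ln (real n)) / real n) - poly P0 (ln y))"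
    using sum_poly_ln_over_n by blast
  obtain P1 where P1: "pb (-c) (\<lambda>y. (\<Sum>m=1..nat \<lfloor>y powr c\<rfloor>. poly p (ln y - ln (real m)) * poly r (ln (real m)) / real m) - poly P1 (ln y))"
    using pCons.IH by blast
  obtain P2 where P2: "pb (-c) (\<lambda>y. (\<Sum>m=1..nat \<lfloor>y powr c\<rfloor>. poly p (ln y - ln (real m)) * poly (pCons 0 r) (ln (real m)) / real m) - poly P2 (ln y))"
    using pCons.IH by blast
  have t0: "pb (-c) (\<lambda>y. a * ((\<Sum>n=1..nat \<lfloor>y powr c\<rfloor>. poly r (ln (real n)) / real n) - poly P0 (ln (y powr c))))"
    using pb_cmult[OF pb_compose[OF P0 c]] by simp
  have t1: "pb (-c) (\<lambda>y. ln y * ((\<Sum>m=1..nat \<lfloor>y powr c\<rfloor>. poly p (ln y - ln (real m)) * poly r (ln (real m)) / real m) - poly P1 (ln y)))"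
    using pb_mult[OF pb_ln P1] by simp
  define P where "P = smult a (pcompose P0 [:0, c:]) + pCons 0 P1 - P2"
  show ?case
  proof (intro exI[of _ P] pb_cong[OF pb_diff[OF pb_add[OF t0 t1] P2]])
    fix y :: real assume y: "y \<ge> 1"
    have "(\<Sum>m=1..N. poly (pCons a p) (ln y - ln (real m)) * poly r (ln (real m)) / real m)
        = a * (\<Sum>m=1..N. poly r (ln (real m)) / real m) + ln y * (\<Sum>m=1..N. poly p (ln y - ln (real m)) * poly r (ln (real m)) / real m)
          - (\<Sum>m=1..N. poly p (ln y - ln (real m)) * poly (pCons 0 r) (ln (real m)) / real m)" for N
      unfolding sum_distrib_left sum.distrib[symmetric] sum_subtractf[symmetric]
      by (intro sum.cong refl) (simp add: field_simps)
    moreover have "ln (y powr c) = c * ln y" using y by (simp add: ln_powr)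
    ultimately show "(\<Sum>m=1..nat \<lfloor>y powr c\<rfloor>. poly (pCons a p) (ln y - ln (real m)) * poly r (ln (real m)) / real m) - poly P (ln y) =
        a * ((\<Sum>n=1..nat \<lfloor>y powr c\<rfloor>. poly r (ln (real n)) / real n) - poly P0 (ln (y powr c)))
      + ln y * ((\<Sum>m=1..nat \<lfloor>y powr c\<rfloor>. poly p (ln y - ln (real m)) * poly r (ln (real m)) / real m) - poly P1 (ln y))
      - ((\<Sum>m=1..nat \<lfloor>y powr c\<rfloor>. poly p (ln y - ln (real m)) * poly (pCons 0 r) (ln (real m)) / real m) - poly P2 (ln y))"
      by (simp add: P_def poly_pcompose algebra_simps)
  qed
qed


section \<open>The hyperbola method for the summatory functions\<close>

definition T :: "nat \<Rightarrow> real \<Rightarrow> real" where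
  "T k y = (\<Sum>n=1..nat \<lfloor>y\<rfloor>. dk k n)"

lemma nat_floor_div:
  assumes "y \<ge> (0::real)"
  shows "nat \<lfloor>y / real m\<rfloor> = nat \<lfloor>y\<rfloor> div m"
proof -
  have "\<lfloor>y / real_of_int (int m)\<rfloor> = \<lfloor>y\<rfloor> div int m" by (rule floor_divide_real_eq_div) simp
  then have "nat \<lfloor>y / real m\<rfloor> = nat (\<lfloor>y\<rfloor> div int m)" by simp
  also have "\<dots> = nat \<lfloor>y\<rfloor> div m" using assms by (subst nat_div_distrib) auto
  finally show ?thesis .
qed

text \<open>Sort m n <= y by the new factor m. For m <= M the cofactors are counted by
  \<open>T k\<close>. For m > M the cofactor satisfies n <= N, because M N = y, and the number of m
  in (M, y / n] is counted instead.\<close>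

lemma T_hyperbola:
  assumes MN: "1 \<le> M" "1 \<le> N" "M * N = y"
  shows "T (Suc k) y = (\<Sum>m=1..nat \<lfloor>M\<rfloor>. T k (y / real m))
           + (\<Sum>n=1..nat \<lfloor>N\<rfloor>. dk k n * (real (nat \<lfloor>y / real n\<rfloor>) - real (nat \<lfloor>M\<rfloor>)))"
proof -
  have y1: "M \<le> y" "N \<le> y" "1 \<le> y"
    using MN mult_left_mono[of 1 N M] mult_right_mono[of 1 M N] by auto
  define m0 where "m0 = nat \<lfloor>M\<rfloor>"
  define Y where "Y = nat \<lfloor>y\<rfloor>"
  let ?u = "\<lambda>m::nat. if m \<le> m0 then 1 else 0 :: real"
  let ?v = "\<lambda>m::nat. if m > m0 then 1 else 0 :: real"
  have m0Y: "m0 \<le> Y" using y1 by (simp add: m0_def Y_def nat_mono floor_mono)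
  have NY: "nat \<lfloor>N\<rfloor> \<le> Y" using y1 by (simp add: Y_def nat_mono floor_mono)
  have div: "nat \<lfloor>y / real n\<rfloor> = Y div n" for n using y1 by (simp add: Y_def nat_floor_div)
  have "T (Suc k) y = (\<Sum>n=1..Y. dconv (\<lambda>m. ?u m + ?v m) (dk k) n)"
    unfolding T_def dk_Suc Y_def by (intro sum.cong refl dconv_cong) auto
  also have "\<dots> = (\<Sum>n=1..Y. dconv (dk k) ?u n *\<^sub>R 1) + (\<Sum>n=1..Y. dconv ?v (dk k) n *\<^sub>R 1)"
    unfolding dconv_add_left sum.distrib by (simp add: dconv_commute[of ?u])
  also have "(\<Sum>n=1..Y. dconv (dk k) ?u n *\<^sub>R (1::real)) = (\<Sum>b=1..Y. ?u b *\<^sub>R (\<Sum>a=1..Y div b. dk k a *\<^sub>R 1))"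
    by (rule sum_dconv)
  also have "\<dots> = (\<Sum>b=1..m0. T k (y / real b))"
    using m0Y by (intro sum.mono_neutral_cong_right) (auto simp: T_def div)
  also have "(\<Sum>n=1..Y. dconv ?v (dk k) n *\<^sub>R (1::real)) = (\<Sum>b=1..Y. dk k b *\<^sub>R (\<Sum>a=1..Y div b. ?v a *\<^sub>R 1))"
    by (rule sum_dconv)
  also have "\<dots> = (\<Sum>b=1..Y. dk k b * real (Y div b - m0))"
  proof (intro sum.cong refl)
    fix b
    have "(\<Sum>a=1..Y div b. ?v a *\<^sub>R (1::real)) = (\<Sum>a\<in>{m0<..Y div b}. 1)"
      by (rule sum.mono_neutral_cong_right) auto
    then show "dk k b *\<^sub>R (\<Sum>a=1..Y div b. ?v a *\<^sub>R 1) = dk k b * real (Y div b - m0)" by simp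
  qed
  also have "\<dots> = (\<Sum>b=1..nat \<lfloor>N\<rfloor>. dk k b * (real (nat \<lfloor>y / real b\<rfloor>) - real m0))"
  proof (rule sum.mono_neutral_cong_right)
    show "\<forall>b\<in>{1..Y} - {1..nat \<lfloor>N\<rfloor>}. dk k b * real (Y div b - m0) = 0"
    proof
      fix b assume b: "b \<in> {1..Y} - {1..nat \<lfloor>N\<rfloor>}"
      then have "real b > N" using MN by auto linarith
      then have "y / real b \<le> M" using MN b by (simp add: divide_le_eq mult_left_mono flip: MN(3))
      then have "Y div b \<le> m0" unfolding div[symmetric] m0_def by (intro nat_mono floor_mono)
      then show "dk k b * real (Y div b - m0) = 0" by simp
    qed
    fix b assume b: "b \<in> {1..nat \<lfloor>N\<rfloor>}"
    then have bN: "real b \<le> N" using MN by auto linarith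
    have "M * real b \<le> y" using bN MN by (simp add: mult_left_mono flip: MN(3))
    then have "M \<le> y / real b" using b by (simp add: le_divide_eq)
    then have "m0 \<le> Y div b" unfolding div[symmetric] m0_def by (intro nat_mono floor_mono)
    then show "dk k b * real (Y div b - m0) = dk k b * (real (nat \<lfloor>y / real b\<rfloor>) - real m0)"
      by (simp add: div of_nat_diff)
  qed (use NY in auto)
  finally show ?thesis by (simp add: m0_def)
qed

lemma T_nonneg: "T k y \<ge> 0"
  by (simp add: T_def sum_nonneg)

text \<open>For m <= M the power m^(-theta) is at most M^(1-theta) / m. A harmonic sum then replaces
  the power sum, at the price of a logarithm hidden in eps.\<close>

lemma sum_error_bound:
  fixes E :: "real \<Rightarrow> real"
  assumes E: "pb \<theta> E" and \<theta>: "0 \<le> \<theta>" "\<theta> < 1" and c: "0 < c" "c \<le> 1"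
  shows "pb (\<theta> + (1 - \<theta>) * c) (\<lambda>y. \<Sum>m=1..nat \<lfloor>y powr c\<rfloor>. E (y / real m))"
proof (rule pbI)
  fix \<epsilon> :: real assume e: "\<epsilon> > 0"
  then have e2: "\<epsilon> / 2 > 0" by simp
  obtain C where C: "C \<ge> 0" "\<And>y. y \<ge> 1 \<Longrightarrow> \<bar>E y\<bar> \<le> C * y powr (\<theta> + \<epsilon> / 2)" using pbE[OF E e2] by blast
  have "pb 0 (\<lambda>y. 1 + ln y)" by (intro pb_add pb_const pb_ln)
  then obtain C' where C': "C' \<ge> 0" "\<And>y. y \<ge> 1 \<Longrightarrow> \<bar>1 + ln y\<bar> \<le> C' * y powr (0 + \<epsilon> / 2)" using pbE[OF _ e2] by blast
  have "\<bar>\<Sum>m=1..nat \<lfloor>y powr c\<rfloor>. E (y / real m)\<bar> \<le> (C * C') * y powr (\<theta> + (1 - \<theta>) * c + \<epsilon>)" if y: "y \<ge> 1" for y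
  proof -
    define M where "M = y powr c"
    have M: "1 \<le> M" "M \<le> y"
      using y c powr_mono[of c 1 y] by (auto simp: M_def ge_one_powr_ge_zero)
    note fl = nat_floor_bounds[OF M(1)]
    have "\<bar>\<Sum>m=1..nat \<lfloor>M\<rfloor>. E (y / real m)\<bar> \<le> (\<Sum>m=1..nat \<lfloor>M\<rfloor>. C * (y powr (\<theta> + \<epsilon> / 2) * M powr (1 - \<theta>)) * (1 / real m))"
    proof (rule order_trans[OF sum_abs sum_mono])
      fix m assume m: "m \<in> {1..nat \<lfloor>M\<rfloor>}"
      have "real m \<le> real (nat \<lfloor>M\<rfloor>)" using m by simp
      also note fl(1)
      finally have mM: "real m \<le> M" .
      have m1: "1 \<le> real m" using m by simp
      have "\<bar>E (y / real m)\<bar> \<le> C * (y / real m) powr (\<theta> + \<epsilon> / 2)"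
        using mM m1 M by (intro C(2)) (simp add: le_divide_eq)
      also have "(y / real m) powr (\<theta> + \<epsilon> / 2) = y powr (\<theta> + \<epsilon> / 2) * (1 / real m powr (\<theta> + \<epsilon> / 2))"
        using y m1 by (simp add: powr_divide)
      also have "C * \<dots> \<le> C * (y powr (\<theta> + \<epsilon> / 2) * (M powr (1 - \<theta>) * (1 / real m)))"
      proof (intro mult_left_mono C(1))
        have "1 / real m powr (\<theta> + \<epsilon> / 2) \<le> 1 / real m powr \<theta>"
          using m1 e by (intro divide_left_mono powr_mono mult_pos_pos) auto
        also have "\<dots> = real m powr (1 - \<theta>) * (1 / real m)" using m1 by (simp add: powr_diff)
        also have "\<dots> \<le> M powr (1 - \<theta>) * (1 / real m)"
          using mM m1 \<theta> by (intro mult_right_mono powr_mono2) auto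
        finally show "1 / real m powr (\<theta> + \<epsilon> / 2) \<le> M powr (1 - \<theta>) * (1 / real m)" .
      qed auto
      finally show "\<bar>E (y / real m)\<bar> \<le> C * (y powr (\<theta> + \<epsilon> / 2) * M powr (1 - \<theta>)) * (1 / real m)"
        by (simp add: mult_ac)
    qed
    also have "\<dots> = C * (y powr (\<theta> + \<epsilon> / 2) * M powr (1 - \<theta>)) * (\<Sum>m=1..nat \<lfloor>M\<rfloor>. 1 / real m)"
      by (rule sum_distrib_left [symmetric])
    also have "\<dots> \<le> C * (y powr (\<theta> + \<epsilon> / 2) * M powr (1 - \<theta>)) * (C' * y powr (\<epsilon> / 2))"
    proof (intro mult_left_mono mult_nonneg_nonneg C(1))
      have "(\<Sum>m=1..nat \<lfloor>M\<rfloor>. 1 / real m) \<le> 1 + ln (real (nat \<lfloor>M\<rfloor>))" by (rule sum_inverse_le_ln[OF fl(3)])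
      also have "\<dots> \<le> 1 + ln y"
      proof -
        have "real (nat \<lfloor>M\<rfloor>) \<le> y" "0 < real (nat \<lfloor>M\<rfloor>)" using fl M(2) by linarith+
        then show ?thesis by (intro add_left_mono ln_mono) auto
      qed
      also have "\<dots> \<le> C' * y powr (\<epsilon> / 2)" using C'(2)[OF y] by simp
      finally show "(\<Sum>m=1..nat \<lfloor>M\<rfloor>. 1 / real m) \<le> C' * y powr (\<epsilon> / 2)" .
    qed auto
    also have "\<dots> = (C * C') * (y powr (\<theta> + \<epsilon> / 2) * y powr (c * (1 - \<theta>)) * y powr (\<epsilon> / 2))"
      by (simp add: M_def powr_powr mult_ac)
    also have "y powr (\<theta> + \<epsilon> / 2) * y powr (c * (1 - \<theta>)) * y powr (\<epsilon> / 2) = y powr (\<theta> + (1 - \<theta>) * c + \<epsilon>)"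
      unfolding powr_add[symmetric] by (rule arg_cong2[where f = "(powr)"]) (auto simp: mult.commute)
    finally show ?thesis by (simp add: M_def)
  qed
  then show "\<exists>C. \<forall>y\<ge>1. \<bar>\<Sum>m=1..nat \<lfloor>y powr c\<rfloor>. E (y / real m)\<bar> \<le> C * y powr (\<theta> + (1 - \<theta>) * c + \<epsilon>)" by blast
qed

text \<open>Induction on the number of factors by the hyperbola method with M = y^c and N = y^(1-c).
  The terms in M and N that do not depend on the induction error combine to y times a polynomial in
  log y, up to admissible errors.\<close>

theorem piltz_divisor_asymp:
  "\<exists>p. pb (1 - 1 / real (Suc k)) (\<lambda>y. T (Suc k) y - y * poly p (ln y))"
proof (induction k)
  case 0
  have "pb 0 (\<lambda>y. T (Suc 0) y - y * poly [:1:] (ln y))"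
  proof (rule pb_dominated[OF pb_const[of 1]])
    fix y :: real assume y: "y \<ge> 1"
    have "T (Suc 0) y = (\<Sum>n=1..nat \<lfloor>y\<rfloor>. 1)"
      unfolding T_def using dk_1 by (intro sum.cong refl) auto
    then have "T (Suc 0) y - y * poly [:1:] (ln y) = real (nat \<lfloor>y\<rfloor>) - y" by simp
    then show "\<bar>T (Suc 0) y - y * poly [:1:] (ln y)\<bar> \<le> \<bar>1\<bar>"
      using nat_floor_bounds(1,2)[OF y] by linarith
  qed
  then show ?case by (intro exI[of _ "[:1:]"]) simp
next
  case (Suc k')
  define k where "k = Suc k'"
  \<comment> \<open>This c balances everything: (1 - c) / k = c turns each of the three error
    exponents into 1 - c.\<close>
  define c where "c = 1 / real (Suc k)"
  define \<theta> where "\<theta> = 1 - 1 / real k"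
  have k: "k \<ge> 1" by (simp add: k_def)
  have c: "0 < c" "c \<le> 1" "c < 1" using k by (auto simp: c_def)
  have \<theta>: "0 \<le> \<theta>" "\<theta> < 1" using k by (auto simp: \<theta>_def)
  define i where "i = 1 / real k"
  have "1 - c = real k / real (Suc k)" by (simp add: c_def field_simps)
  then have key: "(1 - c) * i = c" using k by (simp add: i_def c_def)
  have \<theta>i: "\<theta> = 1 - i" by (simp add: \<theta>_def i_def)
  have ex1: "\<theta> + (1 - \<theta>) * c = 1 - c" using key unfolding \<theta>i by (simp add: algebra_simps)
  have ex2: "1 + (1 - c) * (\<theta> - 1) = 1 - c" using key unfolding \<theta>i by (simp add: algebra_simps)
  have ex3: "c + (1 - c) * \<theta> = 1 - c" using key unfolding \<theta>i by (simp add: algebra_simps)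
  obtain p where p: "pb \<theta> (\<lambda>y. T k y - y * poly p (ln y))"
    using Suc by (auto simp: k_def \<theta>_def)
  obtain P2 where P2: "pb (\<theta> - 1) (\<lambda>y. (\<Sum>n=1..nat \<lfloor>y\<rfloor>. dk k n / real n) - poly P2 (ln y))"
    using sum_over_n_asymp[of \<theta> "dk k" p] p \<theta> by (auto simp: T_def)
  obtain P1 where P1: "pb (-c) (\<lambda>y. (\<Sum>m=1..nat \<lfloor>y powr c\<rfloor>. poly p (ln y - ln (real m)) * poly [:1:] (ln (real m)) / real m) - poly P1 (ln y))"
    using sum_shifted_poly[OF c(1)] by blast
  define E where "E = (\<lambda>y. T k y - y * poly p (ln y))"
  define P where "P = P1 + pcompose (P2 - p) [:0, 1 - c:]"
  define S where "S = (\<lambda>y. \<Sum>n=1..nat \<lfloor>y powr (1 - c)\<rfloor>. dk k n / real n)"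
  define U where "U = (\<lambda>y. \<Sum>m=1..nat \<lfloor>y powr c\<rfloor>. poly p (ln y - ln (real m)) / real m)"
  \<comment> \<open>The effect of the floors in the second hyperbola sum. Each n contributes a
    difference of two fractional parts, of absolute value at most 1, so X is bounded by
    \<open>T k\<close> at y^(1-c).\<close>
  define X where "X = (\<lambda>y. (\<Sum>n=1..nat \<lfloor>y powr (1 - c)\<rfloor>. dk k n * (real (nat \<lfloor>y / real n\<rfloor>) - real (nat \<lfloor>y powr c\<rfloor>)))
     - (y * S y - y powr c * T k (y powr (1 - c))))"
  have t1: "pb (1 - c) (\<lambda>y. \<Sum>m=1..nat \<lfloor>y powr c\<rfloor>. E (y / real m))"
    using sum_error_bound[of \<theta> E c] p \<theta> c ex1 by (simp add: E_def)
  have t2: "pb (1 - c) (\<lambda>y. y * (U y - poly P1 (ln y)))"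
    using pb_mult[OF pb_ident P1] by (simp add: U_def)
  have "pb (1 + (1 - c) * (\<theta> - 1)) (\<lambda>y. y * (S y - poly P2 (ln (y powr (1 - c)))))"
    unfolding S_def using c by (intro pb_mult pb_ident pb_compose[OF P2]) auto
  then have t3: "pb (1 - c) (\<lambda>y. y * (S y - poly P2 (ln (y powr (1 - c)))))" by (simp only: ex2)
  have "pb (c + (1 - c) * \<theta>) (\<lambda>y. y powr c * E (y powr (1 - c)))"
    using c p by (intro pb_mult pb_powr pb_compose[of \<theta> E]) (auto simp: E_def)
  then have t4: "pb (1 - c) (\<lambda>y. y powr c * E (y powr (1 - c)))" by (simp only: ex3)
  have T1: "pb 1 (T k)"
  proof (rule pb_cong)
    show "pb 1 (\<lambda>y. E y + y * poly p (ln y))"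
      using pb_add[OF pb_mono[of \<theta> E 1] pb_mult[OF pb_ident pb_poly_ln[of p], simplified]] p \<theta> by (simp add: E_def)
  qed (simp add: E_def)
  have t5: "pb (1 - c) X"
  proof (rule pb_dominated)
    show "pb (1 - c) (\<lambda>y. T k (y powr (1 - c)))"
      using pb_compose[OF T1, of "1 - c"] c by simp
    fix y :: real assume y: "y \<ge> 1"
    define N where "N = nat \<lfloor>y powr (1 - c)\<rfloor>"
    have yc: "y powr c \<ge> 1" using y c by (intro ge_one_powr_ge_zero) auto
    have "X y = (\<Sum>n=1..N. dk k n * (real (nat \<lfloor>y / real n\<rfloor>) - real (nat \<lfloor>y powr c\<rfloor>))) - (\<Sum>n=1..N. dk k n * (y / real n - y powr c))"
      by (simp add: X_def S_def T_def N_def sum_distrib_left sum_subtractf right_diff_distrib mult_ac)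
    also have "\<dots> = (\<Sum>n=1..N. dk k n * ((real (nat \<lfloor>y / real n\<rfloor>) - y / real n) - (real (nat \<lfloor>y powr c\<rfloor>) - y powr c)))"
      unfolding sum_subtractf[symmetric] by (intro sum.cong refl) (simp add: algebra_simps)
    finally have "\<bar>X y\<bar> \<le> (\<Sum>n=1..N. \<bar>dk k n * ((real (nat \<lfloor>y / real n\<rfloor>) - y / real n) - (real (nat \<lfloor>y powr c\<rfloor>) - y powr c))\<bar>)"
      by simp
    also have "\<dots> \<le> (\<Sum>n=1..N. dk k n * 1)"
    proof (rule sum_mono)
      fix n
      have "y / real n \<ge> 0" using y by simp
      then have a: "real (nat \<lfloor>y / real n\<rfloor>) \<le> y / real n" "y / real n < real (nat \<lfloor>y / real n\<rfloor>) + 1" by linarith+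
      have "\<bar>(real (nat \<lfloor>y / real n\<rfloor>) - y / real n) - (real (nat \<lfloor>y powr c\<rfloor>) - y powr c)\<bar> \<le> 1"
        using a nat_floor_bounds(1,2)[OF yc] by linarith
      then show "\<bar>dk k n * ((real (nat \<lfloor>y / real n\<rfloor>) - y / real n) - (real (nat \<lfloor>y powr c\<rfloor>) - y powr c))\<bar> \<le> dk k n * 1"
        unfolding abs_mult by (intro mult_mono) auto
    qed
    also have "\<dots> = T k (y powr (1 - c))" by (simp add: T_def N_def)
    finally show "\<bar>X y\<bar> \<le> \<bar>T k (y powr (1 - c))\<bar>" using T_nonneg[of k] by simp
  qed
  have "pb (1 - c) (\<lambda>y. T (Suc k) y - y * poly P (ln y))"
  proof (rule pb_cong[OF pb_add[OF pb_add[OF t1 t2] pb_add[OF pb_diff[OF t3 t4] t5]]])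
    fix y :: real assume y: "y \<ge> 1"
    have MN: "1 \<le> y powr c" "1 \<le> y powr (1 - c)" "y powr c * y powr (1 - c) = y"
      using y c by (auto simp: ge_one_powr_ge_zero powr_add[symmetric])
    have TE: "T k (y powr (1 - c)) = E (y powr (1 - c)) + y powr (1 - c) * poly p (ln (y powr (1 - c)))"
      by (simp add: E_def)
    have "(\<Sum>m=1..nat \<lfloor>y powr c\<rfloor>. T k (y / real m)) = (\<Sum>m=1..nat \<lfloor>y powr c\<rfloor>. E (y / real m)) + y * U y"
      unfolding U_def sum_distrib_left sum.distrib[symmetric]
    proof (intro sum.cong refl)
      fix m assume "m \<in> {1..nat \<lfloor>y powr c\<rfloor>}"
      then have "ln (y / real m) = ln y - ln (real m)" using y by (simp add: ln_div)
      then show "T k (y / real m) = E (y / real m) + y * (poly p (ln y - ln (real m)) / real m)"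
        by (simp add: E_def)
    qed
    moreover have "(\<Sum>n=1..nat \<lfloor>y powr (1 - c)\<rfloor>. dk k n * (real (nat \<lfloor>y / real n\<rfloor>) - real (nat \<lfloor>y powr c\<rfloor>)))
        = X y + y * S y - (y powr c * E (y powr (1 - c)) + y * poly p (ln (y powr (1 - c))))"
      unfolding X_def TE using MN(3) by (simp add: distrib_left mult.assoc[symmetric])
    moreover have "ln (y powr (1 - c)) = (1 - c) * ln y" using y by (simp add: ln_powr)
    ultimately show "T (Suc k) y - y * poly P (ln y) =
      (\<Sum>m=1..nat \<lfloor>y powr c\<rfloor>. E (y / real m)) + y * (U y - poly P1 (ln y)) +
      (y * (S y - poly P2 (ln (y powr (1 - c)))) - y powr c * E (y powr (1 - c)) + X y)"
      unfolding T_hyperbola[OF MN] by (simp add: P_def poly_pcompose algebra_simps)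
  qed
  then show ?case by (auto simp: k_def c_def)
qed

section \<open>Divisor functions restricted by a gcd condition\<close>

lemma dconv_commute_fun: "dconv f g = dconv g f"
  by (rule ext) (rule dconv_commute)

lemma dconv_assoc_fun: "dconv (dconv f g) h = dconv f (dconv g h)"
  by (rule ext) (rule dconv_assoc)

lemma dconv_exchange: "dconv (dconv v u) (dconv w d) = dconv (dconv v w) (dconv u d)"
  by (metis dconv_assoc_fun dconv_commute_fun)

lemma dconv_point:
  assumes "M > 0" "m > 0"
  shows "dconv (\<lambda>N. if N = M then c else 0) f m = (if M dvd m then c * f (m div M) else 0)"
proof (cases "M dvd m")
  case True
  then obtain t where t: "m = M * t" by (elim dvdE)
  have "dconv (\<lambda>N. if N = M then c else 0) f m = (\<Sum>x\<in>divs m. if x = (M, t) then c * f t else 0)"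
    unfolding dconv_def using assms t by (intro sum.cong) (auto simp: divs_def split: if_splits)
  also have "\<dots> = c * f t" using assms t by (subst sum.delta[OF finite_divs]) (auto simp: divs_def)
  finally show ?thesis using True t assms by simp
next
  case False
  have "dconv (\<lambda>N. if N = M then c else 0) f m = 0"
    unfolding dconv_def using False by (intro sum.neutral) (auto simp: divs_def)
  then show ?thesis using False by simp
qed

lemma prod_primes_dvd_iff:
  assumes "finite A" "\<And>p. p \<in> A \<Longrightarrow> prime (p::nat)"
  shows "\<Prod>A dvd m \<longleftrightarrow> (\<forall>p\<in>A. p dvd m)"
  using assms
proof (induction A rule: finite_induct)
  case (insert p A)
  have cop: "coprime p (\<Prod>A)"
    using insert by (intro prod_coprime_right) (auto intro!: primes_coprime)
  have "p * \<Prod>A dvd m \<longleftrightarrow> p dvd m \<and> \<Prod>A dvd m"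
    using cop divides_mult[of p m "\<Prod>A"] by (auto intro: dvd_mult_left dvd_mult_right)
  then show ?case using insert by auto
qed simp

text \<open>gcd(m, q) = e means that e divides m and m / e is divisible by no prime of q / e.
  Inclusion-exclusion over the sets A of these primes gives conditions that e times the product of A
  divides m, and each of them is the convolution of a point mass with 1.\<close>

lemma gcd_indicator_expansion:
  assumes q: "q > 0" and e: "e dvd q" and m: "m > 0"
  shows "(if gcd m q = e then 1 else 0 :: real) =
    (\<Sum>A\<in>Pow (prime_factors (q div e)). dconv (\<lambda>N. if N = e * \<Prod>A then (-1) ^ card A else 0) (\<lambda>_. 1) m)"
proof -
  define q' where "q' = q div e"
  define P where "P = prime_factors q'"
  have eq: "q = e * q'" "e > 0" "q' > 0" using e q by (auto simp: q'_def intro!: Nat.gr0I)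
  have finP: "finite P" by (simp add: P_def)
  have primeP: "\<And>p. p \<in> P \<Longrightarrow> prime p" by (auto simp: P_def)
  have pos: "\<Prod>A > 0" if "A \<in> Pow P" for A
    using that primeP by (intro prod_pos) (auto simp: prime_gt_0_nat)
  have R: "(\<Sum>A\<in>Pow P. dconv (\<lambda>N. if N = e * \<Prod>A then (-1) ^ card A else 0) (\<lambda>_. 1) m)
      = (\<Sum>A\<in>Pow P. if e * \<Prod>A dvd m then (-1) ^ card A else 0)"
    using pos eq m by (intro sum.cong refl) (simp add: dconv_point)
  show ?thesis
  proof (cases "e dvd m")
    case False
    then have "\<not> e * x dvd m" for x by (meson dvd_mult_left)
    moreover have "gcd m q \<noteq> e" using False gcd_dvd1[of m q] by auto
    ultimately show ?thesis using R by (simp add: P_def q'_def)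
  next
    case True
    then obtain m' where m': "m = e * m'" by (elim dvdE)
    have "gcd m q = e \<longleftrightarrow> coprime m' q'"
    proof -
      have "gcd m q = e * gcd m' q'" by (simp add: m' eq(1) gcd_mult_distrib_nat)
      then show ?thesis using eq by (simp add: coprime_iff_gcd_eq_1)
    qed
    also have "\<dots> \<longleftrightarrow> (\<forall>p\<in>P. \<not> p dvd m')"
    proof
      assume cop: "coprime m' q'"
      show "\<forall>p\<in>P. \<not> p dvd m'"
      proof (intro ballI notI)
        fix p assume p: "p \<in> P" "p dvd m'"
        have "p dvd q'" using p(1) by (auto simp: P_def)
        then have "is_unit p" using coprime_common_divisor[OF cop p(2)] by blast
        then show False using primeP[OF p(1)] by auto
      qed
    next
      assume h: "\<forall>p\<in>P. \<not> p dvd m'"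
      show "coprime m' q'"
      proof (rule ccontr)
        assume "\<not> coprime m' q'"
        then have "gcd m' q' \<noteq> 1" by (simp add: coprime_iff_gcd_eq_1)
        then obtain p where "prime p" "p dvd gcd m' q'" using prime_factor_nat by blast
        then have "p dvd m'" "p \<in> P" using eq by (auto simp: P_def in_prime_factors_iff)
        then show False using h by blast
      qed
    qed
    finally have iff: "gcd m q = e \<longleftrightarrow> (\<forall>p\<in>P. \<not> p dvd m')" .
    have "(if gcd m q = e then 1 else 0 :: real) = (\<Prod>p\<in>P. 1 - (if p dvd m' then 1 else 0))"
    proof (cases "\<forall>p\<in>P. \<not> p dvd m'")
      case True
      then show ?thesis using iff by simp
    next
      case False
      then have "(\<Prod>p\<in>P. 1 - (if p dvd m' then 1 else 0 :: real)) = 0"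
        using finP by (intro prod_zero) auto
      then show ?thesis using iff False by simp
    qed
    also have "\<dots> = (\<Sum>A\<in>Pow P. (-1) ^ card A * (\<Prod>p\<in>A. if p dvd m' then 1 else 0) * (\<Prod>p\<in>P - A. 1))"
      by (rule prod_diff_conv_sum[OF finP])
    also have "\<dots> = (\<Sum>A\<in>Pow P. if e * \<Prod>A dvd m then (-1) ^ card A else 0)"
    proof (intro sum.cong refl)
      fix A assume A: "A \<in> Pow P"
      then have finA: "finite A" using finP finite_subset by auto
      have "e * \<Prod>A dvd m \<longleftrightarrow> (\<forall>p\<in>A. p dvd m')"
        using prod_primes_dvd_iff[OF finA, of m'] A primeP eq by (auto simp: m')
      moreover have "(\<Prod>p\<in>A. if p dvd m' then 1 else 0 :: real) = (if \<forall>p\<in>A. p dvd m' then 1 else 0)"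
        using finA by (auto intro!: prod_zero)
      ultimately show "(-1) ^ card A * (\<Prod>p\<in>A. if p dvd m' then 1 else 0) * (\<Prod>p\<in>P - A. 1) = (if e * \<Prod>A dvd m then (-1) ^ card A else (0::real))"
        by simp
    qed
    finally show ?thesis using R by (simp add: P_def q'_def)
  qed
qed

text \<open>Sets of prime factors correspond to squarefree divisors through their products.\<close>

lemma two_power_omega_le_tau:
  assumes "n > 0"
  shows "card (Pow (prime_factors n)) \<le> tau n"
proof -
  have "inj_on (\<lambda>A. \<Prod>A) (Pow (prime_factors n))"
  proof (rule inj_on_inverseI[where g = prime_factors])
    fix A assume A: "A \<in> Pow (prime_factors n)"
    then have fin: "finite A" by (meson PowD finite_set_mset finite_subset)
    have "prime p" if "p \<in> A" for p using A that by auto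
    moreover from this have "0 \<notin> A" using not_prime_0 by blast
    ultimately have "prime_factors (\<Prod>A) = (\<Union>p\<in>A. {p})"
      using fin by (subst prime_factors_prod) (auto simp: prime_prime_factors)
    then show "prime_factors (\<Prod>A) = A" by simp
  qed
  moreover have "(\<lambda>A. \<Prod>A) ` Pow (prime_factors n) \<subseteq> {d. d dvd n}"
  proof clarify
    fix A assume A: "A \<subseteq> prime_factors n"
    then have "finite A" by (meson finite_set_mset finite_subset)
    then show "\<Prod>A dvd n" using A by (subst prod_primes_dvd_iff) auto
  qed
  ultimately show ?thesis
    unfolding tau_def using assms by (intro card_inj_on_le[where f = "\<lambda>A. \<Prod>A"]) auto
qed

text \<open>A finite signed weight of total mass at most B on positive multiples of g. These two
  properties are what the error estimate uses: the sum of |w N| (x / N)^theta is then at most B (x /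
  g)^theta.\<close>

definition fin_weight :: "nat \<Rightarrow> real \<Rightarrow> (nat \<Rightarrow> real) \<Rightarrow> bool" where
  "fin_weight g B w \<longleftrightarrow> (\<exists>S. finite S \<and> (\<forall>N. N \<notin> S \<longrightarrow> w N = 0) \<and> (\<forall>N\<in>S. N > 0 \<and> g dvd N) \<and> (\<Sum>N\<in>S. \<bar>w N\<bar>) \<le> B)"

lemma fin_weight_mono: "fin_weight g B w \<Longrightarrow> B \<le> B' \<Longrightarrow> fin_weight g B' w"
  unfolding fin_weight_def by (meson order_trans)

lemma fin_weight_sum:
  assumes "finite I" "\<And>i. i \<in> I \<Longrightarrow> fin_weight g (B i) (w i)"
  shows "fin_weight g (\<Sum>i\<in>I. B i) (\<lambda>N. \<Sum>i\<in>I. w i N)"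
proof -
  have "\<forall>i\<in>I. \<exists>S. finite S \<and> (\<forall>N. N \<notin> S \<longrightarrow> w i N = 0) \<and> (\<forall>N\<in>S. N > 0 \<and> g dvd N) \<and> (\<Sum>N\<in>S. \<bar>w i N\<bar>) \<le> B i"
    using assms(2) by (auto simp: fin_weight_def)
  then obtain S where S: "\<And>i. i \<in> I \<Longrightarrow> finite (S i)" "\<And>i N. i \<in> I \<Longrightarrow> N \<notin> S i \<Longrightarrow> w i N = 0"
     "\<And>i N. i \<in> I \<Longrightarrow> N \<in> S i \<Longrightarrow> N > 0 \<and> g dvd N" "\<And>i. i \<in> I \<Longrightarrow> (\<Sum>N\<in>S i. \<bar>w i N\<bar>) \<le> B i"
    by metis
  define U where "U = (\<Union>i\<in>I. S i)"
  have finU: "finite U" using assms(1) S(1) by (simp add: U_def)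
  have "(\<Sum>N\<in>U. \<bar>\<Sum>i\<in>I. w i N\<bar>) \<le> (\<Sum>N\<in>U. \<Sum>i\<in>I. \<bar>w i N\<bar>)" by (intro sum_mono sum_abs)
  also have "\<dots> = (\<Sum>i\<in>I. \<Sum>N\<in>U. \<bar>w i N\<bar>)" by (rule sum.swap)
  also have "\<dots> = (\<Sum>i\<in>I. \<Sum>N\<in>S i. \<bar>w i N\<bar>)"
    using finU S(2) by (intro sum.cong refl sum.mono_neutral_right) (auto simp: U_def)
  also have "\<dots> \<le> (\<Sum>i\<in>I. B i)" by (intro sum_mono S(4))
  finally have mass: "(\<Sum>N\<in>U. \<bar>\<Sum>i\<in>I. w i N\<bar>) \<le> (\<Sum>i\<in>I. B i)" .
  have "(\<Sum>i\<in>I. w i N) = 0" if "N \<notin> U" for N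
    using that S(2) by (intro sum.neutral) (auto simp: U_def)
  then show ?thesis unfolding fin_weight_def using finU mass S(3) by (intro exI[of _ U]) (auto simp: U_def)
qed

lemma fin_weight_shift:
  assumes M: "M > 0" "e dvd M" and w: "fin_weight g B w" and c: "\<bar>c\<bar> \<le> 1"
  shows "fin_weight (e * g) B (dconv (\<lambda>N. if N = M then c else 0) w)"
proof -
  let ?v = "dconv (\<lambda>N. if N = M then c else 0) w"
  obtain S where S: "finite S" "\<And>N. N \<notin> S \<Longrightarrow> w N = 0" "\<And>N. N \<in> S \<Longrightarrow> N > 0 \<and> g dvd N" "(\<Sum>N\<in>S. \<bar>w N\<bar>) \<le> B"
    using w by (auto simp: fin_weight_def)
  have v: "?v (M * N) = c * w N" if "N \<in> S" for N using M S(3)[OF that] by (simp add: dconv_point)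
  have "(\<Sum>N\<in>(*) M ` S. \<bar>?v N\<bar>) = (\<Sum>N\<in>S. \<bar>?v (M * N)\<bar>)"
    using M by (subst sum.reindex) (auto simp: inj_on_def)
  also have "\<dots> = (\<Sum>N\<in>S. \<bar>c\<bar> * \<bar>w N\<bar>)" by (intro sum.cong refl) (simp add: v abs_mult)
  also have "\<dots> \<le> (\<Sum>N\<in>S. 1 * \<bar>w N\<bar>)" using c by (intro sum_mono mult_right_mono) auto
  also have "\<dots> \<le> B" using S(4) by simp
  finally have mass: "(\<Sum>N\<in>(*) M ` S. \<bar>?v N\<bar>) \<le> B" .
  have zero: "?v N = 0" if "N \<notin> (*) M ` S" for N
  proof (cases "N = 0")
    case False
    then have v: "?v N = (if M dvd N then c * w (N div M) else 0)" using M by (simp add: dconv_point)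
    have "w (N div M) = 0" if "M dvd N" using \<open>N \<notin> (*) M ` S\<close> that S(2) by (metis dvd_mult_div_cancel imageI)
    then show ?thesis using v by simp
  qed simp
  show ?thesis unfolding fin_weight_def
    using S(1) mass zero M S(3) by (intro exI[of _ "(*) M ` S"]) (auto intro: mult_dvd_mono)
qed

text \<open>Allows one factor to be stripped off: once gcd(a, q) = e is fixed, the condition on a b
  becomes one on b alone, with q / e in place of q.\<close>

lemma gcd_mult_split:
  assumes "q > (0::nat)"
  shows "gcd (a * b) q = gcd a q * gcd b (q div gcd a q)"
proof -
  define g where "g = gcd a q"
  have g: "g > 0" "g dvd a" "g dvd q" using assms by (auto simp: g_def)
  obtain a' q' where e: "a = g * a'" "q = g * q'" using g by (elim dvdE)
  have "coprime (a div g) (q div g)" unfolding g_def using assms by (intro div_gcd_coprime) auto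
  then have cop: "coprime a' q'" using e g by simp
  have "gcd (a * b) q = gcd (g * (a' * b)) (g * q')" by (simp add: e mult_ac)
  also have "\<dots> = g * gcd (a' * b) q'" by (rule gcd_mult_distrib_nat [symmetric])
  also have "gcd (a' * b) q' = gcd b q'" using cop by (simp add: gcd_mult_left_left_cancel coprime_commute)
  also have "q' = q div g" using e g by simp
  finally show ?thesis by (simp add: g_def)
qed

lemma cofactor:
  assumes "e dvd q" "q > (0::nat)"
  shows "q div e > 0" "q div e dvd q"
proof -
  obtain t where t: "q = e * t" using assms(1) by (elim dvdE)
  then have "q div e = t" using assms(2) by auto
  then show "q div e > 0" "q div e dvd q" using t assms(2) by auto
qed

text \<open>Induction on k for all q and g. If the first factor has gcd e with q, the others have
  gcd g / e with q / e. A step costs the choice of e, at most tau(q) ways, and the expansion of the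
  indicator into at most tau(q) point masses, hence two powers of tau(q) per factor. Point masses
  sit at multiples of e and the weights at multiples of g / e, so the convolution lives on multiples
  of g.\<close>

theorem gcd_restricted_dk:
  assumes "q > 0" "g dvd q"
  shows "\<exists>w. fin_weight g (real (tau q) ^ (2 * k)) w \<and> (\<forall>n>0. (if gcd n q = g then dk k n else 0) = dconv w (dk k) n)"
  using assms
proof (induction k arbitrary: q g)
  case 0
  define w where "w = (\<lambda>N. if g = 1 then dk 0 N else 0)"
  have "fin_weight g (real (tau q) ^ (2 * 0)) w"
    unfolding fin_weight_def by (rule exI[of _ "if g = 1 then {1} else {}"]) (auto simp: w_def dk_0)
  moreover have "(if gcd n q = g then dk 0 n else 0) = dconv w (dk 0) n" if "n > 0" for n
    unfolding dconv_delta using that by (simp add: w_def dk_0)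
  ultimately show ?case by blast
next
  case (Suc k)
  have q: "q > 0" and gq: "g dvd q" by fact+
  have gp: "g > 0" using q gq by (auto intro!: Nat.gr0I)
  have ex: "\<exists>w. fin_weight (g div e) (real (tau q) ^ (2 * k)) w \<and>
      (\<forall>n>0. (if gcd n (q div e) = g div e then dk k n else 0) = dconv w (dk k) n)" if e: "e dvd g" for e
  proof -
    have qe: "q div e > 0" "g div e dvd q div e" "q div e dvd q"
      using e gq cofactor[OF dvd_trans[OF e gq] q] by (auto simp: div_dvd_div intro: dvd_trans)
    obtain w where w: "fin_weight (g div e) (real (tau (q div e)) ^ (2 * k)) w"
      "\<forall>n>0. (if gcd n (q div e) = g div e then dk k n else 0) = dconv w (dk k) n"
      using Suc.IH[OF qe(1,2)] by blast
    have "real (tau (q div e)) ^ (2 * k) \<le> real (tau q) ^ (2 * k)"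
      using tau_mono[OF qe(3) q] by (intro power_mono) auto
    with w show ?thesis by (meson fin_weight_mono)
  qed
  then obtain W where W: "\<And>e. e dvd g \<Longrightarrow> fin_weight (g div e) (real (tau q) ^ (2 * k)) (W e)"
    "\<And>e n. e dvd g \<Longrightarrow> n > 0 \<Longrightarrow> (if gcd n (q div e) = g div e then dk k n else 0) = dconv (W e) (dk k) n"
    by metis
  define V where "V = (\<lambda>(e::nat) A N. if N = e * \<Prod>A then (-1) ^ card A else 0 :: real)"
  define w where "w = (\<lambda>N. \<Sum>e | e dvd g. \<Sum>A\<in>Pow (prime_factors (q div e)). dconv (V e A) (W e) N)"
  have fin: "finite {e. e dvd g}" using gp by simp
  have fw1: "fin_weight g (real (tau q) ^ (2 * k)) (dconv (V e A) (W e))"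
    if e: "e dvd g" and A: "A \<in> Pow (prime_factors (q div e))" for e A
  proof -
    have "a > 0" if "a \<in> A" for a
      using A that by (intro prime_gt_0_nat) (auto dest: in_prime_factors_imp_prime)
    then have "\<Prod>A > 0" by (intro prod_pos)
    then have "fin_weight (e * (g div e)) (real (tau q) ^ (2 * k)) (dconv (V e A) (W e))"
      unfolding V_def using e gp by (intro fin_weight_shift W(1)) (auto intro!: Nat.gr0I simp: power_abs)
    then show ?thesis using e by simp
  qed
  have "fin_weight g (\<Sum>e | e dvd g. \<Sum>A\<in>Pow (prime_factors (q div e)). real (tau q) ^ (2 * k)) w"
    unfolding w_def by (intro fin_weight_sum fin fw1) auto
  moreover have "(\<Sum>e | e dvd g. \<Sum>A\<in>Pow (prime_factors (q div e)). real (tau q) ^ (2 * k)) \<le> real (tau q) ^ (2 * Suc k)"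
  proof -
    have "(\<Sum>e | e dvd g. \<Sum>A\<in>Pow (prime_factors (q div e)). real (tau q) ^ (2 * k)) \<le> (\<Sum>e | e dvd g. real (tau q) * real (tau q) ^ (2 * k))"
    proof (rule sum_mono)
      fix e assume "e \<in> {e. e dvd g}"
      then have "q div e dvd q" "q div e > 0" using cofactor[of e q] gq q by (auto intro: dvd_trans)
      then have "card (Pow (prime_factors (q div e))) \<le> tau q"
        using two_power_omega_le_tau[of "q div e"] tau_mono[of "q div e" q] q by linarith
      then have "real (card (Pow (prime_factors (q div e)))) * real (tau q) ^ (2 * k) \<le> real (tau q) * real (tau q) ^ (2 * k)"
        by (intro mult_right_mono) auto
      then show "(\<Sum>A\<in>Pow (prime_factors (q div e)). real (tau q) ^ (2 * k)) \<le> real (tau q) * real (tau q) ^ (2 * k)"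
        by (simp only: sum_constant)
    qed
    also have "\<dots> = real (tau g) * (real (tau q) * real (tau q) ^ (2 * k))" by (simp add: tau_def)
    also have "\<dots> \<le> real (tau q) * (real (tau q) * real (tau q) ^ (2 * k))"
      using tau_mono[OF gq q] by (intro mult_right_mono) auto
    also have "\<dots> = real (tau q) ^ (2 * Suc k)" by simp
    finally show ?thesis .
  qed
  ultimately have fw: "fin_weight g (real (tau q) ^ (2 * Suc k)) w" by (rule fin_weight_mono)
  have "(if gcd n q = g then dk (Suc k) n else 0) = dconv w (dk (Suc k)) n" if n: "n > 0" for n
  proof -
    have "(if gcd n q = g then dk (Suc k) n else 0) = (\<Sum>(a, b)\<in>divs n. if gcd (a * b) q = g then dk k b else 0)"
      unfolding dk_Suc dconv_def by (auto simp: divs_def intro!: sum.cong sum.neutral)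
    also have "\<dots> = (\<Sum>(a, b)\<in>divs n. \<Sum>e | e dvd g. (if gcd a q = e then 1 else 0) * (if gcd b (q div e) = g div e then dk k b else 0))"
    proof (intro sum.cong refl, clarify)
      fix a b
      define e0 where "e0 = gcd a q"
      have e0: "e0 > 0" using q by (simp add: e0_def)
      have "(\<Sum>e | e dvd g. (if e0 = e then 1 else 0) * (if gcd b (q div e) = g div e then dk k b else 0))
         = (\<Sum>e | e dvd g. if e = e0 then (if gcd b (q div e0) = g div e0 then dk k b else 0) else 0)"
        by (intro sum.cong) auto
      also have "\<dots> = (if e0 dvd g then (if gcd b (q div e0) = g div e0 then dk k b else 0) else 0)"
        using fin by (subst sum.delta) auto
      also have "\<dots> = (if e0 * gcd b (q div e0) = g then dk k b else 0)"
      proof -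
        have "e0 * t = g \<longleftrightarrow> e0 dvd g \<and> t = g div e0" for t using e0 by auto
        then show ?thesis by simp
      qed
      also have "e0 * gcd b (q div e0) = gcd (a * b) q" unfolding e0_def by (rule gcd_mult_split[OF q, symmetric])
      finally show "(if gcd (a * b) q = g then dk k b else 0) = (\<Sum>e | e dvd g. (if gcd a q = e then 1 else 0) * (if gcd b (q div e) = g div e then dk k b else 0))"
        by (simp add: e0_def)
    qed
    also have "\<dots> = (\<Sum>e | e dvd g. dconv (\<lambda>a. if gcd a q = e then 1 else 0) (\<lambda>b. if gcd b (q div e) = g div e then dk k b else 0) n)"
      unfolding dconv_def case_prod_unfold by (rule sum.swap)
    also have "\<dots> = (\<Sum>e | e dvd g. dconv (\<lambda>a. \<Sum>A\<in>Pow (prime_factors (q div e)). dconv (V e A) (\<lambda>_. 1) a) (dconv (W e) (dk k)) n)"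
    proof (intro sum.cong refl dconv_cong)
      fix e a :: nat assume "e \<in> {e. e dvd g}" "a > 0"
      then show "(if gcd a q = e then 1 else 0) = (\<Sum>A\<in>Pow (prime_factors (q div e)). dconv (V e A) (\<lambda>_. 1) a)"
        unfolding V_def using gq by (intro gcd_indicator_expansion q) (auto intro: dvd_trans)
    qed (use W(2) in auto)
    \<comment> \<open>The exchange collects the weights on one side and joins the 1 left by the
      indicator with \<open>dk k\<close> to form \<open>dk (Suc k)\<close>.\<close>
    also have "\<dots> = (\<Sum>e | e dvd g. \<Sum>A\<in>Pow (prime_factors (q div e)). dconv (dconv (V e A) (W e)) (dconv (\<lambda>_. 1) (dk k)) n)"
      by (simp only: dconv_sum_left dconv_exchange)
    also have "\<dots> = dconv w (dconv (\<lambda>_. 1) (dk k)) n"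
      unfolding w_def by (simp only: dconv_sum_left)
    also have "\<dots> = dconv w (dk (Suc k)) n"
      by (intro dconv_cong) (auto simp: dk_Suc)
    finally show ?thesis .
  qed
  with fw show ?case by blast
qed

section \<open>The zeta function and Dirichlet series of divisor functions\<close>

text \<open>With m = n + 1 this is (s - 1) times the difference between m^(-s) and the integral of
  u^(-s) over [m, m + 1]. Clearing the factor s - 1 leaves no division, so s = 1 is not
  exceptional.\<close>

definition zterm :: "nat \<Rightarrow> complex \<Rightarrow> complex" where
  "zterm n s = (s - 1) * of_nat (Suc n) powr (-s) + of_nat (Suc (Suc n)) powr (1 - s) - of_nat (Suc n) powr (1 - s)"

text \<open>The function \<open>(s - 1) \<zeta>(s)\<close>, continued to \<open>Re s > 0\<close>.\<close>

definition zF :: "complex \<Rightarrow> complex" where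
  "zF s = 1 + (\<Sum>n. zterm n s)"

lemma norm_of_real_powr: "u > 0 \<Longrightarrow> norm (complex_of_real u powr w) = u powr Re w"
  by (simp add: norm_powr_real_powr)

lemma powr_diff_bound:
  assumes s: "Re s > 0" and u: "0 < m" "m \<le> u"
  shows "norm (complex_of_real u powr (-s) - complex_of_real m powr (-s)) \<le> norm s * m powr (-1 - Re s) * (u - m)"
proof -
  let ?S = "closed_segment (complex_of_real m) (complex_of_real u)"
  have S: "\<exists>v. z = complex_of_real v \<and> m \<le> v \<and> v \<le> u" if "z \<in> ?S" for z
    using that u by (auto simp: closed_segment_of_real closed_segment_eq_real_ivl)
  have "norm (complex_of_real u powr (-s) - complex_of_real m powr (-s)) \<le> (norm s * m powr (-1 - Re s)) * norm (complex_of_real u - complex_of_real m)"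
  proof (rule field_differentiable_bound[where S = ?S and f' = "\<lambda>z. (-s) * z powr (-s - 1)"])
    fix z assume "z \<in> ?S"
    then obtain v where v: "z = complex_of_real v" "m \<le> v" "v \<le> u" using S by blast
    have "z \<notin> \<real>\<^sub>\<le>\<^sub>0" using v u by (auto simp: complex_nonpos_Reals_iff)
    then show "((\<lambda>z. z powr (-s)) has_field_derivative (-s) * z powr (-s - 1)) (at z within ?S)"
      by (rule has_field_derivative_at_within[OF has_field_derivative_powr])
    have e: "-1 - Re s = - Re s - 1" by simp
    have "norm ((-s) * z powr (-s - 1)) = norm s * v powr (-1 - Re s)"
      unfolding e using v u by (simp add: norm_mult norm_of_real_powr)
    also have "\<dots> \<le> norm s * m powr (-1 - Re s)"
      using v u s by (intro mult_left_mono powr_mono2') auto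
    finally show "norm ((-s) * z powr (-s - 1)) \<le> norm s * m powr (-1 - Re s)" .
  qed auto
  also have "norm (complex_of_real u - complex_of_real m) = u - m"
    using u by (simp flip: of_real_diff)
  finally show ?thesis .
qed

text \<open>The term is the increment over [m, m + 1] of a function whose derivative is (1 - s)
  (u^(-s) - m^(-s)). A second use of the mean value inequality makes this small, which yields
  convergence for Re s > 0.\<close>

lemma zterm_bound:
  assumes s: "Re s > 0"
  shows "norm (zterm n s) \<le> norm s * norm (s - 1) * real (Suc n) powr (-1 - Re s)"
proof -
  define m where "m = real (Suc n)"
  have m: "m > 0" by (simp add: m_def)
  let ?S = "closed_segment (complex_of_real m) (complex_of_real (m + 1))"
  let ?f = "\<lambda>z. (s - 1) * complex_of_real m powr (-s) * z + z powr (1 - s)"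
  have S: "\<exists>v. z = complex_of_real v \<and> m \<le> v \<and> v \<le> m + 1" if "z \<in> ?S" for z
    using that by (auto simp: closed_segment_of_real closed_segment_eq_real_ivl simp del: of_real_add)
  have "norm (?f (complex_of_real (m + 1)) - ?f (complex_of_real m)) \<le> (norm s * norm (s - 1) * m powr (-1 - Re s)) * norm (complex_of_real (m + 1) - complex_of_real m)"
  proof (rule field_differentiable_bound[where S = ?S and f' = "\<lambda>z. (s - 1) * complex_of_real m powr (-s) + (1 - s) * z powr (1 - s - 1)"])
    fix z assume "z \<in> ?S"
    then obtain v where v: "z = complex_of_real v" "m \<le> v" "v \<le> m + 1" using S by blast
    have "z \<notin> \<real>\<^sub>\<le>\<^sub>0" using v m by (auto simp: complex_nonpos_Reals_iff)
    then show "(?f has_field_derivative (s - 1) * complex_of_real m powr (-s) + (1 - s) * z powr (1 - s - 1)) (at z within ?S)"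
      by (intro has_field_derivative_at_within[OF DERIV_add] has_field_derivative_powr) (auto intro!: derivative_eq_intros)
    have "(s - 1) * complex_of_real m powr (-s) + (1 - s) * z powr (1 - s - 1) = (1 - s) * (complex_of_real v powr (-s) - complex_of_real m powr (-s))"
      by (simp add: v algebra_simps)
    then have "norm ((s - 1) * complex_of_real m powr (-s) + (1 - s) * z powr (1 - s - 1)) = norm (s - 1) * norm (complex_of_real v powr (-s) - complex_of_real m powr (-s))"
      by (simp add: norm_mult norm_minus_commute)
    also have "\<dots> \<le> norm (s - 1) * (norm s * m powr (-1 - Re s) * (v - m))"
      using v m s by (intro mult_left_mono powr_diff_bound) auto
    also have "\<dots> \<le> norm (s - 1) * (norm s * m powr (-1 - Re s) * 1)"
      using v by (intro mult_left_mono) auto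
    finally show "norm ((s - 1) * complex_of_real m powr (-s) + (1 - s) * z powr (1 - s - 1)) \<le> norm s * norm (s - 1) * m powr (-1 - Re s)"
      by (simp add: mult_ac)
  qed auto
  moreover have "?f (complex_of_real (m + 1)) - ?f (complex_of_real m) = zterm n s"
    by (simp add: zterm_def m_def algebra_simps)
  moreover have "norm (complex_of_real (m + 1) - complex_of_real m) = 1" by simp
  ultimately show ?thesis by (simp add: m_def)
qed

lemma summable_Suc_powr: "h > 0 \<Longrightarrow> summable (\<lambda>n. real (Suc n) powr (-1 - h))"
  by (subst summable_Suc_iff) (simp add: summable_real_powr_iff)

lemma zF_holomorphic: "zF holomorphic_on {s. Re s > 0}"
proof (rule holomorphic_uniform_sequence)
  show op: "open {s. Re s > 0}" by (rule open_halfspace_Re_gt)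
  show "(\<lambda>s. 1 + (\<Sum>n<N. zterm n s)) holomorphic_on {s. Re s > 0}" for N
    unfolding zterm_def by (intro holomorphic_intros)
  fix z assume z: "z \<in> {s. Re s > 0}"
  define d where "d = Re z / 2"
  have d: "d > 0" using z by (simp add: d_def)
  define K where "K = norm z + d"
  have in_ball: "Re s \<ge> d \<and> norm s \<le> K" if "s \<in> cball z d" for s
  proof -
    have "\<bar>Re (z - s)\<bar> \<le> norm (z - s)" by (rule abs_Re_le_cmod)
    then have "\<bar>Re z - Re s\<bar> \<le> d" using that by (simp add: dist_norm)
    then have 1: "Re s \<ge> d" unfolding d_def by linarith
    have "norm s \<le> norm z + norm (z - s)" by (metis norm_minus_commute norm_triangle_sub)
    also have "norm (z - s) \<le> d" using that by (simp add: dist_norm)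
    finally show ?thesis using 1 by (simp add: K_def)
  qed
  have "uniform_limit (cball z d) (\<lambda>N s. \<Sum>n<N. zterm n s) (\<lambda>s. \<Sum>n. zterm n s) sequentially"
  proof (rule Weierstrass_m_test)
    show "summable (\<lambda>n. (K * (K + 1)) * real (Suc n) powr (-1 - d))"
      by (intro summable_mult summable_Suc_powr d)
    fix n s assume "s \<in> cball z d"
    then have s: "Re s \<ge> d" "norm s \<le> K" using in_ball by auto
    have "norm (s - 1) \<le> K + 1" using norm_triangle_ineq4[of s 1] s by simp
    have "norm (zterm n s) \<le> norm s * norm (s - 1) * real (Suc n) powr (-1 - Re s)"
      using s d by (intro zterm_bound) auto
    also have "\<dots> \<le> (K * (K + 1)) * real (Suc n) powr (-1 - d)"
      using s \<open>norm (s - 1) \<le> K + 1\<close> d norm_ge_zero[of s] by (intro mult_mono powr_mono) (auto intro!: mult_nonneg_nonneg simp: K_def)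
    finally show "norm (zterm n s) \<le> (K * (K + 1)) * real (Suc n) powr (-1 - d)" .
  qed
  then have "uniform_limit (cball z d) (\<lambda>N s. 1 + (\<Sum>n<N. zterm n s)) zF sequentially"
    unfolding zF_def[abs_def] by (intro uniform_limit_add uniform_limit_const)
  moreover have "cball z d \<subseteq> {s. Re s > 0}" using in_ball d by force
  ultimately show "\<exists>d>0. cball z d \<subseteq> {s. Re s > 0} \<and> uniform_limit (cball z d) (\<lambda>N s. 1 + (\<Sum>n<N. zterm n s)) zF sequentially"
    using d by blast
qed

lemma norm_Suc_powr: "norm (complex_of_nat (Suc n) powr w) = real (Suc n) powr Re w"
proof -
  have "complex_of_nat (Suc n) = complex_of_real (real (Suc n))" by simp
  then show ?thesis by (simp only: norm_of_real_powr of_nat_0_less_iff zero_less_Suc)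
qed

text \<open>For Re s > 1 the differences in \<open>zterm\<close> telescope to -1 and cancel the
  leading 1 of \<open>zF\<close>.\<close>

lemma zeta_sums:
  assumes s: "Re s > 1"
  shows "summable (\<lambda>n. norm (complex_of_nat (Suc n) powr (-s)))"
    and "(\<lambda>n. complex_of_nat (Suc n) powr (-s)) sums (zF s / (s - 1))"
proof -
  have "summable (\<lambda>n. real (Suc n) powr (-1 - (Re s - 1)))"
    using s by (intro summable_Suc_powr) auto
  then show sn: "summable (\<lambda>n. norm (complex_of_nat (Suc n) powr (-s)))"
    unfolding norm_Suc_powr by simp
  define Z where "Z = (\<Sum>n. complex_of_nat (Suc n) powr (-s))"
  have Z: "(\<lambda>n. complex_of_nat (Suc n) powr (-s)) sums Z"
    unfolding Z_def using summable_norm_cancel[OF sn] by (rule summable_sums)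
  have "(\<lambda>n. complex_of_nat (Suc n) powr (1 - s)) \<longlonglongrightarrow> 0"
  proof (rule tendsto_norm_zero_cancel)
    have "(\<lambda>n. real n powr (1 - Re s)) \<longlonglongrightarrow> 0"
      using s by (intro tendsto_neg_powr filterlim_real_sequentially) auto
    then have "(\<lambda>n. real (Suc n) powr (1 - Re s)) \<longlonglongrightarrow> 0" by (rule LIMSEQ_Suc)
    then show "(\<lambda>n. norm (complex_of_nat (Suc n) powr (1 - s))) \<longlonglongrightarrow> 0"
      unfolding norm_Suc_powr by simp
  qed
  from telescope_sums[OF this]
  have "(\<lambda>n. complex_of_nat (Suc (Suc n)) powr (1 - s) - complex_of_nat (Suc n) powr (1 - s)) sums (0 - 1)" by simp
  from sums_add[OF sums_mult[OF Z, of "s - 1"] this]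
  have "(\<lambda>n. zterm n s) sums ((s - 1) * Z - 1)" by (simp add: zterm_def algebra_simps)
  then have "zF s = (s - 1) * Z" by (simp add: zF_def sums_iff)
  moreover have "s \<noteq> 1" using s by auto
  ultimately have "Z = zF s / (s - 1)" by simp
  with Z show "(\<lambda>n. complex_of_nat (Suc n) powr (-s)) sums (zF s / (s - 1))" by simp
qed

section \<open>Dirichlet series of convolutions\<close>

definition dterm :: "(nat \<Rightarrow> real) \<Rightarrow> complex \<Rightarrow> nat \<Rightarrow> complex" where
  "dterm f s n = of_real (f n) / of_nat n powr s"

lemma atLeast_1_nat: "{1::nat..} = Suc ` UNIV"
  by (auto simp: image_iff Suc_le_eq gr0_conv_Suc)

lemma has_sum_from_1:
  fixes f :: "nat \<Rightarrow> 'a :: real_normed_vector"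
  shows "(f has_sum a) {1..} \<longleftrightarrow> ((\<lambda>n. f (Suc n)) has_sum a) UNIV"
  unfolding atLeast_1_nat by (subst has_sum_reindex) (auto simp: o_def)

lemma dterm_one_has_sum:
  assumes s: "Re s > 1"
  shows "(dterm (\<lambda>_. 1) s has_sum (zF s / (s - 1))) {1..}"
  unfolding has_sum_from_1 dterm_def
  using norm_summable_imp_has_sum[OF zeta_sums[OF s]] by (simp add: powr_minus divide_inverse)

text \<open>Unconditional summability of complex terms is absolute, so the double series of products
  is summable and may be regrouped according to n = x y.\<close>

lemma dterm_dconv_has_sum:
  assumes f: "(dterm f s has_sum a) {1..}" and g: "(dterm g s has_sum b) {1..}"
  shows "(dterm (dconv f g) s has_sum (a * b)) {1..}"
proof -
  let ?h = "\<lambda>(x, y). dterm f s x * dterm g s y"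
  have nf: "(\<lambda>x. norm (dterm f s x)) summable_on {1..}" and ng: "(\<lambda>x. norm (dterm g s x)) summable_on {1..}"
    using f g has_sum_imp_summable summable_on_iff_abs_summable_on_complex by blast+
  have "(\<lambda>x. norm (?h x)) summable_on {1..} \<times> {1..}"
  proof (subst Infinite_Sum.abs_summable_on_Sigma_iff, intro conjI ballI)
    show "(\<lambda>y. norm (case (x, y) of (x, y) \<Rightarrow> dterm f s x * dterm g s y)) summable_on {1..}" for x
      using summable_on_cmult_right[OF ng, of "norm (dterm f s x)"] by (simp add: norm_mult)
    have "(\<lambda>x. norm (dterm f s x) * (\<Sum>\<^sub>\<infinity>y\<in>{1..}. norm (dterm g s y))) summable_on {1..}"
      by (rule summable_on_cmult_left[OF nf])
    then show "(\<lambda>x. norm (\<Sum>\<^sub>\<infinity>y\<in>{1..}. norm (case (x, y) of (x, y) \<Rightarrow> dterm f s x * dterm g s y))) summable_on {1..}"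
      by (simp add: norm_mult infsum_cmult_right' abs_mult infsum_nonneg)
  qed
  then have "?h summable_on {1..} \<times> {1..}" using summable_on_iff_abs_summable_on_complex by blast
  then have "(?h has_sum (a * b)) ({1..} \<times> {1..})"
    using has_sum_cmult_right[OF g] has_sum_cmult_left[OF f] by (intro has_sum_SigmaI[where g = "\<lambda>x. dterm f s x * b"]) auto
  also have "?this \<longleftrightarrow> ((\<lambda>(n, (x, y)). dterm f s x * dterm g s y) has_sum (a * b)) (Sigma {1..} divs)"
    by (rule has_sum_reindex_bij_witness[where i = "\<lambda>(n, (x, y)). (x, y)" and j = "\<lambda>(x, y). (x * y, (x, y))"])
       (auto simp: divs_def Suc_le_eq intro!: Nat.gr0I)
  finally have "((\<lambda>(n, (x, y)). dterm f s x * dterm g s y) has_sum (a * b)) (Sigma {1..} divs)" .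
  then show ?thesis
  proof (rule has_sum_SigmaD)
    fix n :: nat assume n: "n \<in> {1..}"
    have "(\<Sum>p\<in>divs n. case p of (x, y) \<Rightarrow> dterm f s x * dterm g s y) = dterm (dconv f g) s n"
      unfolding dterm_def dconv_def of_real_sum sum_divide_distrib
    proof (intro sum.cong refl, clarify)
      fix x y assume xy: "(x, y) \<in> divs n"
      then have "n = x * y" "x > 0" "y > 0" by (auto simp: divs_def intro!: Nat.gr0I)
      then have "complex_of_nat n powr s = complex_of_nat x powr s * complex_of_nat y powr s"
        using powr_times_real[of "complex_of_nat x" "complex_of_nat y" s] by simp
      then show "complex_of_real (f x) / of_nat x powr s * (complex_of_real (g y) / of_nat y powr s) = complex_of_real (f x * g y) / of_nat n powr s"
        by simp
    qed
    then show "((\<lambda>y. case (n, y) of (n, x, y) \<Rightarrow> dterm f s x * dterm g s y) has_sum dterm (dconv f g) s n) (divs n)"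
      using has_sum_finite[OF finite_divs, of "\<lambda>p. case p of (x, y) \<Rightarrow> dterm f s x * dterm g s y" n] by simp
  qed
qed

lemma dterm_dk_has_sum:
  assumes s: "Re s > 1"
  shows "(dterm (dk k) s has_sum (zF s / (s - 1)) ^ k) {1..}"
proof (induction k)
  case 0
  have "(dterm (dk 0) s has_sum (\<Sum>n\<in>{1}. dterm (dk 0) s n)) {1}" by (rule has_sum_finite) simp
  also have "?this \<longleftrightarrow> (dterm (dk 0) s has_sum (\<Sum>n\<in>{1}. dterm (dk 0) s n)) {1..}"
    by (rule has_sum_cong_neutral) (auto simp: dterm_def dk_0)
  finally have "(dterm (dk 0) s has_sum (\<Sum>n\<in>{1}. dterm (dk 0) s n)) {1..}" .
  moreover have "(\<Sum>n\<in>{1}. dterm (dk 0) s n) = 1" by (simp add: dterm_def dk_0)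
  ultimately show ?case by (simp only: power_0)
next
  case (Suc k)
  have "dterm (dk (Suc k)) s = dterm (dconv (\<lambda>_. 1) (dk k)) s" by (rule ext) (simp add: dterm_def dk_Suc)
  then show ?case using dterm_dconv_has_sum[OF dterm_one_has_sum[OF s] Suc] by simp
qed

section \<open>The residue at 1\<close>

lemma T_abel:
  "(\<Sum>n<N. dk k (Suc n) * real (Suc n) powr (-s)) =
   (\<Sum>n<N. T k (real (Suc n)) * (real (Suc n) powr (-s) - real (Suc (Suc n)) powr (-s))) + T k (real N) * real (Suc N) powr (-s)"
proof (induction N)
  case 0
  show ?case by (simp add: T_def)
next
  case (Suc N)
  have "T k (real (Suc N)) = T k (real N) + dk k (Suc N)"
    unfolding T_def floor_of_nat nat_int by simp
  then have d: "dk k (Suc N) = T k (real (Suc N)) - T k (real N)" by simp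
  show ?case unfolding sum.lessThan_Suc Suc d by (simp add: algebra_simps del: of_nat_Suc)
qed

text \<open>Q is built so that -u^(1-s) Q(log u) is an antiderivative of p(log u) u^(-s). Its value
  Q(0) is the integral of that function over [1, infinity), the Laplace transform of p at s -
  1.\<close>

lemma laplace_poly:
  fixes p :: "real poly"
  assumes "s > 1"
  defines "Q \<equiv> \<Sum>i\<le>degree p. smult (1 / (s - 1) ^ Suc i) ((pderiv ^^ i) p)"
  shows "smult (s - 1) Q - pderiv Q = p"
    and "poly Q 0 = (\<Sum>i\<le>degree p. fact i * coeff p i / (s - 1) ^ Suc i)"
proof -
  define t where "t = s - 1"
  have t: "t > 0" using assms by (simp add: t_def)
  define g where "g = (\<lambda>i. smult (1 / t ^ i) ((pderiv ^^ i) p))"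
  have ss: "smult t (sum f A) = (\<Sum>i\<in>A. smult t (f i))" for f :: "nat \<Rightarrow> real poly" and A
    by (induction A rule: infinite_finite_induct) (auto simp: smult_add_right)
  have "smult t Q = (\<Sum>i\<le>degree p. g i)"
    unfolding Q_def t_def[symmetric] g_def ss using t by simp
  moreover have "pderiv Q = (\<Sum>i\<le>degree p. g (Suc i))"
    unfolding Q_def t_def[symmetric] g_def
    using higher_pderiv_sum[of 1 "\<lambda>i. smult (1 / t ^ Suc i) ((pderiv ^^ i) p)" "{..degree p}"]
    by (simp add: pderiv_smult)
  ultimately have "smult t Q - pderiv Q = (\<Sum>i\<le>degree p. g i - g (Suc i))" by (simp add: sum_subtractf)
  also have "\<dots> = g 0 - g (Suc (degree p))" by (rule sum_telescope)
  also have "g (Suc (degree p)) = 0"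
  proof -
    have "pderiv ((pderiv ^^ degree p) p) = 0"
      by (simp add: pderiv_eq_0_iff degree_higher_pderiv)
    then show ?thesis by (simp add: g_def)
  qed
  also have "g 0 - 0 = p" by (simp add: g_def)
  finally show "smult (s - 1) Q - pderiv Q = p" by (simp add: t_def)
  have "poly ((pderiv ^^ i) p) 0 = fact i * coeff p i" for i
    using coeff_higher_pderiv[of i p 0] by (simp add: poly_0_coeff_0 pochhammer_fact)
  then show "poly Q 0 = (\<Sum>i\<le>degree p. fact i * coeff p i / (s - 1) ^ Suc i)"
    by (simp add: Q_def poly_sum)
qed

lemma powr_poly_ln_tendsto_0:
  fixes Q :: "real poly"
  assumes "h > 0"
  shows "(\<lambda>n. real (Suc n) powr (-h) * poly Q (ln (real (Suc n)))) \<longlonglongrightarrow> 0"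
proof -
  obtain C where C: "C \<ge> 0" "\<And>u. u \<ge> 1 \<Longrightarrow> \<bar>poly Q (ln u)\<bar> \<le> C * u powr (0 + h / 2)"
    using pbE[OF pb_poly_ln[of Q], of "h / 2"] assms by auto
  have "(\<lambda>n. C * real n powr (-(h / 2))) \<longlonglongrightarrow> C * 0"
    using assms by (intro tendsto_mult tendsto_const tendsto_neg_powr filterlim_real_sequentially) auto
  then have lim: "(\<lambda>n. C * real (Suc n) powr (-(h / 2))) \<longlonglongrightarrow> 0" using LIMSEQ_Suc by fastforce
  show ?thesis
  proof (rule Lim_null_comparison[OF always_eventually lim], rule allI)
    fix n
    have "norm (real (Suc n) powr (-h) * poly Q (ln (real (Suc n)))) \<le> real (Suc n) powr (-h) * (C * real (Suc n) powr (h / 2))"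
      using C(2)[of "real (Suc n)"] by (simp add: abs_mult mult_left_mono)
    also have "\<dots> = C * (real (Suc n) powr (-h) * real (Suc n) powr (h / 2))" by simp
    also have "real (Suc n) powr (-h) * real (Suc n) powr (h / 2) = real (Suc n) powr (-(h / 2))"
      unfolding powr_add[symmetric] by (rule arg_cong2[where f = "(powr)"]) auto
    finally show "norm (real (Suc n) powr (-h) * poly Q (ln (real (Suc n)))) \<le> C * real (Suc n) powr (-(h / 2))" .
  qed
qed

text \<open>A discrete version of D(s) = s times the integral of T(u) u^(-s-1). Replacing T(u) by u
  p(log u) gives s Q(0) with the Q of \<open>laplace_poly\<close>, and the error of the replacement
  is absolutely summable uniformly for 1 < s < 2, because theta < 1.\<close>

lemma dirichlet_series_near_1:
  fixes p :: "real poly"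
  assumes p: "pb \<theta> (\<lambda>y. T k y - y * poly p (ln y))" and \<theta>: "0 \<le> \<theta>" "\<theta> < 1"
  shows "\<exists>C. \<forall>s D. 1 < s \<and> s < 2 \<and> (\<lambda>n. dk k (Suc n) * real (Suc n) powr (-s)) sums D \<longrightarrow>
     \<bar>D - s * (\<Sum>i\<le>degree p. fact i * coeff p i / (s - 1) ^ Suc i)\<bar> \<le> C"
proof -
  define h where "h = (1 - \<theta>) / 2"
  have h: "h > 0" "\<theta> + h = 1 - h" using \<theta> by (auto simp: h_def field_simps)
  obtain C0 where C0: "C0 \<ge> 0" "\<And>u. u \<ge> 1 \<Longrightarrow> \<bar>T k u - u * poly p (ln u)\<bar> \<le> C0 * u powr (\<theta> + h)"
    using pbE[OF p h(1)] by blast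
  define C where "C = (\<Sum>n. (2 * C0) * real (Suc n) powr (-1 - h))"
  have sC: "summable (\<lambda>n. (2 * C0) * real (Suc n) powr (-1 - h))"
    by (intro summable_mult summable_Suc_powr h)
  have T1: "pb 1 (T k)"
  proof (rule pb_cong)
    show "pb 1 (\<lambda>y. (T k y - y * poly p (ln y)) + y * poly p (ln y))"
      using pb_add[OF pb_mono[OF p] pb_mult[OF pb_ident pb_poly_ln[of p], simplified]] \<theta> by simp
  qed simp
  have "\<bar>D - s * (\<Sum>i\<le>degree p. fact i * coeff p i / (s - 1) ^ Suc i)\<bar> \<le> C"
    if s: "1 < s" "s < 2" and D: "(\<lambda>n. dk k (Suc n) * real (Suc n) powr (-s)) sums D" for s D
  proof -
    define Q where "Q = (\<Sum>i\<le>degree p. smult (1 / (s - 1) ^ Suc i) ((pderiv ^^ i) p))"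
    have Q1: "smult (s - 1) Q - pderiv Q = p"
      and Q0: "poly Q 0 = (\<Sum>i\<le>degree p. fact i * coeff p i / (s - 1) ^ Suc i)"
      unfolding Q_def by (rule laplace_poly[OF s(1)])+
    have Qp: "(s - 1) * poly Q x - poly (pderiv Q) x = poly p x" for x
      using arg_cong[OF Q1, of "\<lambda>q. poly q x"] by simp
    define \<Phi> where "\<Phi> = (\<lambda>u. - (u powr (1 - s) * poly Q (ln u)))"
    have \<Phi>': "(\<Phi> has_real_derivative poly p (ln u) * u powr (-s)) (at u)" if u: "u > 0" for u
    proof -
      have "(\<Phi> has_real_derivative - ((1 - s) * u powr (1 - s - 1) * poly Q (ln u) + poly (pderiv Q) (ln u) / u * u powr (1 - s))) (at u)"
        unfolding \<Phi>_def using u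
        by (intro DERIV_minus DERIV_mult poly_ln_deriv has_real_derivative_powr) auto
      moreover have "u powr (1 - s) / u = u powr (-s)" using u by (simp add: powr_diff powr_minus divide_inverse)
      then have "- ((1 - s) * u powr (1 - s - 1) * poly Q (ln u) + poly (pderiv Q) (ln u) / u * u powr (1 - s))
          = ((s - 1) * poly Q (ln u) - poly (pderiv Q) (ln u)) * u powr (-s)"
        by (simp add: algebra_simps) (simp flip: divide_inverse times_divide_eq_right)
      ultimately show ?thesis by (simp add: Qp)
    qed
    have "(\<lambda>n. s * \<Phi> (real (Suc n))) \<longlonglongrightarrow> s * - 0"
      unfolding \<Phi>_def using powr_poly_ln_tendsto_0[of "s - 1" Q] s
      by (intro tendsto_mult tendsto_const tendsto_minus) (auto simp: algebra_simps)
    from telescope_sums[OF this]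
    have s2: "(\<lambda>n. s * \<Phi> (real (Suc (Suc n))) - s * \<Phi> (real (Suc n))) sums (s * poly Q 0)"
      by (simp add: \<Phi>_def)
    have s1: "(\<lambda>n. T k (real (Suc n)) * (real (Suc n) powr (-s) - real (Suc (Suc n)) powr (-s))) sums D"
    proof -
      define e where "e = (s - 1) / 2"
      have e: "e > 0" using s by (simp add: e_def)
      obtain C1 where C1: "C1 \<ge> 0" "\<And>y. y \<ge> 1 \<Longrightarrow> \<bar>T k y\<bar> \<le> C1 * y powr (1 + e)" using pbE[OF T1 e] by blast
      have "(\<lambda>n. C1 * real n powr (-e)) \<longlonglongrightarrow> C1 * 0"
        using e by (intro tendsto_mult tendsto_const tendsto_neg_powr filterlim_real_sequentially) auto
      then have lim: "(\<lambda>n. C1 * real (Suc n) powr (-e)) \<longlonglongrightarrow> 0" using LIMSEQ_Suc by fastforce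
      have "(\<lambda>N. T k (real N) * real (Suc N) powr (-s)) \<longlonglongrightarrow> 0"
      proof (rule Lim_null_comparison[OF eventually_mono[OF eventually_ge_at_top[of 1]] lim])
        fix N :: nat assume N: "1 \<le> N"
        have "norm (T k (real N) * real (Suc N) powr (-s)) \<le> (C1 * real N powr (1 + e)) * real (Suc N) powr (-s)"
          using C1(2)[of "real N"] N by (simp add: abs_mult mult_right_mono)
        also have "\<dots> \<le> (C1 * real (Suc N) powr (1 + e)) * real (Suc N) powr (-s)"
          using C1(1) e by (intro mult_right_mono mult_left_mono powr_mono2) auto
        also have "\<dots> = C1 * (real (Suc N) powr (1 + e) * real (Suc N) powr (-s))" by simp
        also have "real (Suc N) powr (1 + e) * real (Suc N) powr (-s) = real (Suc N) powr (-e)"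
          unfolding powr_add[symmetric] by (rule arg_cong2[where f = "(powr)"]) (auto simp: e_def field_simps)
        finally show "norm (T k (real N) * real (Suc N) powr (-s)) \<le> C1 * real (Suc N) powr (-e)" .
      qed
      from tendsto_diff[OF D[unfolded sums_def T_abel] this]
      show ?thesis by (simp add: sums_def)
    qed
    define g where "g = (\<lambda>n. T k (real (Suc n)) * (real (Suc n) powr (-s) - real (Suc (Suc n)) powr (-s))
       - (s * \<Phi> (real (Suc (Suc n))) - s * \<Phi> (real (Suc n))))"
    have sg: "g sums (D - s * poly Q 0)" unfolding g_def by (rule sums_diff[OF s1 s2])
    have g_le: "norm (g n) \<le> (2 * C0) * real (Suc n) powr (-1 - h)" for n
    proof -
      define m where "m = real (Suc n)"
      have m: "m \<ge> 1" by (simp add: m_def)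
      \<comment> \<open>Since T is constant on [m, m + 1), the derivative of G there is s u^(-s-1)
        (T(u) - u p(log u)), which is where the asymptotics of T enter.\<close>
      define G where "G = (\<lambda>u. - (T k m * u powr (-s)) - s * \<Phi> u)"
      have "\<exists>z. m < z \<and> z < m + 1 \<and> G (m + 1) - G m = (m + 1 - m) * (- (T k m * (-s * z powr (-s - 1))) - s * (poly p (ln z) * z powr (-s)))"
      proof (rule MVT2)
        fix u assume u: "m \<le> u"
        show "(G has_real_derivative - (T k m * (-s * u powr (-s - 1))) - s * (poly p (ln u) * u powr (-s))) (at u)"
          unfolding G_def using u m
          by (intro DERIV_diff DERIV_minus DERIV_cmult has_real_derivative_powr \<Phi>') auto
      qed simp
      then obtain z where z: "m < z" "z < m + 1" "G (m + 1) - G m = T k m * (s * z powr (-s - 1)) - s * (poly p (ln z) * z powr (-s))"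
        by auto
      have "\<lfloor>z\<rfloor> = int (Suc n)" using z by (intro floor_unique) (auto simp: m_def)
      then have Tz: "T k z = T k m" by (simp add: T_def m_def)
      have zp: "z powr (-s) = z * z powr (-s - 1)"
        using z m by (simp add: powr_diff)
      have "g n = G (m + 1) - G m" by (simp add: g_def G_def m_def algebra_simps)
      also have "\<dots> = s * z powr (-s - 1) * (T k z - z * poly p (ln z))"
        unfolding z(3) zp Tz by (simp add: algebra_simps)
      finally have "norm (g n) = s * z powr (-s - 1) * \<bar>T k z - z * poly p (ln z)\<bar>" using s by (simp add: abs_mult)
      also have "\<dots> \<le> (2 * z powr (-2)) * (C0 * z powr (1 - h))"
        using s z m C0(2)[of z] h by (intro mult_mono powr_mono) auto
      also have "\<dots> = (2 * C0) * (z powr (-2) * z powr (1 - h))" by simp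
      also have "z powr (-2) * z powr (1 - h) = z powr (-1 - h)"
        unfolding powr_add[symmetric] by simp
      also have "(2 * C0) * z powr (-1 - h) \<le> (2 * C0) * m powr (-1 - h)"
        using C0(1) z m h by (intro mult_left_mono powr_mono2') auto
      finally show ?thesis by (simp add: m_def)
    qed
    have "norm (\<Sum>n. g n) \<le> C" unfolding C_def by (rule norm_suminf_le[OF g_le sC])
    then show ?thesis using sg by (simp add: sums_iff Q0)
  qed
  then show ?thesis by blast
qed

lemma bounded_poly_imp_constant:
  fixes P :: "complex poly"
  assumes "\<And>X. X \<ge> X0 \<Longrightarrow> norm (poly P (of_real X)) \<le> B"
  shows "coeff P (Suc j) = 0"
proof -
  obtain a q where P: "P = pCons a q" by (cases P) auto
  have "q = 0"
  proof (rule ccontr)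
    assume "q \<noteq> 0"
    then obtain r where r: "\<forall>z. r \<le> norm z \<longrightarrow> B + 1 \<le> norm (poly (pCons a q) z)"
      using poly_infinity by blast
    define X where "X = max X0 \<bar>r\<bar>"
    have "r \<le> norm (complex_of_real X)" by (auto simp: X_def)
    then have "B + 1 \<le> norm (poly P (of_real X))" using r P by blast
    moreover have "norm (poly P (of_real X)) \<le> B" by (rule assms) (simp add: X_def)
    ultimately show False by simp
  qed
  then show ?thesis by (simp add: P)
qed

text \<open>The polar part of D(s) / s at 1 is computed twice: from the power series of h, with
  coefficients c_(k-j) of (s - 1)^(-j-1), and from the asymptotics of T, with coefficients j! p_j.
  The difference stays bounded as s tends to 1 from above, so the coefficients agree, and Leibniz'
  rule turns the residue into the sum of c_(k-i) (ln y)^i / i!. All y > 0 are allowed because the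
  formula is applied at x / N, possibly below 1.\<close>

theorem residue_zeta_power:
  fixes p :: "real poly"
  assumes p: "pb \<theta> (\<lambda>y. T (Suc k) y - y * poly p (ln y))" and \<theta>: "0 \<le> \<theta>" "\<theta> < 1" and y: "y > 0"
  shows "residue (\<lambda>s. of_real y powr (s - 1) / s * (zF s / (s - 1)) ^ Suc k) 1 = of_real (poly p (ln y))"
proof -
  define h where "h = (\<lambda>s. zF s ^ Suc k / s)"
  have hol: "h holomorphic_on {s. Re s > 0}"
    unfolding h_def by (intro holomorphic_intros zF_holomorphic) auto
  have op: "open {s. Re s > 0}" by (rule open_halfspace_Re_gt)
  define c where "c = (\<lambda>i. (deriv ^^ i) h 1 / fact i)"
  have ball: "ball 1 1 \<subseteq> {s. Re s > 0}"
  proof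
    fix s :: complex assume "s \<in> ball 1 1"
    then have "norm (1 - s) < 1" by (simp add: dist_norm)
    moreover have "Re (1 - s) \<le> norm (1 - s)" by (rule complex_Re_le_cmod)
    ultimately show "s \<in> {s. Re s > 0}" by simp
  qed
  have series: "(\<lambda>n. c n * (s - 1) ^ n) sums h s" if "s \<in> ball 1 1" for s
    unfolding c_def by (rule holomorphic_power_series[OF holomorphic_on_subset[OF hol ball] that])
  \<comment> \<open>Convergence at a point between 1/2 and the radius 1 gives absolute convergence
    at 1/2, hence a bound for the remainder that is uniform in |s - 1| <= 1/2.\<close>
  have "summable (\<lambda>n. c n * (complex_of_real (3 / 4)) ^ n)"
    using series[of "1 + complex_of_real (3 / 4)"] by (auto simp: dist_norm sums_iff)
  then have sum_half: "summable (\<lambda>n. norm (c n * (complex_of_real (1 / 2)) ^ n))"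
    by (rule powser_insidea) simp
  define b where "b = (\<lambda>n. norm (c (n + Suc k)) * (1 / 2) ^ n)"
  have sb: "summable b"
  proof -
    have "summable (\<lambda>n. 2 ^ Suc k * norm (c (n + Suc k) * (complex_of_real (1 / 2)) ^ (n + Suc k)))"
      by (intro summable_mult summable_ignore_initial_segment[OF sum_half])
    moreover have "(\<lambda>n. 2 ^ Suc k * norm (c (n + Suc k) * (complex_of_real (1 / 2)) ^ (n + Suc k))) = b"
      by (rule ext) (simp add: b_def norm_mult norm_power power_add norm_divide field_simps)
    ultimately show ?thesis by (simp only:)
  qed
  have rem: "norm (h s / (s - 1) ^ Suc k - (\<Sum>i<Suc k. c i * (s - 1) ^ i) / (s - 1) ^ Suc k) \<le> suminf b"
    if t: "0 < norm (s - 1)" "norm (s - 1) \<le> 1 / 2" for s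
  proof -
    have sb1: "s \<in> ball 1 1" using t by (simp add: dist_norm norm_minus_commute)
    have ne: "s \<noteq> 1" using t by auto
    have "(\<lambda>n. c (n + Suc k) * (s - 1) ^ (n + Suc k)) sums (h s - (\<Sum>i<Suc k. c i * (s - 1) ^ i))"
      by (rule sums_split_initial_segment[OF series[OF sb1]])
    from sums_divide[OF this, of "(s - 1) ^ Suc k"]
    have "(\<lambda>n. c (n + Suc k) * (s - 1) ^ n) sums ((h s - (\<Sum>i<Suc k. c i * (s - 1) ^ i)) / (s - 1) ^ Suc k)"
      using ne by (simp add: power_add mult.assoc)
    moreover have "norm (\<Sum>n. c (n + Suc k) * (s - 1) ^ n) \<le> suminf b"
    proof (rule norm_suminf_le[OF _ sb])
      fix n
      show "norm (c (n + Suc k) * (s - 1) ^ n) \<le> b n"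
        unfolding b_def norm_mult norm_power using t by (intro mult_left_mono power_mono) auto
    qed
    ultimately show ?thesis by (simp add: sums_iff diff_divide_distrib)
  qed
  obtain C where C: "\<And>s D. 1 < s \<Longrightarrow> s < 2 \<Longrightarrow> (\<lambda>n. dk (Suc k) (Suc n) * real (Suc n) powr (-s)) sums D \<Longrightarrow>
     \<bar>D - s * (\<Sum>i\<le>degree p. fact i * coeff p i / (s - 1) ^ Suc i)\<bar> \<le> C"
    using dirichlet_series_near_1[OF p \<theta>] by blast
  \<comment> \<open>The difference of the two polar parts as a polynomial in X = 1 / (s - 1).
    Boundedness for large real X forces its nonconstant coefficients to vanish.\<close>
  define P where "P = (\<Sum>j<Suc k. monom (c (k - j)) (Suc j)) - (\<Sum>j\<le>degree p. monom (complex_of_real (fact j * coeff p j)) (Suc j))"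
  have "norm (poly P (of_real X)) \<le> suminf b + C" if X: "X \<ge> 2" for X
  proof -
    define t where "t = 1 / X"
    have t: "0 < t" "t \<le> 1 / 2" using X by (auto simp: t_def field_simps)
    define s where "s = 1 + t"
    have s: "1 < s" "s < 2" "s - 1 = t" using t by (auto simp: s_def)
    define E where "E = (\<Sum>i\<le>degree p. fact i * coeff p i / (s - 1) ^ Suc i)"
    have "(dterm (dk (Suc k)) (of_real s) has_sum (zF (of_real s) / (of_real s - 1)) ^ Suc k) {1..}"
      using s by (intro dterm_dk_has_sum) simp
    then have "(\<lambda>n. dterm (dk (Suc k)) (of_real s) (Suc n)) sums ((zF (of_real s) / (of_real s - 1)) ^ Suc k)"
      unfolding has_sum_from_1 by (rule has_sum_imp_sums)
    moreover have "dterm (dk (Suc k)) (of_real s) (Suc n) = complex_of_real (dk (Suc k) (Suc n) * real (Suc n) powr (-s))" for n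
    proof -
      have "complex_of_nat (Suc n) powr complex_of_real s = complex_of_real (real (Suc n) powr s)"
        using powr_of_real[of "real (Suc n)" s] by simp
      then show ?thesis by (simp add: dterm_def powr_minus divide_inverse del: of_nat_Suc)
    qed
    ultimately have sums: "(\<lambda>n. complex_of_real (dk (Suc k) (Suc n) * real (Suc n) powr (-s))) sums ((zF (of_real s) / (of_real s - 1)) ^ Suc k)"
      by simp
    define D where "D = Re ((zF (of_real s) / (of_real s - 1)) ^ Suc k)"
    have D: "(\<lambda>n. dk (Suc k) (Suc n) * real (Suc n) powr (-s)) sums D"
      using sums_Re[OF sums] by (simp add: D_def)
    have Deq: "complex_of_real D = (zF (of_real s) / (of_real s - 1)) ^ Suc k"
      using sums_unique2[OF sums_of_real[OF D] sums] .
    have hD: "h (of_real s) / (of_real s - 1) ^ Suc k = of_real (D / s)"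
      using s by (simp add: h_def Deq power_divide)
    have "\<bar>D / s - E\<bar> \<le> C"
    proof -
      have "\<bar>D - s * E\<bar> \<le> C" unfolding E_def using s D by (intro C) auto
      moreover have "D / s - E = (D - s * E) / s" using s by (simp add: field_simps)
      then have "\<bar>D / s - E\<bar> = \<bar>D - s * E\<bar> / s" using s by simp
      moreover have "\<bar>D - s * E\<bar> / s \<le> \<bar>D - s * E\<bar> / 1" using s by (intro divide_left_mono) auto
      ultimately show ?thesis by simp
    qed
    have st: "complex_of_real s - 1 = of_real t" by (simp add: s_def)
    have 1: "norm (of_real (D / s) - (\<Sum>i<Suc k. c i * of_real t ^ i) / of_real t ^ Suc k) \<le> suminf b"
      using rem[of "of_real s"] t hD unfolding st by simp
    have "poly P (of_real X) = (\<Sum>i<Suc k. c i * of_real t ^ i) / of_real t ^ Suc k - of_real E"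
    proof -
      have "(\<Sum>j<Suc k. c (k - j) * of_real X ^ Suc j) = (\<Sum>j<Suc k. c (Suc k - Suc j) * of_real t ^ (Suc k - Suc j) / of_real t ^ Suc k)"
      proof (intro sum.cong refl)
        fix j assume j: "j \<in> {..<Suc k}"
        have tX: "complex_of_real X = 1 / of_real t" using X by (simp add: t_def)
        have "of_real t ^ Suc k = complex_of_real t ^ (k - j) * of_real t ^ Suc j"
          unfolding power_add[symmetric] using j by simp
        then show "c (k - j) * of_real X ^ Suc j = c (Suc k - Suc j) * of_real t ^ (Suc k - Suc j) / of_real t ^ Suc k"
          unfolding tX using t by (simp add: power_divide)
      qed
      also have "\<dots> = (\<Sum>i<Suc k. c i * of_real t ^ i / of_real t ^ Suc k)"
        by (rule sum.nat_diff_reindex)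
      also have "\<dots> = (\<Sum>i<Suc k. c i * of_real t ^ i) / of_real t ^ Suc k" by (rule sum_divide_distrib [symmetric])
      finally have a: "(\<Sum>j<Suc k. c (k - j) * of_real X ^ Suc j) = (\<Sum>i<Suc k. c i * of_real t ^ i) / of_real t ^ Suc k" .
      have b: "(\<Sum>j\<le>degree p. complex_of_real (fact j * coeff p j) * of_real X ^ Suc j) = of_real E"
        unfolding E_def s(3) of_real_sum using X by (intro sum.cong refl) (simp add: t_def power_divide field_simps)
      show ?thesis unfolding P_def poly_diff poly_sum poly_monom a b ..
    qed
    also have "\<dots> = of_real (D / s - E) - (of_real (D / s) - (\<Sum>i<Suc k. c i * of_real t ^ i) / of_real t ^ Suc k)" by simp
    also have "norm \<dots> \<le> norm (complex_of_real (D / s - E)) + norm (of_real (D / s) - (\<Sum>i<Suc k. c i * of_real t ^ i) / of_real t ^ Suc k)"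
      by (rule norm_triangle_ineq4)
    also have "\<dots> \<le> C + suminf b" using \<open>\<bar>D / s - E\<bar> \<le> C\<close> 1 by (intro add_mono) (auto simp only: norm_of_real)
    finally show ?thesis by simp
  qed
  then have P0: "coeff P (Suc j) = 0" for j by (rule bounded_poly_imp_constant)
  have coeffs: "complex_of_real (coeff p j) = (if j \<le> k then c (k - j) / fact j else 0)" for j
  proof -
    have "coeff P (Suc j) = (\<Sum>i<Suc k. if i = j then c (k - i) else 0) - (\<Sum>i\<le>degree p. if i = j then complex_of_real (fact i * coeff p i) else 0)"
      unfolding P_def coeff_diff coeff_sum coeff_monom by simp
    also have "\<dots> = (if j \<le> k then c (k - j) else 0) - complex_of_real (fact j * coeff p j)"
      by (auto simp: sum.delta coeff_eq_0)
    finally have "complex_of_real (fact j * coeff p j) = (if j \<le> k then c (k - j) else 0)" using P0[of j] by simp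
    then show ?thesis by (auto simp: field_simps)
  qed
  have "residue (\<lambda>s. of_real y powr (s - 1) / s * (zF s / (s - 1)) ^ Suc k) 1 = residue (\<lambda>s. (of_real y powr (s - 1) * h s) / (s - 1) ^ Suc k) 1"
    by (rule arg_cong2[where f = residue]) (auto simp: h_def power_divide)
  also have "\<dots> = (deriv ^^ k) (\<lambda>s. of_real y powr (s - 1) * h s) 1 / fact k"
    using y by (intro residue_holomorphic_over_power[OF op] holomorphic_intros hol) auto
  also have "(deriv ^^ k) (\<lambda>s. of_real y powr (s - 1) * h s) 1 =
      (\<Sum>i=0..k. of_nat (k choose i) * (deriv ^^ i) (\<lambda>s. of_real y powr (s - 1)) 1 * (deriv ^^ (k - i)) h 1)"
    using y by (intro higher_deriv_mult[OF _ hol op] holomorphic_intros) auto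
  also have "\<dots> / fact k = (\<Sum>i=0..k. (c (k - i) / fact i) * of_real (ln y) ^ i)"
  proof -
    have d: "(deriv ^^ i) (\<lambda>s. complex_of_real y powr (s - 1)) = (\<lambda>s. of_real (ln y) ^ i * of_real y powr (s - 1))" for i
    proof (induction i)
      case (Suc i)
      have "((\<lambda>s. complex_of_real y powr (s - 1)) has_field_derivative of_real (ln y) * of_real y powr (s - 1)) (at s)" for s
        using y unfolding powr_def by (auto intro!: derivative_eq_intros simp: Ln_of_real mult.commute)
      from DERIV_cmult[OF this, of "of_real (ln y) ^ i"]
      have "deriv (\<lambda>s. complex_of_real (ln y) ^ i * of_real y powr (s - 1)) s = of_real (ln y) ^ Suc i * of_real y powr (s - 1)" for s
        by (intro DERIV_imp_deriv) (simp add: mult_ac)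
      then show ?case by (simp add: Suc fun_eq_iff)
    qed simp
    show ?thesis unfolding sum_divide_distrib d
    proof (intro sum.cong refl)
      fix i assume i: "i \<in> {0..k}"
      have "of_nat (k choose i) = (fact k / (fact i * fact (k - i)) :: complex)" using i by (simp add: binomial_fact)
      then show "of_nat (k choose i) * (of_real (ln y) ^ i * of_real y powr (1 - 1)) * (deriv ^^ (k - i)) h 1 / fact k = (c (k - i) / fact i) * of_real (ln y) ^ i"
        using y by (simp add: c_def field_simps)
    qed
  qed
  also have "\<dots> = (\<Sum>i=0..k. of_real (coeff p i) * of_real (ln y) ^ i)"
    by (intro sum.cong refl) (simp add: coeffs)
  also have "\<dots> = (\<Sum>i\<le>degree p. of_real (coeff p i) * of_real (ln y) ^ i)"
  proof (rule sum.mono_neutral_right)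
    have "degree p \<le> k" by (rule degree_le) (use coeffs in \<open>auto simp flip: of_real_eq_0_iff[where 'a = complex]\<close>)
    then show "{..degree p} \<subseteq> {0..k}" by auto
  qed (auto simp: coeff_eq_0)
  also have "\<dots> = of_real (poly p (ln y))" by (simp add: poly_altdef)
  finally show ?thesis .
qed

section \<open>The main term\<close>

text \<open>Also valid for y < 1, where T vanishes and y p(log y) must itself be small. This is
  needed because the weights are not confined to N <= x. The loss is taken as a power of x, which
  stays at least 1 when y is small.\<close>

lemma piltz_divisor_asymp_uniform:
  fixes p :: "real poly"
  assumes p: "pb (1 - 1 / real k) (\<lambda>y. T k y - y * poly p (ln y))" and k: "k \<ge> 1" and e: "\<epsilon> > 0"
  obtains C where "C \<ge> 0" "\<And>x y. 1 \<le> x \<Longrightarrow> 0 < y \<Longrightarrow> y \<le> x \<Longrightarrow>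
     \<bar>T k y - y * poly p (ln y)\<bar> \<le> C * (y powr (1 - 1 / real k) * x powr \<epsilon>)"
proof -
  obtain C1 where C1: "C1 \<ge> 0" "\<And>y. y \<ge> 1 \<Longrightarrow> \<bar>T k y - y * poly p (ln y)\<bar> \<le> C1 * y powr (1 - 1 / real k + \<epsilon>)"
    using pbE[OF p e] by blast
  have k1: "1 / real k \<le> 1" using k by simp
  \<comment> \<open>The reflected polynomial p(-X) turns ln y into ln (1 / y), so a bound at 1 / y
    >= 1 serves y < 1. A loss of (1 / y)^(1/k) is exactly what y^(1-1/k) allows.\<close>
  have "1 / real k > 0" using k by simp
  then obtain C2 where C2: "C2 \<ge> 0" "\<And>y. y \<ge> 1 \<Longrightarrow> \<bar>poly (pcompose p [:0, -1:]) (ln y)\<bar> \<le> C2 * y powr (0 + 1 / real k)"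
    using pbE[OF pb_poly_ln[of "pcompose p [:0, -1:]"]] by blast
  have "\<bar>T k y - y * poly p (ln y)\<bar> \<le> (C1 + C2) * (y powr (1 - 1 / real k) * x powr \<epsilon>)"
    if h: "1 \<le> x" "0 < y" "y \<le> x" for x y
  proof (cases "y \<ge> 1")
    case True
    have "\<bar>T k y - y * poly p (ln y)\<bar> \<le> C1 * y powr (1 - 1 / real k + \<epsilon>)" by (rule C1(2)[OF True])
    also have "\<dots> = C1 * (y powr (1 - 1 / real k) * y powr \<epsilon>)" by (simp only: powr_add)
    also have "\<dots> \<le> (C1 + C2) * (y powr (1 - 1 / real k) * x powr \<epsilon>)"
      using h e k1 C1(1) C2(1) by (intro mult_mono powr_mono2) auto
    finally show ?thesis .
  next
    case False
    then have "\<lfloor>y\<rfloor> = 0" using h by (simp add: floor_eq_iff)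
    then have T0: "T k y = 0" by (simp add: T_def)
    have "\<bar>poly (pcompose p [:0, -1:]) (ln (1 / y))\<bar> \<le> C2 * (1 / y) powr (0 + 1 / real k)"
      using False h by (intro C2(2)) simp
    then have "\<bar>poly p (ln y)\<bar> \<le> C2 * (1 / y) powr (1 / real k)"
      using h by (simp add: poly_pcompose ln_div)
    then have "y * \<bar>poly p (ln y)\<bar> \<le> y * (C2 * (1 / y) powr (1 / real k))" using h by (intro mult_left_mono) auto
    also have "\<dots> = C2 * y powr (1 - 1 / real k)" using h by (simp add: powr_diff powr_divide)
    also have "\<dots> = C2 * (y powr (1 - 1 / real k) * 1)" by simp
    also have "\<dots> \<le> (C1 + C2) * (y powr (1 - 1 / real k) * x powr \<epsilon>)"
      using h e C1(1) C2(1) by (intro mult_mono ge_one_powr_ge_zero) auto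
    finally show ?thesis using T0 h by (simp add: abs_mult)
  qed
  then show ?thesis using that[of "C1 + C2"] C1(1) C2(1) by simp
qed

text \<open>Terms with N > x do no harm, since \<open>T k\<close> vanishes below 1.\<close>

lemma sum_gcd_restricted:
  assumes S: "finite S" "\<And>N. N \<notin> S \<Longrightarrow> w N = 0" "\<And>N. N \<in> S \<Longrightarrow> N > 0"
    and w: "\<And>n. n > 0 \<Longrightarrow> (if gcd n q = g then dk k n else 0) = dconv w (dk k) n" and x: "x \<ge> 1"
  shows "(\<Sum>n | n \<in> {1..nat \<lfloor>x\<rfloor>} \<and> gcd n q = g. dk k n) = (\<Sum>N\<in>S. w N * T k (x / real N))"
proof -
  define Y where "Y = nat \<lfloor>x\<rfloor>"
  have div: "nat \<lfloor>x / real n\<rfloor> = Y div n" for n using x by (simp add: Y_def nat_floor_div)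
  have "(\<Sum>n | n \<in> {1..Y} \<and> gcd n q = g. dk k n) = (\<Sum>n=1..Y. if gcd n q = g then dk k n else 0)"
    by (rule sum.inter_filter) simp
  also have "\<dots> = (\<Sum>n=1..Y. dconv (dk k) w n *\<^sub>R 1)"
    by (intro sum.cong refl) (simp add: w dconv_commute[of "dk k"])
  also have "\<dots> = (\<Sum>b=1..Y. w b *\<^sub>R (\<Sum>a=1..Y div b. dk k a *\<^sub>R 1))" by (rule sum_dconv)
  also have "\<dots> = (\<Sum>b=1..Y. w b * T k (x / real b))" by (simp add: T_def div)
  also have "\<dots> = (\<Sum>b\<in>{1..Y} \<inter> S. w b * T k (x / real b))"
    using S(2) by (intro sum.mono_neutral_right) auto
  also have "\<dots> = (\<Sum>N\<in>S. w N * T k (x / real N))"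
  proof (rule sum.mono_neutral_left)
    show "\<forall>N\<in>S - {1..Y} \<inter> S. w N * T k (x / real N) = 0"
    proof
      fix N assume "N \<in> S - {1..Y} \<inter> S"
      then have "Y < N" using S(3) by (auto simp: not_le Suc_le_eq)
      then show "w N * T k (x / real N) = 0" by (simp add: T_def div)
    qed
  qed (use S(1) in auto)
  finally show ?thesis by (simp add: Y_def)
qed

lemma residue_finite_sum:
  assumes "open A" "z \<in> A" "finite I" "\<And>i. i \<in> I \<Longrightarrow> f i holomorphic_on A - {z}"
  shows "residue (\<lambda>s. \<Sum>i\<in>I. c i * f i s) z = (\<Sum>i\<in>I. c i * residue (f i) z)"
  using assms(3,4)
proof (induction I rule: finite_induct)
  case empty
  then show ?case by (simp add: residue_const)
next
  case (insert i I)
  have "residue (\<lambda>s. c i * f i s + (\<Sum>i\<in>I. c i * f i s)) z = residue (\<lambda>s. c i * f i s) z + residue (\<lambda>s. \<Sum>i\<in>I. c i * f i s) z"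
    using insert by (intro residue_add[OF assms(1,2)] holomorphic_intros) auto
  also have "residue (\<lambda>s. c i * f i s) z = c i * residue (f i) z"
    using insert by (intro residue_lmul[OF assms(1,2)]) auto
  finally show ?case using insert by simp
qed

text \<open>For Re s > 1 the restricted series is the Dirichlet polynomial of w times a power of
  zeta. Multiplying by x^(s-1) turns N^(-s) into (1 / N) (x / N)^(s-1), so the residue is a
  combination of residues already known at y = x / N.\<close>

lemma main_coeff_eq:
  fixes p :: "real poly"
  assumes p: "pb \<theta> (\<lambda>y. T (Suc k) y - y * poly p (ln y))" and \<theta>: "0 \<le> \<theta>" "\<theta> < 1" and x: "x \<ge> 1"
    and S: "finite S" "\<And>N. N \<notin> S \<Longrightarrow> w N = 0" "\<And>N. N \<in> S \<Longrightarrow> N > 0"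
    and w: "\<And>n. n > 0 \<Longrightarrow> (if gcd n q = gcd q a then dk (Suc k) n else 0) = dconv w (dk (Suc k)) n"
  shows "main_coeff (Suc k) x q a = of_nat q / of_nat (totient (q div gcd q a)) *
           of_real (\<Sum>N\<in>S. w N / real N * poly p (ln (x / real N)))"
proof -
  define U where "U = {s. 0 < Re s} - {1}"
  have opR: "open {s. 0 < Re s}" by (rule open_halfspace_Re_gt)
  have opU: "open U" unfolding U_def using opR by (intro open_delete)
  have conU: "connected U" unfolding U_def
    by (intro connected_open_delete opR convex_connected convex_halfspace_Re_gt) simp
  define F0 where "F0 = (\<lambda>s. (\<Sum>N\<in>S. of_real (w N) / of_nat N powr s) * (zF s / (s - 1)) ^ Suc k)"
  have F0_hol: "F0 holomorphic_on U"
    unfolding F0_def U_def using S(3)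
    by (intro holomorphic_intros holomorphic_on_subset[OF zF_holomorphic]) auto
  have F0_eq: "F0 s = divisor_series (Suc k) q a s" if s: "1 < Re s" for s
  proof -
    have "(dterm w s has_sum (\<Sum>N\<in>S. dterm w s N)) S" using S(1) by simp
    also have "?this \<longleftrightarrow> (dterm w s has_sum (\<Sum>N\<in>S. dterm w s N)) {1..}"
      using S(2,3) by (intro has_sum_cong_neutral) (auto simp: dterm_def Suc_le_eq)
    finally have "(dterm (dconv w (dk (Suc k))) s has_sum ((\<Sum>N\<in>S. dterm w s N) * (zF s / (s - 1)) ^ Suc k)) {1..}"
      by (rule dterm_dconv_has_sum[OF _ dterm_dk_has_sum[OF s]])
    then have "(dterm (dconv w (dk (Suc k))) s has_sum F0 s) {1..}" by (simp add: F0_def dterm_def)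
    also have "?this \<longleftrightarrow> ((\<lambda>n. of_nat (divisor_fun (Suc k) n) / of_nat n powr s) has_sum F0 s) {n. 1 \<le> n \<and> gcd n q = gcd q a}"
      by (rule has_sum_cong_neutral) (auto simp: dterm_def w[symmetric] Suc_le_eq)
    finally show ?thesis unfolding divisor_series_def by (rule infsumI [symmetric])
  qed
  define F where "F = divisor_series_cont (Suc k) q a"
  \<comment> \<open>The explicit product witnesses that a continuation exists; only then does the
    choice in \<open>divisor_series_cont\<close> have its defining property.\<close>
  have "\<exists>F. F holomorphic_on ({s. 0 < Re s} - {1}) \<and> (\<forall>s. 1 < Re s \<longrightarrow> F s = divisor_series (Suc k) q a s)"
    using F0_hol F0_eq by (intro exI[of _ F0]) (auto simp: U_def)
  from someI_ex[OF this] have F: "F holomorphic_on U" "\<And>s. 1 < Re s \<Longrightarrow> F s = divisor_series (Suc k) q a s"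
    by (auto simp: F_def divisor_series_cont_def U_def)
  \<comment> \<open>The identity theorem: U is connected, and both functions agree on the half-plane
    Re s > 1.\<close>
  have F_eq: "F s = F0 s" if "s \<in> U" for s
  proof (rule analytic_continuation_open[of "{s. 1 < Re s}" U F F0 s])
    show "{s. 1 < Re s} \<noteq> {}" by (auto intro!: exI[of _ 2])
  qed (use F F0_hol F0_eq opU conU that in \<open>auto simp: U_def open_halfspace_Re_gt\<close>)
  have U1: "eventually (\<lambda>s. s \<in> U) (at 1)"
    using eventually_at_in_open[OF opR, of 1] by (simp add: U_def)
  define H where "H = (\<lambda>N s. complex_of_real (x / real N) powr (s - 1) / s * (zF s / (s - 1)) ^ Suc k)"
  have "residue (\<lambda>s. of_real x powr (s - 1) / s * F s) 1 = residue (\<lambda>s. \<Sum>N\<in>S. of_real (w N / real N) * H N s) 1"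
  proof (rule residue_cong[OF eventually_mono[OF U1] refl])
    fix s assume s: "s \<in> U"
    have "of_real x powr (s - 1) * (of_real (w N) / of_nat N powr s) = of_real (w N / real N) * of_real (x / real N) powr (s - 1)"
      if "N \<in> S" for N
    proof -
      have N: "N > 0" by (rule S(3)[OF that])
      have "(complex_of_real (x / real N) * of_nat N) powr (s - 1) = of_real (x / real N) powr (s - 1) * of_nat N powr (s - 1)"
        using x N by (intro powr_times_real) auto
      then have "of_real x powr (s - 1) = complex_of_real (x / real N) powr (s - 1) * (of_nat N powr s / of_nat N)"
        using N by (simp add: powr_diff)
      then show ?thesis using N by (simp add: field_simps)
    qed
    then have "(\<Sum>N\<in>S. of_real x powr (s - 1) * (of_real (w N) / of_nat N powr s)) = (\<Sum>N\<in>S. of_real (w N / real N) * of_real (x / real N) powr (s - 1))"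
      by (rule sum.cong[OF refl])
    then have "of_real x powr (s - 1) * (\<Sum>N\<in>S. of_real (w N) / of_nat N powr s) = (\<Sum>N\<in>S. of_real (w N / real N) * of_real (x / real N) powr (s - 1))"
      by (simp only: sum_distrib_left)
    moreover have "of_real x powr (s - 1) / s * F s = (of_real x powr (s - 1) * (\<Sum>N\<in>S. of_real (w N) / of_nat N powr s)) * ((zF s / (s - 1)) ^ Suc k / s)"
      unfolding F_eq[OF s] F0_def by (simp only: times_divide_eq_left times_divide_eq_right mult.assoc)
    ultimately have "of_real x powr (s - 1) / s * F s = (\<Sum>N\<in>S. of_real (w N / real N) * of_real (x / real N) powr (s - 1)) * ((zF s / (s - 1)) ^ Suc k / s)"
      by simp
    also have "\<dots> = (\<Sum>N\<in>S. of_real (w N / real N) * H N s)"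
      unfolding sum_distrib_right H_def
      by (intro sum.cong refl) (simp only: times_divide_eq_left times_divide_eq_right mult.assoc)
    finally show "of_real x powr (s - 1) / s * F s = (\<Sum>N\<in>S. of_real (w N / real N) * H N s)" .
  qed
  also have "\<dots> = (\<Sum>N\<in>S. of_real (w N / real N) * residue (H N) 1)"
  proof (rule residue_finite_sum[OF opR])
    fix N assume "N \<in> S"
    then have "x / real N > 0" using x S(3) by simp
    then have "complex_of_real (x / real N) \<noteq> 0" by (metis less_irrefl of_real_eq_0_iff)
    then show "H N holomorphic_on {s. 0 < Re s} - {1}"
      unfolding H_def by (intro holomorphic_intros holomorphic_on_subset[OF zF_holomorphic]) auto
  qed (use S(1) in auto)
  also have "\<dots> = of_real (\<Sum>N\<in>S. w N / real N * poly p (ln (x / real N)))"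
    unfolding of_real_sum
  proof (intro sum.cong refl)
    fix N assume "N \<in> S"
    then have "x / real N > 0" using x S(3) by simp
    then have "residue (H N) 1 = of_real (poly p (ln (x / real N)))"
      unfolding H_def by (rule residue_zeta_power[OF p \<theta>])
    then show "of_real (w N / real N) * residue (H N) 1 = complex_of_real (w N / real N * poly p (ln (x / real N)))" by simp
  qed
  finally show ?thesis unfolding main_coeff_def F_def by simp
qed

text \<open>Average and main term are the same combination with coefficients w N / totient(q / g),
  once of T(x / N) and once of (x / N) p(log(x / N)). On the support g divides N, so the asymptotic
  error at x / N is bounded by the one at x / g.\<close>

lemma principal_part_bound:
  fixes p :: "real poly"
  assumes p: "pb (1 - 1 / real (Suc k)) (\<lambda>y. T (Suc k) y - y * poly p (ln y))" and x: "x \<ge> 1" and q: "q > 0"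
    and C: "C \<ge> 0" "\<And>y. 0 < y \<Longrightarrow> y \<le> x \<Longrightarrow> \<bar>T (Suc k) y - y * poly p (ln y)\<bar> \<le> C * y powr (1 - 1 / real (Suc k))"
  shows "norm (of_real ((\<Sum>n | n \<in> {1..nat \<lfloor>x\<rfloor>} \<and> gcd n q = gcd a q. dk (Suc k) n) / real (totient (q div gcd a q)))
            - of_real x * main_coeff (Suc k) x q a / of_nat q)
     \<le> real (tau q) ^ (2 * Suc k) * C * (x / real (gcd a q)) powr (1 - 1 / real (Suc k)) / real (totient (q div gcd a q))"
proof -
  define g where "g = gcd a q"
  define \<phi> where "\<phi> = real (totient (q div g))"
  have g: "g > 0" "g dvd q" using q by (auto simp: g_def)
  have \<theta>: "0 \<le> 1 - 1 / real (Suc k)" "1 - 1 / real (Suc k) < 1" by auto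
  obtain w where fw: "fin_weight g (real (tau q) ^ (2 * Suc k)) w"
    and w: "\<forall>n>0. (if gcd n q = g then dk (Suc k) n else 0) = dconv w (dk (Suc k)) n"
    using gcd_restricted_dk[OF q g(2), of "Suc k"] by blast
  obtain S where S: "finite S" "\<And>N. N \<notin> S \<Longrightarrow> w N = 0" "\<And>N. N \<in> S \<Longrightarrow> N > 0" "\<And>N. N \<in> S \<Longrightarrow> g dvd N"
      "(\<Sum>N\<in>S. \<bar>w N\<bar>) \<le> real (tau q) ^ (2 * Suc k)"
    using fw unfolding fin_weight_def by blast
  have mc: "main_coeff (Suc k) x q a = of_nat q / of_nat (totient (q div g)) *
           of_real (\<Sum>N\<in>S. w N / real N * poly p (ln (x / real N)))"
    using main_coeff_eq[OF p \<theta> x S(1,2,3), where q = q and a = a] w by (simp add: g_def gcd.commute)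
  have sm: "(\<Sum>n | n \<in> {1..nat \<lfloor>x\<rfloor>} \<and> gcd n q = g. dk (Suc k) n) = (\<Sum>N\<in>S. w N * T (Suc k) (x / real N))"
    using w by (intro sum_gcd_restricted[OF S(1,2,3) _ x]) auto
  have "of_real ((\<Sum>n | n \<in> {1..nat \<lfloor>x\<rfloor>} \<and> gcd n q = g. dk (Suc k) n) / \<phi>) - of_real x * main_coeff (Suc k) x q a / of_nat q
      = complex_of_real ((\<Sum>N\<in>S. w N * (T (Suc k) (x / real N) - x / real N * poly p (ln (x / real N)))) / \<phi>)"
  proof -
    have "(\<Sum>N\<in>S. w N * (x / real N * poly p (ln (x / real N)))) = x * (\<Sum>N\<in>S. w N / real N * poly p (ln (x / real N)))"
      by (simp add: sum_distrib_left mult_ac)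
    then have "(\<Sum>N\<in>S. w N * (T (Suc k) (x / real N) - x / real N * poly p (ln (x / real N))))
        = (\<Sum>N\<in>S. w N * T (Suc k) (x / real N)) - x * (\<Sum>N\<in>S. w N / real N * poly p (ln (x / real N)))"
      by (simp only: right_diff_distrib sum_subtractf)
    then show ?thesis unfolding sm mc \<phi>_def using q by (simp add: diff_divide_distrib)
  qed
  then have "norm (of_real ((\<Sum>n | n \<in> {1..nat \<lfloor>x\<rfloor>} \<and> gcd n q = g. dk (Suc k) n) / \<phi>) - of_real x * main_coeff (Suc k) x q a / of_nat q)
      = \<bar>\<Sum>N\<in>S. w N * (T (Suc k) (x / real N) - x / real N * poly p (ln (x / real N)))\<bar> / \<phi>"
    by (simp only: norm_of_real abs_divide) (simp add: \<phi>_def)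
  also have "\<dots> \<le> (\<Sum>N\<in>S. \<bar>w N\<bar> * (C * (x / real g) powr (1 - 1 / real (Suc k)))) / \<phi>"
  proof (intro divide_right_mono order_trans[OF sum_abs sum_mono])
    fix N assume N: "N \<in> S"
    have Np: "N > 0" "g \<le> N" using S(3,4)[OF N] by (auto intro: dvd_imp_le)
    have "\<bar>T (Suc k) (x / real N) - x / real N * poly p (ln (x / real N))\<bar> \<le> C * (x / real N) powr (1 - 1 / real (Suc k))"
    proof (rule C(2))
      have "x / real N \<le> x / 1" using x Np by (intro divide_left_mono) auto
      then show "x / real N \<le> x" by simp
    qed (use x Np in auto)
    also have "\<dots> \<le> C * (x / real g) powr (1 - 1 / real (Suc k))"
      using C(1) x Np g \<theta> by (intro mult_left_mono powr_mono2 divide_left_mono) auto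
    finally show "\<bar>w N * (T (Suc k) (x / real N) - x / real N * poly p (ln (x / real N)))\<bar> \<le> \<bar>w N\<bar> * (C * (x / real g) powr (1 - 1 / real (Suc k)))"
      unfolding abs_mult[of "w N"] by (rule mult_left_mono) auto
  qed (simp add: \<phi>_def)
  also have "\<dots> = (\<Sum>N\<in>S. \<bar>w N\<bar>) * (C * (x / real g) powr (1 - 1 / real (Suc k))) / \<phi>"
    by (simp only: sum_distrib_right)
  also have "\<dots> \<le> real (tau q) ^ (2 * Suc k) * (C * (x / real g) powr (1 - 1 / real (Suc k))) / \<phi>"
    using S(5) C(1) by (intro divide_right_mono mult_right_mono) (auto simp: \<phi>_def)
  finally show ?thesis by (simp add: g_def \<phi>_def mult.assoc)
qed

lemma sum_by_gcd:
  fixes f :: "nat \<Rightarrow> real"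
  assumes q: "q > 0"
  shows "(\<Sum>a=1..q. f (gcd a q)) = (\<Sum>g | g dvd q. real (totient (q div g)) * f g)"
proof -
  have "(\<Sum>a=1..q. f (gcd a q)) = (\<Sum>g | g dvd q. \<Sum>a\<in>{a \<in> {1..q}. gcd a q = g}. f (gcd a q))"
    using q by (intro sum.group [symmetric]) auto
  also have "\<dots> = (\<Sum>g | g dvd q. real (totient (q div g)) * f g)"
  proof (intro sum.cong refl)
    fix g assume g: "g \<in> {g. g dvd q}"
    have e: "{a \<in> {1..q}. gcd a q = g} = {a \<in> {0<..q}. gcd a q = g}" by auto
    have "(\<Sum>a\<in>{a \<in> {1..q}. gcd a q = g}. f (gcd a q)) = (\<Sum>a\<in>{a \<in> {1..q}. gcd a q = g}. f g)"
      by (rule sum.cong) auto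
    also have "\<dots> = real (card {a \<in> {0<..q}. gcd a q = g}) * f g" unfolding e by simp
    also have "card {a \<in> {0<..q}. gcd a q = g} = totient (q div g)" using card_gcd_eq_totient[OF q] g by simp
    finally show "(\<Sum>a\<in>{a \<in> {1..q}. gcd a q = g}. f (gcd a q)) = real (totient (q div g)) * f g" .
  qed
  finally show ?thesis .
qed

text \<open>In r = sum of totient(d) over d | r each summand is at most totient(r). The resulting
  lower bound r / tau(r) for the totient is crude but loses only x^eps.\<close>

lemma le_tau_mult_totient:
  assumes "r > 0"
  shows "real r \<le> real (tau r) * real (totient r)"
proof -
  have "r = (\<Sum>d | d dvd r. totient d)" by (rule totient_divisor_sum [symmetric])
  also have "\<dots> \<le> (\<Sum>d | d dvd r. totient r)" using assms by (intro sum_mono totient_dvd_mono) auto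
  also have "\<dots> = tau r * totient r" by (simp add: tau_def)
  finally show ?thesis by (metis of_nat_le_iff of_nat_mult)
qed

text \<open>With z = x^(1/(k+1)) both parts of the split stop at Y = x^(1-1/(k+1)): the cofactors in
  \<open>alpha\<close> are at most z^k, and beyond Y no m > z satisfies m M <= x. The factor k + 2
  is 1 for \<open>alpha\<close> plus k + 1 for \<open>beta\<close>.\<close>

lemma hyperbola_instance:
  assumes k: "k \<ge> 1" and x: "x \<ge> 1" and D: "D \<ge> 0"
    and D1: "\<And>M. 0 < M \<Longrightarrow> real M \<le> x \<Longrightarrow> real (k + 2) * dk k M \<le> D"
    and D2: "\<And>n. 0 < n \<Longrightarrow> real n \<le> x \<Longrightarrow> dk (Suc k) n \<le> D"
  defines "z \<equiv> nat \<lfloor>x powr (1 / real (Suc k))\<rfloor>"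
  shows "bounded_hyperbola_split (dk (Suc k)) (alpha z k) (beta z k) (nat \<lfloor>x\<rfloor>) (nat \<lfloor>x powr (1 - 1 / real (Suc k))\<rfloor>) z D"
proof -
  define c where "c = 1 / real (Suc k)"
  define N where "N = nat \<lfloor>x\<rfloor>"
  define Y where "Y = nat \<lfloor>x powr (1 - c)\<rfloor>"
  have c: "0 < c" "c \<le> 1" using k by (auto simp: c_def)
  have zc: "z = nat \<lfloor>x powr c\<rfloor>" by (simp add: z_def c_def)
  have x1: "x powr c \<ge> 1" "x powr (1 - c) \<ge> 1" using x c by (auto intro!: ge_one_powr_ge_zero)
  have xx: "x powr c * x powr (1 - c) = x" using x by (simp add: powr_add[symmetric])
  have YN: "1 \<le> Y" "Y \<le> N"
  proof -
    show "1 \<le> Y" using nat_floor_bounds(3)[OF x1(2)] by (simp add: Y_def)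
    have "x powr (1 - c) \<le> x powr 1" using x c by (intro powr_mono) auto
    then show "Y \<le> N" using x by (simp add: Y_def N_def nat_mono floor_mono)
  qed
  have Nx: "real N \<le> x" using nat_floor_bounds(1)[OF x] by (simp add: N_def)
  have al0: "alpha z k M = 0" if M: "M > Y" for M
  proof (rule ccontr)
    assume "alpha z k M \<noteq> 0"
    then have "M \<le> z ^ k" by (rule alpha_support)
    then have "real M \<le> real z ^ k" by (metis of_nat_le_iff of_nat_power)
    also have "\<dots> \<le> (x powr c) ^ k" using nat_floor_bounds(1)[OF x1(1)] by (intro power_mono) (auto simp: zc)
    also have "\<dots> = x powr (c * real k)" using x by (simp add: powr_realpow[symmetric] powr_powr)
    also have "c * real k = 1 - c" by (simp add: c_def field_simps)
    finally have "M \<le> Y" unfolding Y_def by (simp add: le_nat_iff le_floor_iff)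
    then show False using M by simp
  qed
  have be0: "N div M \<le> z" if M: "M > Y" for M
  proof -
    have Mp: "M > 0" using M by simp
    have "real Y + 1 \<le> real M" using M by simp
    then have "x powr (1 - c) < real M" using nat_floor_bounds(2)[OF x1(2)] unfolding Y_def by linarith
    then have "x powr c * x powr (1 - c) \<le> x powr c * real M" using x1 by (intro mult_left_mono) auto
    then have "x / real M \<le> x powr c" using Mp by (simp add: xx divide_le_eq)
    then have "nat \<lfloor>x / real M\<rfloor> \<le> z" unfolding zc by (intro nat_mono floor_mono)
    then show ?thesis using x by (simp add: N_def nat_floor_div)
  qed
  have split: "(\<Sum>n=1..N. dk (Suc k) n *\<^sub>R \<phi> n) =
     (\<Sum>M=1..Y. alpha z k M *\<^sub>R (\<Sum>m\<in>{0<..min z (N div M)}. \<phi> (m * M)) + beta z k M *\<^sub>R (\<Sum>m\<in>{z<..N div M}. \<phi> (m * M)))" for \<phi> :: "nat \<Rightarrow> complex"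
  proof -
    let ?u = "\<lambda>m::nat. if m \<le> z then 1 else 0 :: real"
    let ?v = "\<lambda>m::nat. if m > z then 1 else 0 :: real"
    have u: "(\<Sum>a=1..L. ?u a *\<^sub>R \<phi> (a * M)) = (\<Sum>m\<in>{0<..min z L}. \<phi> (m * M))" for L M
      by (rule sum.mono_neutral_cong_right) auto
    have v: "(\<Sum>a=1..L. ?v a *\<^sub>R \<phi> (a * M)) = (\<Sum>m\<in>{z<..L}. \<phi> (m * M))" for L M
      by (rule sum.mono_neutral_cong_right) auto
    have "(\<Sum>n=1..N. dk (Suc k) n *\<^sub>R \<phi> n) = (\<Sum>n=1..N. dconv ?u (alpha z k) n *\<^sub>R \<phi> n) + (\<Sum>n=1..N. dconv ?v (beta z k) n *\<^sub>R \<phi> n)"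
      unfolding dk_split[of k _ z] scaleR_left_distrib sum.distrib ..
    also have "\<dots> = (\<Sum>M=1..N. alpha z k M *\<^sub>R (\<Sum>m\<in>{0<..min z (N div M)}. \<phi> (m * M)) + beta z k M *\<^sub>R (\<Sum>m\<in>{z<..N div M}. \<phi> (m * M)))"
      unfolding sum_dconv u v sum.distrib ..
    also have "\<dots> = (\<Sum>M=1..Y. alpha z k M *\<^sub>R (\<Sum>m\<in>{0<..min z (N div M)}. \<phi> (m * M)) + beta z k M *\<^sub>R (\<Sum>m\<in>{z<..N div M}. \<phi> (m * M)))"
      using YN al0 be0 by (intro sum.mono_neutral_right) auto
    finally show ?thesis .
  qed
  have "bounded_hyperbola_split (dk (Suc k)) (alpha z k) (beta z k) N Y z D"
  proof unfold_locales
    fix M assume M: "M \<in> {1..Y}"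
    have "alpha z k M + beta z k M \<le> dk k M + real (Suc k) * dk k M" by (intro add_mono alpha_le beta_le)
    also have "\<dots> = real (k + 2) * dk k M" by (simp add: algebra_simps)
    also have "\<dots> \<le> D"
    proof (rule D1)
      have "real M \<le> real N" using M YN by simp
      then show "real M \<le> x" using Nx by linarith
    qed (use M in simp)
    finally show "alpha z k M + beta z k M \<le> D" .
  next
    fix n assume n: "n \<in> {1..N}"
    then have "real n \<le> real N" by simp
    then have "real n \<le> x" using Nx by linarith
    then show "\<bar>dk (Suc k) n\<bar> \<le> D" using D2[of n] n by simp
  qed (use split alpha_nonneg beta_nonneg D YN in auto)
  then show ?thesis by (simp only: N_def Y_def c_def)
qed

section \<open>The variance bound\<close>

text \<open>The totient(q / g) members of a gcd class turn the squared denominator into a single 1 /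
  totient(q / g), at most B g / q. Since 2 theta >= 1, the power (x / g)^(2 theta) is at most x^(2
  theta) / g and cancels this g. Each q thus costs tau(q) B x^(2 theta) / q.\<close>

lemma sum_principal_squares:
  assumes x: "x \<ge> 1" and \<theta>: "1 / 2 \<le> \<theta>" and Q: "1 \<le> Q" "real Q \<le> x" and K: "K \<ge> 0"
    and B: "B \<ge> 0" "\<And>n. 0 < n \<Longrightarrow> real n \<le> x \<Longrightarrow> real (tau n) \<le> B"
  shows "(\<Sum>q=1..Q. \<Sum>a=1..q. (K * (x / real (gcd a q)) powr \<theta> / real (totient (q div gcd a q)))\<^sup>2)
           \<le> K\<^sup>2 * B\<^sup>2 * x powr (2 * \<theta>) * (1 + ln (real Q))"
proof -
  have inner: "(\<Sum>a=1..q. (K * (x / real (gcd a q)) powr \<theta> / real (totient (q div gcd a q)))\<^sup>2)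
      \<le> K\<^sup>2 * B\<^sup>2 * x powr (2 * \<theta>) * (1 / real q)" if q: "q \<in> {1..Q}" for q
  proof -
    have qp: "q > 0" "real q \<le> x" using q Q by auto
    have "(\<Sum>a=1..q. (K * (x / real (gcd a q)) powr \<theta> / real (totient (q div gcd a q)))\<^sup>2)
        = (\<Sum>g | g dvd q. real (totient (q div g)) * (K * (x / real g) powr \<theta> / real (totient (q div g)))\<^sup>2)"
      by (rule sum_by_gcd[OF qp(1)])
    also have "\<dots> \<le> (\<Sum>g | g dvd q. K\<^sup>2 * B * x powr (2 * \<theta>) * (1 / real q))"
    proof (rule sum_mono)
      fix g assume "g \<in> {g. g dvd q}"
      then have g: "g dvd q" by simp
      define r where "r = q div g"
      have gr: "q = g * r" "g > 0" "r > 0" using g qp(1) by (auto simp: r_def intro!: Nat.gr0I)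
      have "r dvd q" using gr by simp
      then have "r \<le> q" using qp(1) by (rule dvd_imp_le)
      then have rx: "real r \<le> x" using qp(2) by linarith
      have \<phi>: "real (totient r) > 0" using gr by simp
      have "real r \<le> real (tau r) * real (totient r)" by (rule le_tau_mult_totient[OF gr(3)])
      also have "\<dots> \<le> B * real (totient r)" using B(2)[OF gr(3) rx] by (intro mult_right_mono) auto
      finally have inv: "1 / real (totient r) \<le> B / real r" using \<phi> gr by (simp add: field_simps)
      have "((x / real g) powr \<theta>)\<^sup>2 = (x / real g) powr (2 * \<theta>)"
        using x gr by (simp add: powr_realpow[symmetric] powr_powr mult.commute)
      also have "\<dots> = x powr (2 * \<theta>) / real g powr (2 * \<theta>)" using x by (simp add: powr_divide)
      also have "\<dots> \<le> x powr (2 * \<theta>) / real g"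
      proof (rule divide_left_mono)
        have "real g powr 1 \<le> real g powr (2 * \<theta>)" using gr \<theta> by (intro powr_mono) auto
        then show "real g \<le> real g powr (2 * \<theta>)" by simp
      qed (use gr in auto)
      finally have pw: "((x / real g) powr \<theta>)\<^sup>2 \<le> x powr (2 * \<theta>) / real g" .
      have "real (totient r) * (K * (x / real g) powr \<theta> / real (totient r))\<^sup>2 = K\<^sup>2 * (((x / real g) powr \<theta>)\<^sup>2 * (1 / real (totient r)))"
        using \<phi> by (simp add: power2_eq_square field_simps)
      also have "\<dots> \<le> K\<^sup>2 * ((x powr (2 * \<theta>) / real g) * (B / real r))"
        using pw inv by (intro mult_left_mono mult_mono) auto
      also have "\<dots> = K\<^sup>2 * B * x powr (2 * \<theta>) * (1 / real q)" by (simp add: gr)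
      finally show "real (totient (q div g)) * (K * (x / real g) powr \<theta> / real (totient (q div g)))\<^sup>2 \<le> K\<^sup>2 * B * x powr (2 * \<theta>) * (1 / real q)"
        by (simp add: r_def)
    qed
    also have "\<dots> = real (tau q) * (K\<^sup>2 * B * x powr (2 * \<theta>) * (1 / real q))" by (simp add: tau_def)
    also have "\<dots> \<le> B * (K\<^sup>2 * B * x powr (2 * \<theta>) * (1 / real q))"
      using B qp by (intro mult_right_mono) auto
    finally show ?thesis by (simp add: power2_eq_square mult_ac)
  qed
  have "(\<Sum>q=1..Q. \<Sum>a=1..q. (K * (x / real (gcd a q)) powr \<theta> / real (totient (q div gcd a q)))\<^sup>2)
      \<le> (\<Sum>q=1..Q. K\<^sup>2 * B\<^sup>2 * x powr (2 * \<theta>) * (1 / real q))" by (intro sum_mono inner)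
  also have "\<dots> = K\<^sup>2 * B\<^sup>2 * x powr (2 * \<theta>) * (\<Sum>q=1..Q. 1 / real q)" by (rule sum_distrib_left [symmetric])
  also have "\<dots> \<le> K\<^sup>2 * B\<^sup>2 * x powr (2 * \<theta>) * (1 + ln (real Q))"
    by (intro mult_left_mono sum_inverse_le_ln Q) auto
  finally show ?thesis .
qed

lemma set_upto_real: "{n::nat. 1 \<le> n \<and> real n \<le> y} = {1..nat \<lfloor>y\<rfloor>}"
  by (auto simp: le_nat_iff le_floor_iff) linarith

text \<open>The bound is left in unsimplified form, because the two cases of the final estimate
  simplify it in different ways.\<close>

theorem variance_bound:
  assumes k: "k \<ge> 1" and \<epsilon>: "\<epsilon> > 0"
  shows "\<exists>C\<ge>0. \<forall>x Q. 1 \<le> Q \<and> Q \<le> x \<longrightarrow> AP_variance (Suc k) x Q \<le> C * x powr \<epsilon> *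
    (real (min (nat \<lfloor>x powr (1 / real (Suc k))\<rfloor>) (nat \<lfloor>Q\<rfloor>)) * (real (nat \<lfloor>x powr (1 - 1 / real (Suc k))\<rfloor>))\<^sup>2
     + (if nat \<lfloor>x powr (1 / real (Suc k))\<rfloor> < nat \<lfloor>Q\<rfloor>
        then (real (nat \<lfloor>x\<rfloor>))\<^sup>2 / (real (nat \<lfloor>x powr (1 / real (Suc k))\<rfloor>) + 1) + real (nat \<lfloor>x\<rfloor>) * real (nat \<lfloor>Q\<rfloor>) else 0)
     + x powr (2 * (1 - 1 / real (Suc k))))"
proof -
  define \<theta> where "\<theta> = 1 - 1 / real (Suc k)"
  have \<theta>: "1 / 2 \<le> \<theta>" using k by (simp add: \<theta>_def field_simps)
  \<comment> \<open>Seven factors x^d are spent on the comparison with the residues: four in K^2,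
    two in the squared bound for tau, one for the logarithm. The variance around the averages needs
    five, two from D^2 and three logarithms.\<close>
  define d where "d = \<epsilon> / 7"
  have d: "d > 0" using \<epsilon> by (simp add: d_def)
  \<comment> \<open>The power of tau(q) in the mass of the weights. Bounding tau with the exponent d
    / K2 makes this whole power cost a single x^d.\<close>
  define K2 where "K2 = 2 * Suc k"
  have K2p: "K2 \<noteq> 0" by (simp add: K2_def)
  have d': "d / real K2 > 0" using d by (simp add: K2_def)
  obtain Ca where Ca: "Ca \<ge> 1" "\<And>n. n > 0 \<Longrightarrow> dk k n \<le> Ca * real n powr d" using dk_bound[OF d] by blast
  obtain Cb where Cb: "Cb \<ge> 1" "\<And>n. n > 0 \<Longrightarrow> dk (Suc k) n \<le> Cb * real n powr d" using dk_bound[OF d] by blast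
  obtain Ct where Ct: "Ct \<ge> 1" "\<And>n. n > 0 \<Longrightarrow> real (tau n) \<le> Ct * real n powr (d / real K2)" using tau_bound[OF d'] by blast
  have "pb 0 (\<lambda>y. 1 + ln y)" by (intro pb_add pb_const pb_ln)
  then obtain CL where CL: "CL \<ge> 0" "\<And>y. y \<ge> 1 \<Longrightarrow> \<bar>1 + ln y\<bar> \<le> CL * y powr (0 + d)" using pbE[OF _ d] by blast
  obtain p where p: "pb (1 - 1 / real (Suc k)) (\<lambda>y. T (Suc k) y - y * poly p (ln y))" using piltz_divisor_asymp by blast
  obtain Cp where Cp: "Cp \<ge> 0" "\<And>x y. 1 \<le> x \<Longrightarrow> 0 < y \<Longrightarrow> y \<le> x \<Longrightarrow>
     \<bar>T (Suc k) y - y * poly p (ln y)\<bar> \<le> Cp * (y powr (1 - 1 / real (Suc k)) * x powr d)"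
    using piltz_divisor_asymp_uniform[OF p _ d] by auto
  define Cd where "Cd = real (k + 2) * Ca + Cb"
  have Cd: "Cd \<ge> 0" using Ca Cb by (simp add: Cd_def)
  define C where "C = 2 * (20 * Cd\<^sup>2 * CL ^ 3) + 2 * ((Ct ^ K2 * Cp)\<^sup>2 * Ct\<^sup>2 * CL)"
  have C0: "C \<ge> 0" using CL(1) by (simp add: C_def)
  show ?thesis
  proof (intro exI[of _ C] conjI C0 allI impI)
    fix x Q :: real assume xQ: "1 \<le> Q \<and> Q \<le> x"
    define N where "N = nat \<lfloor>x\<rfloor>"
    define R where "R = nat \<lfloor>x powr (1 / real (Suc k))\<rfloor>"
    define Y where "Y = nat \<lfloor>x powr (1 - 1 / real (Suc k))\<rfloor>"
    define Qn where "Qn = nat \<lfloor>Q\<rfloor>"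
    define t where "t = x powr d"
    define D where "D = Cd * t"
    have x: "x \<ge> 1" and Q: "Q \<ge> 1" using xQ by auto
    have t1: "t \<ge> 1" unfolding t_def using x d by (intro ge_one_powr_ge_zero) auto
    have tle: "real n powr d \<le> t" if "real n \<le> x" for n unfolding t_def using that d by (intro powr_mono2) auto
    have QN: "1 \<le> Qn" "Qn \<le> N" using nat_floor_bounds(3)[OF Q] xQ by (auto simp: Qn_def N_def nat_mono floor_mono)
    have Nx: "1 \<le> N" "real N \<le> x" using nat_floor_bounds(1,3)[OF x] by (auto simp: N_def)
    have D0: "D \<ge> 0" using Cd t1 by (simp add: D_def)
    have L: "1 + ln (real n) \<le> CL * t" "0 \<le> 1 + ln (real n)" if "1 \<le> n" "real n \<le> x" for n
    proof -
      have "1 + ln (real n) \<le> CL * real n powr d" using CL(2)[of "real n"] that by simp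
      also have "\<dots> \<le> CL * t" using CL(1) tle[OF that(2)] by (intro mult_left_mono) auto
      finally show "1 + ln (real n) \<le> CL * t" .
      show "0 \<le> 1 + ln (real n)" using that by simp
    qed
    interpret bounded_hyperbola_split "dk (Suc k)" "alpha R k" "beta R k" N Y R D
      unfolding N_def Y_def R_def
    proof (rule hyperbola_instance[OF k x D0])
      fix M :: nat assume M: "0 < M" "real M \<le> x"
      have "real (k + 2) * dk k M \<le> real (k + 2) * (Ca * t)"
        using Ca(1) tle[OF M(2)] by (intro mult_left_mono order_trans[OF Ca(2)[OF M(1)]]) auto
      also have "\<dots> = real (k + 2) * Ca * t" by simp
      also have "\<dots> \<le> D" unfolding D_def Cd_def using Cb t1 by (intro mult_right_mono) auto
      finally show "real (k + 2) * dk k M \<le> D" .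
    next
      fix n :: nat assume n: "0 < n" "real n \<le> x"
      have "dk (Suc k) n \<le> Cb * t"
        using Cb(1) tle[OF n(2)] by (intro order_trans[OF Cb(2)[OF n(1)]] mult_left_mono) auto
      also have "\<dots> \<le> D" unfolding D_def Cd_def using Ca t1 by (intro mult_right_mono) auto
      finally show "dk (Suc k) n \<le> D" .
    qed
    \<comment> \<open>Holds because 1 / (k + 1) <= 1/2, the number of factors being at least
      2.\<close>
    have RY: "R \<le> Y"
      unfolding R_def Y_def using x \<theta> by (intro nat_mono floor_mono powr_mono) (auto simp: \<theta>_def)
    define Z where "Z = real (min R Qn) * (real Y)\<^sup>2 + (if R < Qn then (real N)\<^sup>2 / (real R + 1) + real N * real Qn else 0)"
    have Z0: "Z \<ge> 0" by (simp add: Z_def)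
    have V1: "(\<Sum>q=1..Qn. \<Sum>a=1..q. (A q a - avg q a)\<^sup>2) \<le> 20 * Cd\<^sup>2 * CL ^ 3 * t ^ 7 * Z"
    proof -
      have "(\<Sum>q=1..Qn. \<Sum>a=1..q. (A q a - avg q a)\<^sup>2) \<le> D\<^sup>2 * (1 + ln (real N)) ^ 3 *
         (16 * real (min R Qn) * (real Y)\<^sup>2 + (if R < Qn then 20 * (real N)\<^sup>2 / (real R + 1) + 16 * real N * real Qn else 0))"
        by (rule variance_le[OF QN RY])
      also have "\<dots> \<le> D\<^sup>2 * (CL * t) ^ 3 * (20 * Z)"
      proof (intro mult_mono mult_left_mono power_mono L Nx)
        have "16 * real (min R Qn) * (real Y)\<^sup>2 \<le> 20 * (real (min R Qn) * (real Y)\<^sup>2)" by simp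
        moreover have "(if R < Qn then 20 * (real N)\<^sup>2 / (real R + 1) + 16 * real N * real Qn else 0)
            \<le> 20 * (if R < Qn then (real N)\<^sup>2 / (real R + 1) + real N * real Qn else 0)" by simp
        ultimately show "16 * real (min R Qn) * (real Y)\<^sup>2 + (if R < Qn then 20 * (real N)\<^sup>2 / (real R + 1) + 16 * real N * real Qn else 0) \<le> 20 * Z"
          unfolding Z_def distrib_left by (rule add_mono)
      qed (use CL(1) t1 D0 L(2)[OF Nx] in auto)
      also have "\<dots> = 20 * Cd\<^sup>2 * CL ^ 3 * t ^ 5 * Z"
        by (simp add: D_def power_mult_distrib eval_nat_numeral mult_ac)
      also have "\<dots> \<le> 20 * Cd\<^sup>2 * CL ^ 3 * t ^ 7 * Z"
        using t1 CL(1) Z0 by (intro mult_right_mono mult_left_mono power_increasing) auto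
      finally show ?thesis .
    qed
    have tauB: "real (tau n) \<le> Ct * t" "real (tau n) ^ K2 \<le> Ct ^ K2 * t" if n: "0 < n" "real n \<le> x" for n
    proof -
      have "real n powr (d / real K2) \<le> real n powr d"
        using n d by (intro powr_mono) (auto simp: K2_def divide_le_eq mult_le_cancel_left1)
      then have "Ct * real n powr (d / real K2) \<le> Ct * t" using Ct(1) tle[OF n(2)] by (intro mult_left_mono) auto
      then show "real (tau n) \<le> Ct * t" using Ct(2)[OF n(1)] by linarith
      have "real (tau n) ^ K2 \<le> (Ct * real n powr (d / real K2)) ^ K2" by (intro power_mono Ct(2) n) auto
      also have "\<dots> = Ct ^ K2 * real n powr d"
        using n by (simp add: power_mult_distrib powr_realpow[symmetric] powr_powr K2p)
      also have "\<dots> \<le> Ct ^ K2 * t" using Ct(1) tle[OF n(2)] by (intro mult_left_mono) auto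
      finally show "real (tau n) ^ K2 \<le> Ct ^ K2 * t" .
    qed
    define E where "E = (\<lambda>q a. norm (complex_of_real (avg q a) - of_real x * main_coeff (Suc k) x q a / of_nat q))"
    define K where "K = (Ct ^ K2 * t) * (Cp * t)"
    have K0: "K \<ge> 0" using Ct(1) t1 Cp(1) by (simp add: K_def)
    have E_le: "E q a \<le> K * (x / real (gcd a q)) powr \<theta> / real (totient (q div gcd a q))" if q: "q \<in> {1..Qn}" for q a
    proof -
      have qp: "q > 0" "real q \<le> x" using q QN Nx by auto
      have "E q a \<le> real (tau q) ^ (2 * Suc k) * (Cp * t) * (x / real (gcd a q)) powr (1 - 1 / real (Suc k)) / real (totient (q div gcd a q))"
        unfolding E_def avg_def unfolding N_def
      proof (rule principal_part_bound[OF p x qp(1)])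
        fix y assume "0 < y" "y \<le> x"
        then show "\<bar>T (Suc k) y - y * poly p (ln y)\<bar> \<le> Cp * t * y powr (1 - 1 / real (Suc k))"
          using Cp(2)[OF x, of y] by (simp add: t_def mult_ac)
      qed (use Cp(1) t1 in auto)
      also have "\<dots> \<le> K * (x / real (gcd a q)) powr \<theta> / real (totient (q div gcd a q))"
        unfolding K_def \<theta>_def K2_def[symmetric] using tauB(2)[OF qp] Cp(1) t1
        by (intro divide_right_mono mult_right_mono) auto
      finally show ?thesis .
    qed
    have V2: "(\<Sum>q=1..Qn. \<Sum>a=1..q. (E q a)\<^sup>2) \<le> (Ct ^ K2 * Cp)\<^sup>2 * Ct\<^sup>2 * CL * t ^ 7 * x powr (2 * \<theta>)"
    proof -
      have Qx: "real Qn \<le> x" using QN Nx by linarith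
      have "(\<Sum>q=1..Qn. \<Sum>a=1..q. (E q a)\<^sup>2) \<le> (\<Sum>q=1..Qn. \<Sum>a=1..q. (K * (x / real (gcd a q)) powr \<theta> / real (totient (q div gcd a q)))\<^sup>2)"
        by (intro sum_mono power_mono E_le) (auto simp: E_def)
      also have "\<dots> \<le> K\<^sup>2 * (Ct * t)\<^sup>2 * x powr (2 * \<theta>) * (1 + ln (real Qn))"
        using Ct(1) t1 by (intro sum_principal_squares x \<theta> QN Qx K0 tauB) auto
      also have "\<dots> \<le> K\<^sup>2 * (Ct * t)\<^sup>2 * x powr (2 * \<theta>) * (CL * t)"
        by (intro mult_left_mono L QN Qx) auto
      also have "\<dots> = (Ct ^ K2 * Cp)\<^sup>2 * Ct\<^sup>2 * CL * t ^ 7 * x powr (2 * \<theta>)"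
        by (simp add: K_def power_mult_distrib eval_nat_numeral mult_ac)
      finally show ?thesis .
    qed
    have err: "(norm (AP_error (Suc k) x q a))\<^sup>2 \<le> 2 * (A q a - avg q a)\<^sup>2 + 2 * (E q a)\<^sup>2" for q a
    proof -
      have "{n::nat. 1 \<le> n \<and> real n \<le> x \<and> [n = a] (mod q)} = {n. n \<in> {n. 1 \<le> n \<and> real n \<le> x} \<and> [n = a] (mod q)}"
        by simp
      then have "{n::nat. 1 \<le> n \<and> real n \<le> x \<and> [n = a] (mod q)} = {n. n \<in> {1..N} \<and> [n = a] (mod q)}"
        unfolding set_upto_real N_def .
      then have "AP_error (Suc k) x q a = of_real (A q a) - of_real x * main_coeff (Suc k) x q a / of_nat q"
        unfolding AP_error_def A_def by simp
      also have "\<dots> = of_real (A q a - avg q a) + (of_real (avg q a) - of_real x * main_coeff (Suc k) x q a / of_nat q)" by simp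
      finally have eq: "AP_error (Suc k) x q a = of_real (A q a - avg q a) + (of_real (avg q a) - of_real x * main_coeff (Suc k) x q a / of_nat q)" .
      have "norm (AP_error (Suc k) x q a) \<le> norm (complex_of_real (A q a - avg q a)) + E q a"
        unfolding E_def eq by (rule norm_triangle_ineq)
      then have "(norm (AP_error (Suc k) x q a))\<^sup>2 \<le> (\<bar>A q a - avg q a\<bar> + E q a)\<^sup>2"
        unfolding norm_of_real by (intro power_mono) auto
      also have "\<dots> \<le> 2 * (A q a - avg q a)\<^sup>2 + 2 * (E q a)\<^sup>2"
        using sum_squares_bound[of "\<bar>A q a - avg q a\<bar>" "E q a"] by (simp add: power2_sum)
      finally show ?thesis .
    qed
    have "AP_variance (Suc k) x Q = (\<Sum>q=1..Qn. \<Sum>a=1..q. (norm (AP_error (Suc k) x q a))\<^sup>2)"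
      unfolding AP_variance_def set_upto_real Qn_def ..
    also have "\<dots> \<le> (\<Sum>q=1..Qn. \<Sum>a=1..q. 2 * (A q a - avg q a)\<^sup>2 + 2 * (E q a)\<^sup>2)"
      by (intro sum_mono err)
    also have "\<dots> = 2 * (\<Sum>q=1..Qn. \<Sum>a=1..q. (A q a - avg q a)\<^sup>2) + 2 * (\<Sum>q=1..Qn. \<Sum>a=1..q. (E q a)\<^sup>2)"
      by (simp add: sum.distrib sum_distrib_left)
    also have "\<dots> \<le> 2 * (20 * Cd\<^sup>2 * CL ^ 3 * t ^ 7 * Z) + 2 * ((Ct ^ K2 * Cp)\<^sup>2 * Ct\<^sup>2 * CL * t ^ 7 * x powr (2 * \<theta>))"
      using V1 V2 by (intro add_mono mult_left_mono) auto
    also have "\<dots> = (2 * (20 * Cd\<^sup>2 * CL ^ 3)) * (t ^ 7 * Z) + (2 * ((Ct ^ K2 * Cp)\<^sup>2 * Ct\<^sup>2 * CL)) * (t ^ 7 * x powr (2 * \<theta>))"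
      by simp
    also have "\<dots> \<le> C * (t ^ 7 * Z) + C * (t ^ 7 * x powr (2 * \<theta>))"
      using CL(1) t1 Z0 by (intro add_mono mult_right_mono) (auto simp: C_def)
    also have "\<dots> = C * t ^ 7 * (Z + x powr (2 * \<theta>))" by (simp add: algebra_simps)
    also have "t ^ 7 = x powr \<epsilon>"
      using x by (simp add: t_def powr_realpow[symmetric] powr_powr d_def)
    finally show "AP_variance (Suc k) x Q \<le> C * x powr \<epsilon> *
      (real (min (nat \<lfloor>x powr (1 / real (Suc k))\<rfloor>) (nat \<lfloor>Q\<rfloor>)) * (real (nat \<lfloor>x powr (1 - 1 / real (Suc k))\<rfloor>))\<^sup>2
       + (if nat \<lfloor>x powr (1 / real (Suc k))\<rfloor> < nat \<lfloor>Q\<rfloor>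
          then (real (nat \<lfloor>x\<rfloor>))\<^sup>2 / (real (nat \<lfloor>x powr (1 / real (Suc k))\<rfloor>) + 1) + real (nat \<lfloor>x\<rfloor>) * real (nat \<lfloor>Q\<rfloor>) else 0)
       + x powr (2 * (1 - 1 / real (Suc k))))"
      by (simp only: Z_def \<theta>_def R_def Qn_def N_def Y_def)
  qed
qed

theorem theorem2:
  fixes k :: nat
  assumes "k \<ge> 2"
  shows "(k > 2 \<longrightarrow> (\<forall>\<epsilon>::real. \<epsilon> > 0 \<longrightarrow> (\<exists>C::real. \<forall>x Q::real. 1 \<le> Q \<and> Q \<le> x \<longrightarrow>
            AP_variance k x Q \<le> C * (x powr \<epsilon> * (x * Q + x powr (2 - 1 / real k)))))) \<and>
         (k = 2 \<longrightarrow> (\<forall>\<epsilon>::real. \<epsilon> > 0 \<longrightarrow> (\<exists>C::real. \<forall>x Q::real. 1 \<le> Q \<and> Q \<le> x \<longrightarrow>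
            AP_variance k x Q \<le> C * (x powr \<epsilon> * (x * Q)))))"
proof -
  obtain k' where k': "k = Suc k'" "k' \<ge> 1" using assms by (cases k) auto
  define c where "c = 1 / real k"
  have c: "0 < c" "c \<le> 1 / 2" using assms by (auto simp: c_def field_simps)
  define Z where "Z = (\<lambda>x Q :: real. real (min (nat \<lfloor>x powr c\<rfloor>) (nat \<lfloor>Q\<rfloor>)) * (real (nat \<lfloor>x powr (1 - c)\<rfloor>))\<^sup>2
     + (if nat \<lfloor>x powr c\<rfloor> < nat \<lfloor>Q\<rfloor> then (real (nat \<lfloor>x\<rfloor>))\<^sup>2 / (real (nat \<lfloor>x powr c\<rfloor>) + 1) + real (nat \<lfloor>x\<rfloor>) * real (nat \<lfloor>Q\<rfloor>) else 0)
     + x powr (2 * (1 - c)))"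
  have main: "\<exists>C\<ge>0. \<forall>x Q. 1 \<le> Q \<and> Q \<le> x \<longrightarrow> AP_variance k x Q \<le> C * x powr \<epsilon> * Z x Q" if "\<epsilon> > 0" for \<epsilon>
    using variance_bound[OF k'(2) that] by (simp only: Z_def c_def k'(1))
  have facts: "real (nat \<lfloor>x powr c\<rfloor>) \<le> x powr c" "x powr c \<le> real (nat \<lfloor>x powr c\<rfloor>) + 1"
      "(real (nat \<lfloor>x powr (1 - c)\<rfloor>))\<^sup>2 \<le> x powr (2 * (1 - c))" "real (nat \<lfloor>Q\<rfloor>) \<le> Q"
      "(real (nat \<lfloor>x\<rfloor>))\<^sup>2 / (real (nat \<lfloor>x powr c\<rfloor>) + 1) \<le> x powr (2 - c)" "real (nat \<lfloor>x\<rfloor>) * real (nat \<lfloor>Q\<rfloor>) \<le> x * Q"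
    if xQ: "1 \<le> Q" "Q \<le> x" for x Q :: real
  proof -
    have x: "x \<ge> 1" using xQ by simp
    have x1: "x powr c \<ge> 1" "x powr (1 - c) \<ge> 1" using x c by (auto intro!: ge_one_powr_ge_zero)
    show 1: "real (nat \<lfloor>x powr c\<rfloor>) \<le> x powr c" and 2: "x powr c \<le> real (nat \<lfloor>x powr c\<rfloor>) + 1"
      using nat_floor_bounds(1,2)[OF x1(1)] by linarith+
    show "(real (nat \<lfloor>x powr (1 - c)\<rfloor>))\<^sup>2 \<le> x powr (2 * (1 - c))"
    proof -
      have "(real (nat \<lfloor>x powr (1 - c)\<rfloor>))\<^sup>2 \<le> (x powr (1 - c))\<^sup>2"
        by (intro power_mono nat_floor_bounds(1)[OF x1(2)]) auto
      also have "\<dots> = x powr (2 * (1 - c))" using x by (simp add: powr_realpow[symmetric] powr_powr mult.commute)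
      finally show ?thesis .
    qed
    show 3: "real (nat \<lfloor>Q\<rfloor>) \<le> Q" by (rule nat_floor_bounds(1)[OF xQ(1)])
    have 4: "real (nat \<lfloor>x\<rfloor>) \<le> x" by (rule nat_floor_bounds(1)[OF x])
    have "(real (nat \<lfloor>x\<rfloor>))\<^sup>2 / (real (nat \<lfloor>x powr c\<rfloor>) + 1) \<le> x\<^sup>2 / x powr c"
      using 2 4 x1 by (intro frac_le power_mono) auto
    also have "\<dots> = x powr (2 - c)" using x by (simp add: powr_diff powr_numeral)
    finally show "(real (nat \<lfloor>x\<rfloor>))\<^sup>2 / (real (nat \<lfloor>x powr c\<rfloor>) + 1) \<le> x powr (2 - c)" .
    show "real (nat \<lfloor>x\<rfloor>) * real (nat \<lfloor>Q\<rfloor>) \<le> x * Q"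
      using 3 4 x by (intro mult_mono) auto
  qed
  \<comment> \<open>R Y^2 and N^2 / R are both at most x^(2-c), and x^(2-2c) is smaller
    still.\<close>
  have gen: "Z x Q \<le> 3 * (x * Q + x powr (2 - c))" if xQ: "1 \<le> Q" "Q \<le> x" for x Q
  proof -
    note f = facts[OF xQ]
    have x: "x \<ge> 1" using xQ by simp
    have "real (min (nat \<lfloor>x powr c\<rfloor>) (nat \<lfloor>Q\<rfloor>)) * (real (nat \<lfloor>x powr (1 - c)\<rfloor>))\<^sup>2 \<le> x powr c * x powr (2 * (1 - c))"
      by (rule mult_mono[OF order_trans[OF of_nat_mono[OF min.cobounded1] f(1)] f(3)]) auto
    also have "\<dots> = x powr (2 - c)" by (simp add: powr_add[symmetric] algebra_simps)
    finally have 1: "real (min (nat \<lfloor>x powr c\<rfloor>) (nat \<lfloor>Q\<rfloor>)) * (real (nat \<lfloor>x powr (1 - c)\<rfloor>))\<^sup>2 \<le> x powr (2 - c)" .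
    have 2: "x powr (2 * (1 - c)) \<le> x powr (2 - c)" using x c by (intro powr_mono) auto
    have 3: "(if nat \<lfloor>x powr c\<rfloor> < nat \<lfloor>Q\<rfloor> then (real (nat \<lfloor>x\<rfloor>))\<^sup>2 / (real (nat \<lfloor>x powr c\<rfloor>) + 1) + real (nat \<lfloor>x\<rfloor>) * real (nat \<lfloor>Q\<rfloor>) else 0)
        \<le> x powr (2 - c) + x * Q" using f(5,6) x xQ by auto
    have "Z x Q \<le> x powr (2 - c) + (x powr (2 - c) + x * Q) + x powr (2 - c)"
      unfolding Z_def by (intro add_mono 1 2 3)
    also have "\<dots> \<le> 3 * (x * Q + x powr (2 - c))" using x xQ by simp
    finally show ?thesis .
  qed
  \<comment> \<open>Here Y^2 <= x, and bounding the minimum by Q gives Q x. The term x^(3/2) occurs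
    only if floor(sqrt x) < floor(Q), and then sqrt x <= Q turns it into x Q.\<close>
  have two: "Z x Q \<le> 4 * (x * Q)" if xQ: "1 \<le> Q" "Q \<le> x" and k2: "k = 2" for x Q
  proof -
    note f = facts[OF xQ]
    have x: "x \<ge> 1" using xQ by simp
    have ch: "c = 1 / 2" by (simp add: c_def k2)
    have e: "x powr (2 * (1 - c)) = x" using x by (simp add: ch)
    have "real (min (nat \<lfloor>x powr c\<rfloor>) (nat \<lfloor>Q\<rfloor>)) * (real (nat \<lfloor>x powr (1 - c)\<rfloor>))\<^sup>2 \<le> Q * x"
      using xQ by (intro mult_mono[OF order_trans[OF of_nat_mono[OF min.cobounded2] f(4)] f(3)[unfolded e]]) auto
    moreover have "(if nat \<lfloor>x powr c\<rfloor> < nat \<lfloor>Q\<rfloor> then (real (nat \<lfloor>x\<rfloor>))\<^sup>2 / (real (nat \<lfloor>x powr c\<rfloor>) + 1) + real (nat \<lfloor>x\<rfloor>) * real (nat \<lfloor>Q\<rfloor>) else 0)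
        \<le> 2 * (x * Q)"
    proof (cases "nat \<lfloor>x powr c\<rfloor> < nat \<lfloor>Q\<rfloor>")
      case True
      then have "real (nat \<lfloor>x powr c\<rfloor>) + 1 \<le> real (nat \<lfloor>Q\<rfloor>)" by linarith
      then have "x powr c \<le> Q" using f(2,4) by linarith
      then have "x * x powr c \<le> x * Q" using x by (intro mult_left_mono) auto
      moreover have "x * x powr c = x powr (2 - c)"
      proof -
        have "x * x powr c = x powr (1 + c)" using x by (simp add: powr_add)
        then show ?thesis by (simp add: ch)
      qed
      ultimately show ?thesis using f(5,6) True by simp
    next
      case False
      then show ?thesis using x xQ by simp
    qed
    moreover have "x \<le> x * Q" using mult_left_mono[of 1 Q x] x xQ by simp
    ultimately show ?thesis unfolding Z_def e by (simp add: mult.commute)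
  qed
  have "\<exists>C. \<forall>x Q. 1 \<le> Q \<and> Q \<le> x \<longrightarrow> AP_variance k x Q \<le> C * (x powr \<epsilon> * (x * Q + x powr (2 - 1 / real k)))" if e: "\<epsilon> > 0" for \<epsilon>
  proof -
    obtain C where C: "C \<ge> 0" "\<And>x Q. 1 \<le> Q \<Longrightarrow> Q \<le> x \<Longrightarrow> AP_variance k x Q \<le> C * x powr \<epsilon> * Z x Q" using main[OF e] by blast
    have "AP_variance k x Q \<le> (C * 3) * (x powr \<epsilon> * (x * Q + x powr (2 - 1 / real k)))" if "1 \<le> Q" "Q \<le> x" for x Q
    proof -
      have "C * x powr \<epsilon> * Z x Q \<le> C * x powr \<epsilon> * (3 * (x * Q + x powr (2 - c)))"
        using C(1) by (intro mult_left_mono gen that) auto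
      then show ?thesis using C(2)[OF that] by (simp add: c_def mult_ac)
    qed
    then show ?thesis by blast
  qed
  moreover have "\<exists>C. \<forall>x Q. 1 \<le> Q \<and> Q \<le> x \<longrightarrow> AP_variance k x Q \<le> C * (x powr \<epsilon> * (x * Q))" if e: "\<epsilon> > 0" and k2: "k = 2" for \<epsilon>
  proof -
    obtain C where C: "C \<ge> 0" "\<And>x Q. 1 \<le> Q \<Longrightarrow> Q \<le> x \<Longrightarrow> AP_variance k x Q \<le> C * x powr \<epsilon> * Z x Q" using main[OF e] by blast
    have "AP_variance k x Q \<le> (C * 4) * (x powr \<epsilon> * (x * Q))" if "1 \<le> Q" "Q \<le> x" for x Q
    proof -
      have "C * x powr \<epsilon> * Z x Q \<le> C * x powr \<epsilon> * (4 * (x * Q))"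
        using C(1) by (intro mult_left_mono two that k2) auto
      then show ?thesis using C(2)[OF that] by (simp add: mult_ac)
    qed
    then show ?thesis by blast
  qed
  ultimately show ?thesis by blast
qed

end
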